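(* Let $B$ be a Hopf algebra with bijective antipode over a field $k$. Equip the algebra $B^{*\mathrm{cop}}$ (which is $B^*$ as an algebra) and the algebra $B$ with the left $\mathscr{D}(B)$-actions $$(\mu\otimes m)\triangleright\beta=\mu''(m\rightharpoonup\beta)\,{S^*}^{-1}(\mu'),\qquad (\mu\otimes m)\triangleright b=(m'bS(m''))\leftharpoonup{S^*}^{-1}(\mu)$$ and the left $\mathscr{D}(B)$-coactions $$\delta(\beta)=(\beta''\otimes 1)\otimes\beta',\qquad \delta(b)=(\varepsilon\otimes b')\otimes b'',$$ where $\mu,\beta\in B^*$, $m,b\in B$. Then: (1) $B^{*\mathrm{cop}}$ and $B$ are Yetter--Drinfeld $\mathscr{D}(B)$-module algebras, and each of them is braided commutative. (2) $B^{*\mathrm{cop}}$ and $B$ are braided symmetric, i.e. $c_{B^{*\mathrm{cop}},B}=c_{B,B^{*\mathrm{cop}}}^{-1}$. (3) The Heisenberg double is their braided product, $\mathscr{H}(B^* )=B^{*\mathrm{cop}}\bowtie B$ (under the identification $\beta\# b=\beta\bowtie b$); it is a braided commutative Yetter--Drinfeld $\mathscr{D}(B)$-module algebra.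
   Context: Notation. $B$ is a Hopf algebra with bijective antipode $S$ over a field $k$; $B^*$ is the dual Hopf algebra (the finite dual of $B$, which is the full linear dual when $\dim B<\infty$), with evaluation pairing $\langle\ ,\ \rangle$, product $\langle\alpha\beta,b\rangle=\langle\alpha,b'\rangle\langle\beta,b''\rangle$, coproduct determined by $\langle\beta,ab\rangle=\langle\beta',a\rangle\langle\beta'',b\rangle$, unit $\varepsilon$ (the counit of $B$), and antipode $S^*$ with inverse ${S^*}^{-1}$. Primes denote Sweedler components in $B$ and in $B^*$ (not in $B^{*\mathrm{cop}}$). Regular actions: $b\rightharpoonup\beta=\langle\beta'',b\rangle\beta'$ and $\beta\leftharpoonup b=\langle\beta',b\rangle\beta''$ (of $B$ on $B^*$); $b\leftharpoonup\beta=\langle\beta,b'\rangle b''$ (right action of $B^*$ on $B$). Heisenberg double: $\mathscr{H}(B^* )=B^*\# B$ is the vector space $B^*\otimes B$ with product $(\alpha\# a)(\beta\# b)=\alpha(a'\rightharpoonup\beta)\# a''b$. Its left $\mathscr{D}(B)$-action is $(\mu\otimes m)\triangleright(\alpha\# a)=\mu'''(m'\rightharpoonup\alpha){S^*}^{-1}(\mu'')\#\bigl((m''aS(m'''))\leftharpoonup{S^*}^{-1}(\mu')\bigr)$ and its left $\mathscr{D}(B)$-coaction is $\delta(\beta\# b)=(\beta''\otimes b')\otimes(\beta'\# b'')$. Drinfeld double: $\mathscr{D}(B)$ is $B^*\otimes B$ with product $(\mu\otimes m)(\nu\otimes n)=\mu(m'\rightharpoonup\nu\leftharpoonup S^{-1}(m'''))\otimes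 m''n$, coproduct $\Delta(\mu\otimes m)=(\mu''\otimes m')\otimes(\mu'\otimes m'')$, and antipode $S_{\mathscr{D}}(\mu\otimes m)=(\varepsilon\otimes S(m))({S^*}^{-1}(\mu)\otimes 1)$. For a Hopf algebra $H$ with bijective antipode, write left coactions as $\delta(u)=u_{(-1)}\otimes u_{(0)}$. A (left--left) Yetter--Drinfeld $H$-module algebra is an algebra $X$ that is a left $H$-module algebra and a left $H$-comodule algebra with $(h'\triangleright x)_{(-1)}h''\otimes(h'\triangleright x)_{(0)}=h'x_{(-1)}\otimes(h''\triangleright x_{(0)})$ for all $h\in H$, $x\in X$. It is braided commutative if $yx=(y_{(-1)}\triangleright x)y_{(0)}$ for all $x,y\in X$. The braiding of Yetter--Drinfeld modules is $c_{U,V}:U\otimes V\to V\otimes U$, $u\otimes v\mapsto(u_{(-1)}\triangleright v)\otimes u_{(0)}$, with inverse $c_{U,V}^{-1}: v\otimes u\mapsto u_{(0)}\otimes S_H^{-1}(u_{(-1)})\triangleright v$. The braided product $X\bowtie Y$ of two Yetter--Drinfeld $H$-module algebras is $X\otimes Y$ with product $(x\bowtie y)(v\bowtie u)=x(y_{(-1)}\triangleright v)\bowtie y_{(0)}u$, diagonal action $h\triangleright(x\bowtie y)=(h'\triangleright x)\bowtie(h''\triangleright y)$ and codiagonal coaction $\delta(x\bowtie y)=x_{(-1)}y_{(-1)}\otimes(x_{(0)}\bowtie y_{(0)})$. *)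

theory Defs
  imports Complex_Main "HOL-Library.Function_Algebras"
begin

section \<open>Vector spaces with carriers and their tensor products\<close>

text \<open>Addition and zero come from the ambient type; the carrier is a subspace of that type.\<close>

record ('k, 'a) vs =
  carr :: "'a set"
  scal :: "'k \<Rightarrow> 'a \<Rightarrow> 'a"

definition vspace :: "('k::field, 'a::ab_group_add, 'z) vs_scheme \<Rightarrow> bool" where
  "vspace V \<longleftrightarrow> vector_space (scal V) \<and> module.subspace (scal V) (carr V)"

definition scalars :: "('k::field, 'k) vs" where
  "scalars = \<lparr>carr = UNIV, scal = (*)\<rparr>"

definition linmap ::
    "('k::field, 'a::ab_group_add, 'y) vs_scheme \<Rightarrow> ('k, 'b::ab_group_add, 'z) vs_scheme
      \<Rightarrow> ('a \<Rightarrow> 'b) \<Rightarrow> bool" where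
  "linmap V W f \<longleftrightarrow>
     (\<forall>x\<in>carr V. f x \<in> carr W) \<and>
     (\<forall>x\<in>carr V. \<forall>y\<in>carr V. f (x + y) = f x + f y) \<and>
     (\<forall>c. \<forall>x\<in>carr V. f (scal V c x) = scal W c (f x))"

definition bilin ::
    "('k::field, 'a::ab_group_add, 'x) vs_scheme \<Rightarrow> ('k, 'b::ab_group_add, 'y) vs_scheme
      \<Rightarrow> ('k, 'c::ab_group_add, 'z) vs_scheme \<Rightarrow> ('a \<Rightarrow> 'b \<Rightarrow> 'c) \<Rightarrow> bool" where
  "bilin U V W f \<longleftrightarrow>
     (\<forall>u\<in>carr U. linmap V W (f u)) \<and> (\<forall>v\<in>carr V. linmap U W (\<lambda>u. f u v))"

text \<open>Over a field, \<open>U \<otimes> V\<close> embeds into the dual of the space of bilinear forms on \<open>U \<times> V\<close>,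
  with \<open>u \<otimes> v\<close> acting as evaluation at \<open>(u, v)\<close>; this embedding is the model used here.
  Its universal property is \<open>tensor_universal\<close> below.\<close>

type_synonym ('k, 'a, 'b) tensor = "('a \<Rightarrow> 'b \<Rightarrow> 'k) \<Rightarrow> 'k"

definition tens ::
    "('k::field, 'a::ab_group_add, 'y) vs_scheme \<Rightarrow> ('k, 'b::ab_group_add, 'z) vs_scheme
      \<Rightarrow> 'a \<Rightarrow> 'b \<Rightarrow> ('k, 'a, 'b) tensor" where
  "tens U V u v = (\<lambda>\<phi>. if bilin U V scalars \<phi> then \<phi> u v else 0)"

definition tspace ::
    "('k::field, 'a::ab_group_add, 'y) vs_scheme \<Rightarrow> ('k, 'b::ab_group_add, 'z) vs_scheme
      \<Rightarrow> ('k, ('k, 'a, 'b) tensor) vs" where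
  "tspace U V =
     \<lparr>carr = module.span (\<lambda>c t \<phi>. c * t \<phi>) {tens U V u v | u v. u \<in> carr U \<and> v \<in> carr V},
      scal = (\<lambda>c t \<phi>. c * t \<phi>)\<rparr>"

text \<open>Sweedler-type sums: \<open>tsum U V t f\<close> is \<open>\<Sum> f u\<^sub>i v\<^sub>i\<close> for a chosen expression
  \<open>t = \<Sum> u\<^sub>i \<otimes> v\<^sub>i\<close>. For bilinear \<open>f\<close> the choice is irrelevant (\<open>tsum_eq\<close> below), and
  \<open>tsum U V t f\<close> is the value at \<open>t\<close> of the linear map induced by \<open>f\<close>.\<close>

definition tsum ::
    "('k::field, 'a::ab_group_add, 'y) vs_scheme \<Rightarrow> ('k, 'b::ab_group_add, 'z) vs_scheme
      \<Rightarrow> ('k, 'a, 'b) tensor \<Rightarrow> ('a \<Rightarrow> 'b \<Rightarrow> 'c::ab_group_add) \<Rightarrow> 'c" where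
  "tsum U V t f =
     (let xs = (SOME xs. set xs \<subseteq> carr U \<times> carr V \<and> t = (\<Sum>(u, v)\<leftarrow>xs. tens U V u v))
      in \<Sum>(u, v)\<leftarrow>xs. f u v)"

text \<open>Elements of \<open>U \<otimes> V \<otimes> W\<close> are bracketed to the left.\<close>

definition tens3 ::
    "('k::field, 'a::ab_group_add, 'x) vs_scheme \<Rightarrow> ('k, 'b::ab_group_add, 'y) vs_scheme
      \<Rightarrow> ('k, 'c::ab_group_add, 'z) vs_scheme \<Rightarrow> 'a \<Rightarrow> 'b \<Rightarrow> 'c
      \<Rightarrow> ('k, ('k, 'a, 'b) tensor, 'c) tensor" where
  "tens3 U V W u v w = tens (tspace U V) W (tens U V u v) w"

subsection \<open>The universal property\<close>

lemma vector_space_fun: "vector_space (\<lambda>(c::'k::field) (t::'x \<Rightarrow> 'k) \<phi>. c * t \<phi>)"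
  by unfold_locales (auto simp: fun_eq_iff algebra_simps)

lemma bilin_scale_left:
  assumes "bilin U V scalars \<phi>" "vspace U" "u \<in> carr U" "v \<in> carr V"
  shows "\<phi> (scal U c u) v = c * \<phi> u v"
  using assms by (auto simp: bilin_def linmap_def scalars_def)

lemma tens_scale:
  assumes "vspace U" "u \<in> carr U" "v \<in> carr V"
  shows "(\<lambda>\<phi>. c * tens U V u v \<phi>) = tens U V (scal U c u) v"
  using assms by (auto simp: tens_def fun_eq_iff bilin_scale_left)

lemma vspace_scal: "vspace U \<Longrightarrow> u \<in> carr U \<Longrightarrow> scal U c u \<in> carr U"
  unfolding vspace_def by (metis module.subspace_scale module_iff_vector_space)

lemma tens_rep:
  assumes "vspace U" "t \<in> carr (tspace U V)"
  shows "\<exists>xs. set xs \<subseteq> carr U \<times> carr V \<and> t = (\<Sum>(u, v)\<leftarrow>xs. tens U V u v)"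
proof -
  interpret F: vector_space "\<lambda>(c::'a) (t::('b \<Rightarrow> 'd \<Rightarrow> 'a) \<Rightarrow> 'a) \<phi>. c * t \<phi>"
    by (rule vector_space_fun)
  have "t \<in> F.span {tens U V u v | u v. u \<in> carr U \<and> v \<in> carr V}"
    using assms(2) by (simp add: tspace_def)
  then show ?thesis
  proof (induction rule: F.span_induct_alt)
    case base
    show ?case by (rule exI[of _ "[]"]) simp
  next
    case (step c x y)
    then obtain u v xs where 1: "x = tens U V u v" "u \<in> carr U" "v \<in> carr V"
      "set xs \<subseteq> carr U \<times> carr V" "y = (\<Sum>(u, v)\<leftarrow>xs. tens U V u v)" by blast
    have "(\<lambda>\<phi>. c * x \<phi>) + y = (\<Sum>(u, v)\<leftarrow>(scal U c u, v) # xs. tens U V u v)"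
      using tens_scale[OF assms(1), of u v V c] 1 by simp
    then show ?case
      using vspace_scal[OF assms(1), of u c] 1 by (intro exI[of _ "(scal U c u, v) # xs"]) auto
  qed
qed

lemma exists_functional:
  assumes "vector_space (s :: 'k::field \<Rightarrow> 'c::ab_group_add \<Rightarrow> 'c)" "d \<noteq> 0"
  shows "\<exists>g. Vector_Spaces.linear s (*) g \<and> g d \<noteq> 0"
proof -
  interpret W: vector_space s by fact
  interpret P: vector_space_pair s "(*) :: 'k \<Rightarrow> 'k \<Rightarrow> 'k"
    by unfold_locales (auto simp: algebra_simps)
  have "W.independent {d}" using assms(2) by simp
  from P.linear_independent_extend[OF this, of "\<lambda>_. 1"] show ?thesis
    by auto
qed

lemma sum_list_tens_apply:
  "bilin U V scalars \<phi> \<Longrightarrow>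
    (\<Sum>(u, v)\<leftarrow>xs. tens U V u v) \<phi> = (\<Sum>(u, v)\<leftarrow>xs. \<phi> u v)"
  by (induction xs) (auto simp: tens_def)

lemma linear_sum_list_pairs:
  assumes "Vector_Spaces.linear s r g"
  shows "g (\<Sum>(u, v)\<leftarrow>xs. f u v) = (\<Sum>(u, v)\<leftarrow>xs. g (f u v))"
proof -
  interpret Vector_Spaces.linear s r g by fact
  show ?thesis by (induction xs) (auto simp: add zero)
qed

lemma tens_reps_agree:
  assumes "vector_space (scal W)" "bilin U V W f"
    and eq: "(\<Sum>(u, v)\<leftarrow>xs. tens U V u v) = (\<Sum>(u, v)\<leftarrow>ys. tens U V u v)"
  shows "(\<Sum>(u, v)\<leftarrow>xs. f u v) = (\<Sum>(u, v)\<leftarrow>ys. f u v)" (is "?x = ?y")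
proof (rule ccontr)
  assume "?x \<noteq> ?y"
  then obtain g where g: "Vector_Spaces.linear (scal W) (*) g" "g (?x - ?y) \<noteq> 0"
    using exists_functional[OF assms(1), of "?x - ?y"] by auto
  interpret G: Vector_Spaces.linear "scal W" "(*)" g by fact
  have b: "bilin U V scalars (\<lambda>u v. g (f u v))"
    using assms(2) by (auto simp: bilin_def linmap_def scalars_def G.add G.scale)
  have "g ?x = g ?y"
    using sum_list_tens_apply[OF b, of xs] sum_list_tens_apply[OF b, of ys] eq
    by (simp add: linear_sum_list_pairs[OF g(1)])
  then show False using g(2) by (simp add: G.diff)
qed

lemma tsum_eq:
  assumes "vector_space (scal W)" "bilin U V W f"
    and "set xs \<subseteq> carr U \<times> carr V" "t = (\<Sum>(u, v)\<leftarrow>xs. tens U V u v)"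
  shows "tsum U V t f = (\<Sum>(u, v)\<leftarrow>xs. f u v)"
proof -
  let ?P = "\<lambda>xs. set xs \<subseteq> carr U \<times> carr V \<and> t = (\<Sum>(u, v)\<leftarrow>xs. tens U V u v)"
  have "?P (SOME xs. ?P xs)" using assms(3,4) by (intro someI[of ?P xs]) simp
  then show ?thesis
    unfolding tsum_def Let_def using assms(4) by (intro tens_reps_agree[OF assms(1,2)]) simp
qed

lemma tens_bilin:
  assumes "vspace U" "vspace V"
  shows "bilin U V (tspace U V) (tens U V)"
proof -
  interpret F: vector_space "\<lambda>(c::'a) (t::('b \<Rightarrow> 'd \<Rightarrow> 'a) \<Rightarrow> 'a) \<phi>. c * t \<phi>"
    by (rule vector_space_fun)
  have mem: "tens U V u v \<in> carr (tspace U V)" if "u \<in> carr U" "v \<in> carr V" for u v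
    using that by (auto simp: tspace_def intro: F.span_base)
  have "tens U V u (v + w) = tens U V u v + tens U V u w"
    and "tens U V (u' + u'') v = tens U V u' v + tens U V u'' v"
    if "u \<in> carr U" "u' \<in> carr U" "u'' \<in> carr U" "v \<in> carr V" "w \<in> carr V" for u u' u'' v w
    using that by (auto simp: tens_def fun_eq_iff bilin_def linmap_def)
  moreover have "tens U V u (scal V c v) = scal (tspace U V) c (tens U V u v)"
    and "tens U V (scal U c u) v = scal (tspace U V) c (tens U V u v)"
    if "u \<in> carr U" "v \<in> carr V" for u v c
    using that by (auto simp: tspace_def tens_def fun_eq_iff bilin_def linmap_def scalars_def)
  ultimately show ?thesis
    unfolding bilin_def linmap_def using mem by simp
qed

lemma tsum_linmap:
  assumes "vspace U" "vspace V" "vspace W" "bilin U V W f"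
  shows "linmap (tspace U V) W (\<lambda>t. tsum U V t f)"
proof -
  interpret F: vector_space "\<lambda>(c::'a) (t::('b \<Rightarrow> 'd \<Rightarrow> 'a) \<Rightarrow> 'a) \<phi>. c * t \<phi>"
    by (rule vector_space_fun)
  have W: "vector_space (scal W)" using assms(3) by (simp add: vspace_def)
  interpret W: vector_space "scal W" by fact
  have subW: "W.subspace (carr W)" using assms(3) by (simp add: vspace_def)
  note eq = tsum_eq[OF W assms(4)]
  show ?thesis
    unfolding linmap_def
  proof (intro conjI ballI allI)
    fix t assume "t \<in> carr (tspace U V)"
    then obtain xs where xs: "set xs \<subseteq> carr U \<times> carr V"
      "t = (\<Sum>(u, v)\<leftarrow>xs. tens U V u v)" using tens_rep[OF assms(1)] by blast
    have "(\<Sum>(u, v)\<leftarrow>xs. f u v) \<in> carr W"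
      using xs(1) assms(4)
      by (induction xs)
        (auto simp: W.subspace_0[OF subW] bilin_def linmap_def intro!: W.subspace_add[OF subW])
    then show "tsum U V t f \<in> carr W" using eq[OF xs] by simp
    fix s assume "s \<in> carr (tspace U V)"
    then obtain ys where ys: "set ys \<subseteq> carr U \<times> carr V"
      "s = (\<Sum>(u, v)\<leftarrow>ys. tens U V u v)" using tens_rep[OF assms(1)] by blast
    show "tsum U V (t + s) f = tsum U V t f + tsum U V s f"
      using eq[OF xs] eq[OF ys] eq[of "xs @ ys" "t + s"] xs ys by simp
  next
    fix c t assume "t \<in> carr (tspace U V)"
    then obtain xs where xs: "set xs \<subseteq> carr U \<times> carr V"
      "t = (\<Sum>(u, v)\<leftarrow>xs. tens U V u v)" using tens_rep[OF assms(1)] by blast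
    let ?ys = "map (\<lambda>(u, v). (scal U c u, v)) xs"
    have "set ?ys \<subseteq> carr U \<times> carr V" using xs(1) vspace_scal[OF assms(1)] by auto
    moreover have "scal (tspace U V) c (\<Sum>(u, v)\<leftarrow>xs. tens U V u v)
        = (\<Sum>(u, v)\<leftarrow>?ys. tens U V u v)"
      using xs(1)
    proof (induction xs)
      case (Cons a xs)
      then show ?case
        using tens_scale[OF assms(1), of "fst a" "snd a" V c]
        by (auto simp: tspace_def fun_eq_iff algebra_simps)
    qed (simp add: tspace_def fun_eq_iff)
    ultimately have "tsum U V (scal (tspace U V) c t) f = (\<Sum>(u, v)\<leftarrow>?ys. f u v)"
      using eq xs(2) by blast
    also have "\<dots> = scal W c (\<Sum>(u, v)\<leftarrow>xs. f u v)"
      using xs(1) assms(4)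
      by (induction xs) (auto simp: W.scale_right_distrib bilin_def linmap_def)
    finally show "tsum U V (scal (tspace U V) c t) f = scal W c (tsum U V t f)"
      using eq[OF xs] by simp
  qed
qed

theorem tensor_universal:
  assumes "vspace U" "vspace V" "vspace W" "bilin U V W f"
  shows "\<exists>g. linmap (tspace U V) W g \<and> (\<forall>u\<in>carr U. \<forall>v\<in>carr V. g (tens U V u v) = f u v)"
    and "\<And>g h. linmap (tspace U V) W g \<Longrightarrow> linmap (tspace U V) W h \<Longrightarrow>
      (\<forall>u\<in>carr U. \<forall>v\<in>carr V. g (tens U V u v) = h (tens U V u v)) \<Longrightarrow>
      \<forall>t\<in>carr (tspace U V). g t = h t"
proof -
  have W: "vector_space (scal W)" using assms(3) by (simp add: vspace_def)
  have "tsum U V (tens U V u v) f = f u v" if "u \<in> carr U" "v \<in> carr V" for u v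
    using that tsum_eq[OF W assms(4), of "[(u, v)]"] by simp
  with tsum_linmap[OF assms]
  show "\<exists>g. linmap (tspace U V) W g \<and> (\<forall>u\<in>carr U. \<forall>v\<in>carr V. g (tens U V u v) = f u v)"
    by blast
next
  fix g h
  assume g: "linmap (tspace U V) W g" and h: "linmap (tspace U V) W h"
    and gh: "\<forall>u\<in>carr U. \<forall>v\<in>carr V. g (tens U V u v) = h (tens U V u v)"
  interpret F: vector_space "\<lambda>(c::'a) (t::('b \<Rightarrow> 'd \<Rightarrow> 'a) \<Rightarrow> 'a) \<phi>. c * t \<phi>"
    by (rule vector_space_fun)
  let ?S = "{tens U V u v | u v. u \<in> carr U \<and> v \<in> carr V}"
  show "\<forall>t\<in>carr (tspace U V). g t = h t"
  proof
    fix t assume "t \<in> carr (tspace U V)"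
    then have "t \<in> F.span ?S" by (simp add: tspace_def)
    then have "t \<in> F.span ?S \<and> g t = h t"
    proof (induction rule: F.span_induct_alt)
      case base
      have z: "f' 0 = 0" if "linmap (tspace U V) W f'" for f' :: "(('b \<Rightarrow> 'd \<Rightarrow> 'a) \<Rightarrow> 'a) \<Rightarrow> 'f"
      proof -
        have "0 \<in> carr (tspace U V)" by (simp add: tspace_def F.span_zero)
        then have "f' (0 + 0) = f' 0 + f' 0" using that unfolding linmap_def by blast
        then show ?thesis by simp
      qed
      show ?case using z[OF g] z[OF h] F.span_zero by metis
    next
      case (step c x y)
      from step(1) have x: "x \<in> F.span ?S" "g x = h x" using gh by (auto intro: F.span_base)
      have cx: "(\<lambda>\<phi>. c * x \<phi>) \<in> F.span ?S" using x F.span_scale by blast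
      have g': "\<And>x y. x \<in> F.span ?S \<Longrightarrow> y \<in> F.span ?S \<Longrightarrow> g (x + y) = g x + g y"
        "\<And>x c. x \<in> F.span ?S \<Longrightarrow> g (\<lambda>\<phi>. c * x \<phi>) = scal W c (g x)"
        using g unfolding linmap_def tspace_def by simp_all
      have h': "\<And>x y. x \<in> F.span ?S \<Longrightarrow> y \<in> F.span ?S \<Longrightarrow> h (x + y) = h x + h y"
        "\<And>x c. x \<in> F.span ?S \<Longrightarrow> h (\<lambda>\<phi>. c * x \<phi>) = scal W c (h x)"
        using h unfolding linmap_def tspace_def by simp_all
      have y: "y \<in> F.span ?S" "g y = h y" using step by auto
      show ?case
        using g'(1)[OF cx y(1)] h'(1)[OF cx y(1)] g'(2)[OF x(1)] h'(2)[OF x(1)] x(2) y(2)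
          F.span_add[OF cx y(1)] by metis
    qed
    then show "g t = h t" by simp
  qed
qed


section \<open>Algebras and Hopf algebras\<close>

record ('k, 'a) alg = "('k, 'a) vs" +
  mul :: "'a \<Rightarrow> 'a \<Rightarrow> 'a"
  unity :: 'a

definition algebra :: "('k::field, 'a::ab_group_add, 'z) alg_scheme \<Rightarrow> bool" where
  "algebra A \<longleftrightarrow>
     vspace A \<and> bilin A A A (mul A) \<and> unity A \<in> carr A \<and>
     (\<forall>x\<in>carr A. \<forall>y\<in>carr A. \<forall>z\<in>carr A. mul A (mul A x y) z = mul A x (mul A y z)) \<and>
     (\<forall>x\<in>carr A. mul A (unity A) x = x \<and> mul A x (unity A) = x)"

record ('k, 'a) hopf = "('k, 'a) alg" +
  comul :: "'a \<Rightarrow> ('k, 'a, 'a) tensor"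
  counit :: "'a \<Rightarrow> 'k"
  antip :: "'a \<Rightarrow> 'a"

text \<open>\<open>sw H h (\<lambda>h' h''. e)\<close> is Sweedler's \<open>\<Sum> e\<close> over \<open>\<Delta> h = h' \<otimes> h''\<close>; \<open>sw3\<close> is its threefold
  version, over \<open>(\<Delta> \<otimes> id) (\<Delta> h) = h' \<otimes> h'' \<otimes> h'''\<close>.\<close>

definition sw ::
    "('k::field, 'a::ab_group_add, 'z) hopf_scheme \<Rightarrow> 'a
      \<Rightarrow> ('a \<Rightarrow> 'a \<Rightarrow> 'c::ab_group_add) \<Rightarrow> 'c" where
  "sw H h f = tsum H H (comul H h) f"

definition sw3 ::
    "('k::field, 'a::ab_group_add, 'z) hopf_scheme \<Rightarrow> 'a
      \<Rightarrow> ('a \<Rightarrow> 'a \<Rightarrow> 'a \<Rightarrow> 'c::ab_group_add) \<Rightarrow> 'c" where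
  "sw3 H h f = sw H h (\<lambda>x h3. sw H x (\<lambda>h1 h2. f h1 h2 h3))"

definition coalgebra :: "('k::field, 'a::ab_group_add, 'z) hopf_scheme \<Rightarrow> bool" where
  "coalgebra C \<longleftrightarrow>
     vspace C \<and> linmap C (tspace C C) (comul C) \<and> linmap C scalars (counit C) \<and>
     (\<forall>c\<in>carr C.
        sw C c (\<lambda>x c3. sw C x (\<lambda>c1 c2. tens3 C C C c1 c2 c3)) =
        sw C c (\<lambda>c1 x. sw C x (\<lambda>c2 c3. tens3 C C C c1 c2 c3))) \<and>
     (\<forall>c\<in>carr C. sw C c (\<lambda>c1 c2. scal C (counit C c1) c2) = c \<and>
                 sw C c (\<lambda>c1 c2. scal C (counit C c2) c1) = c)"

definition bialgebra :: "('k::field, 'a::ab_group_add, 'z) hopf_scheme \<Rightarrow> bool" where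
  "bialgebra H \<longleftrightarrow>
     algebra H \<and> coalgebra H \<and>
     comul H (unity H) = tens H H (unity H) (unity H) \<and>
     counit H (unity H) = 1 \<and>
     (\<forall>a\<in>carr H. \<forall>b\<in>carr H.
        comul H (mul H a b) =
          sw H a (\<lambda>a1 a2. sw H b (\<lambda>b1 b2. tens H H (mul H a1 b1) (mul H a2 b2)))) \<and>
     (\<forall>a\<in>carr H. \<forall>b\<in>carr H. counit H (mul H a b) = counit H a * counit H b)"

definition hopf_algebra :: "('k::field, 'a::ab_group_add, 'z) hopf_scheme \<Rightarrow> bool" where
  "hopf_algebra H \<longleftrightarrow>
     bialgebra H \<and> linmap H H (antip H) \<and>
     (\<forall>h\<in>carr H.
        sw H h (\<lambda>h1 h2. mul H (antip H h1) h2) = scal H (counit H h) (unity H) \<and>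
        sw H h (\<lambda>h1 h2. mul H h1 (antip H h2)) = scal H (counit H h) (unity H))"

definition hopf_algebra_bij :: "('k::field, 'a::ab_group_add, 'z) hopf_scheme \<Rightarrow> bool" where
  "hopf_algebra_bij H \<longleftrightarrow> hopf_algebra H \<and> bij_betw (antip H) (carr H) (carr H)"

definition antip_inv :: "('k::field, 'a::ab_group_add, 'z) hopf_scheme \<Rightarrow> 'a \<Rightarrow> 'a" where
  "antip_inv H = inv_into (carr H) (antip H)"


section \<open>The dual Hopf algebra and the regular actions\<close>

text \<open>A linear functional on \<open>carr B\<close> is represented by the function that extends it by \<open>0\<close>
  outside \<open>carr B\<close>, so that equality of functionals is equality of functions.\<close>

definition ext0 :: "('k::field, 'b::ab_group_add, 'z) vs_scheme \<Rightarrow> ('b \<Rightarrow> 'k) \<Rightarrow> ('b \<Rightarrow> 'k)" where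
  "ext0 B \<beta> = (\<lambda>b. if b \<in> carr B then \<beta> b else 0)"

definition ideal :: "('k::field, 'b::ab_group_add, 'z) alg_scheme \<Rightarrow> 'b set \<Rightarrow> bool" where
  "ideal A I \<longleftrightarrow> I \<subseteq> carr A \<and> module.subspace (scal A) I \<and>
     (\<forall>a\<in>carr A. \<forall>x\<in>I. mul A a x \<in> I \<and> mul A x a \<in> I)"

definition finite_codim :: "('k::field, 'b::ab_group_add, 'z) vs_scheme \<Rightarrow> 'b set \<Rightarrow> bool" where
  "finite_codim V I \<longleftrightarrow>
     (\<exists>F. finite F \<and> F \<subseteq> carr V \<and> carr V = module.span (scal V) (F \<union> I))"

definition dual_vs :: "('k::field, 'b::ab_group_add, 'z) alg_scheme \<Rightarrow> ('k, 'b \<Rightarrow> 'k) vs" where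
  "dual_vs B =
     \<lparr>carr = {\<beta>. linmap B scalars \<beta> \<and> (\<forall>b. b \<notin> carr B \<longrightarrow> \<beta> b = 0) \<and>
               (\<exists>I. ideal B I \<and> finite_codim B I \<and> (\<forall>x\<in>I. \<beta> x = 0))},
      scal = (\<lambda>c \<beta> b. c * \<beta> b)\<rparr>"

definition dual :: "('k::field, 'b::ab_group_add, 'z) hopf_scheme \<Rightarrow> ('k, 'b \<Rightarrow> 'k) hopf" where
  "dual B =
     \<lparr>carr = carr (dual_vs B),
      scal = scal (dual_vs B),
      mul = (\<lambda>\<alpha> \<beta>. ext0 B (\<lambda>b. sw B b (\<lambda>b1 b2. \<alpha> b1 * \<beta> b2))),
      unity = ext0 B (counit B),
      comul = (\<lambda>\<beta>. THE t. t \<in> carr (tspace (dual_vs B) (dual_vs B)) \<and>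
                 (\<forall>a\<in>carr B. \<forall>b\<in>carr B.
                    \<beta> (mul B a b) = tsum (dual_vs B) (dual_vs B) t (\<lambda>\<beta>1 \<beta>2. \<beta>1 a * \<beta>2 b))),
      counit = (\<lambda>\<beta>. \<beta> (unity B)),
      antip = (\<lambda>\<beta>. ext0 B (\<lambda>b. \<beta> (antip B b)))\<rparr>"

text \<open>\<open>b \<rightharpoonup> \<beta>\<close>, \<open>\<beta> \<leftharpoonup> b\<close> and \<open>b \<leftharpoonup> \<beta>\<close>, respectively.\<close>

definition lreg :: "('k::field, 'b::ab_group_add, 'z) hopf_scheme \<Rightarrow> 'b \<Rightarrow> ('b \<Rightarrow> 'k) \<Rightarrow> ('b \<Rightarrow> 'k)" where
  "lreg B b \<beta> = sw (dual B) \<beta> (\<lambda>\<beta>1 \<beta>2. scal (dual B) (\<beta>2 b) \<beta>1)"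

definition rreg :: "('k::field, 'b::ab_group_add, 'z) hopf_scheme \<Rightarrow> ('b \<Rightarrow> 'k) \<Rightarrow> 'b \<Rightarrow> ('b \<Rightarrow> 'k)" where
  "rreg B \<beta> b = sw (dual B) \<beta> (\<lambda>\<beta>1 \<beta>2. scal (dual B) (\<beta>1 b) \<beta>2)"

definition rreg_alg :: "('k::field, 'b::ab_group_add, 'z) hopf_scheme \<Rightarrow> 'b \<Rightarrow> ('b \<Rightarrow> 'k) \<Rightarrow> 'b" where
  "rreg_alg B b \<beta> = sw B b (\<lambda>b1 b2. scal B (\<beta> b1) b2)"


section \<open>The Drinfeld double\<close>

abbreviation dtens ::
    "('k::field, 'b::ab_group_add, 'z) hopf_scheme \<Rightarrow> ('b \<Rightarrow> 'k) \<Rightarrow> 'b \<Rightarrow> ('k, 'b \<Rightarrow> 'k, 'b) tensor" where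
  "dtens B \<equiv> tens (dual B) B"

abbreviation dsum ::
    "('k::field, 'b::ab_group_add, 'z) hopf_scheme \<Rightarrow> ('k, 'b \<Rightarrow> 'k, 'b) tensor
      \<Rightarrow> (('b \<Rightarrow> 'k) \<Rightarrow> 'b \<Rightarrow> 'c::ab_group_add) \<Rightarrow> 'c" where
  "dsum B \<equiv> tsum (dual B) B"

abbreviation dspace ::
    "('k::field, 'b::ab_group_add, 'z) hopf_scheme \<Rightarrow> ('k, ('k, 'b \<Rightarrow> 'k, 'b) tensor) vs" where
  "dspace B \<equiv> tspace (dual B) B"

definition double_mul ::
    "('k::field, 'b::ab_group_add, 'z) hopf_scheme \<Rightarrow> ('k, 'b \<Rightarrow> 'k, 'b) tensor
      \<Rightarrow> ('k, 'b \<Rightarrow> 'k, 'b) tensor \<Rightarrow> ('k, 'b \<Rightarrow> 'k, 'b) tensor" where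
  "double_mul B s t =
     dsum B s (\<lambda>\<mu> m. dsum B t (\<lambda>\<nu> n.
       sw3 B m (\<lambda>m1 m2 m3.
         dtens B (mul (dual B) \<mu> (rreg B (lreg B m1 \<nu>) (antip_inv B m3))) (mul B m2 n))))"

definition double ::
    "('k::field, 'b::ab_group_add, 'z) hopf_scheme \<Rightarrow> ('k, ('k, 'b \<Rightarrow> 'k, 'b) tensor) hopf" where
  "double B =
     \<lparr>carr = carr (dspace B),
      scal = scal (dspace B),
      mul = double_mul B,
      unity = dtens B (unity (dual B)) (unity B),
      comul = (\<lambda>s. dsum B s (\<lambda>\<mu> m. sw (dual B) \<mu> (\<lambda>\<mu>1 \<mu>2. sw B m (\<lambda>m1 m2.
                tens (dspace B) (dspace B) (dtens B \<mu>2 m1) (dtens B \<mu>1 m2))))),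
      counit = (\<lambda>s. dsum B s (\<lambda>\<mu> m. counit (dual B) \<mu> * counit B m)),
      antip = (\<lambda>s. dsum B s (\<lambda>\<mu> m.
                double_mul B (dtens B (unity (dual B)) (antip B m))
                             (dtens B (antip_inv (dual B) \<mu>) (unity B))))\<rparr>"


section \<open>Yetter--Drinfeld module algebras\<close>

record ('k, 'x, 'h) yd_alg = "('k, 'x) alg" +
  act :: "'h \<Rightarrow> 'x \<Rightarrow> 'x"
  coact :: "'x \<Rightarrow> ('k, 'h, 'x) tensor"

text \<open>Sum over \<open>\<delta> x = x\<^sub>(\<^sub>-\<^sub>1\<^sub>) \<otimes> x\<^sub>(\<^sub>0\<^sub>)\<close>.\<close>

definition cosw ::
    "('k::field, 'h::ab_group_add, 'y) hopf_scheme \<Rightarrow> ('k, 'x::ab_group_add, 'h, 'z) yd_alg_scheme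
      \<Rightarrow> 'x \<Rightarrow> ('h \<Rightarrow> 'x \<Rightarrow> 'c::ab_group_add) \<Rightarrow> 'c" where
  "cosw H X x f = tsum H X (coact X x) f"

definition module_algebra ::
    "('k::field, 'h::ab_group_add, 'y) hopf_scheme
      \<Rightarrow> ('k, 'x::ab_group_add, 'h, 'z) yd_alg_scheme \<Rightarrow> bool" where
  "module_algebra H X \<longleftrightarrow>
     algebra X \<and> bilin H X X (act X) \<and>
     (\<forall>x\<in>carr X. act X (unity H) x = x) \<and>
     (\<forall>g\<in>carr H. \<forall>h\<in>carr H. \<forall>x\<in>carr X. act X (mul H g h) x = act X g (act X h x)) \<and>
     (\<forall>h\<in>carr H. act X h (unity X) = scal X (counit H h) (unity X)) \<and>
     (\<forall>h\<in>carr H. \<forall>x\<in>carr X. \<forall>y\<in>carr X.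
        act X h (mul X x y) = sw H h (\<lambda>h1 h2. mul X (act X h1 x) (act X h2 y)))"

definition comodule_algebra ::
    "('k::field, 'h::ab_group_add, 'y) hopf_scheme
      \<Rightarrow> ('k, 'x::ab_group_add, 'h, 'z) yd_alg_scheme \<Rightarrow> bool" where
  "comodule_algebra H X \<longleftrightarrow>
     algebra X \<and> linmap X (tspace H X) (coact X) \<and>
     (\<forall>x\<in>carr X.
        cosw H X x (\<lambda>g x0. sw H g (\<lambda>g1 g2. tens3 H H X g1 g2 x0)) =
        cosw H X x (\<lambda>g1 y. cosw H X y (\<lambda>g2 x0. tens3 H H X g1 g2 x0))) \<and>
     (\<forall>x\<in>carr X. cosw H X x (\<lambda>g x0. scal X (counit H g) x0) = x) \<and>
     coact X (unity X) = tens H X (unity H) (unity X) \<and>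
     (\<forall>x\<in>carr X. \<forall>y\<in>carr X.
        coact X (mul X x y) =
          cosw H X x (\<lambda>g x0. cosw H X y (\<lambda>h y0. tens H X (mul H g h) (mul X x0 y0))))"

definition yd_module_algebra ::
    "('k::field, 'h::ab_group_add, 'y) hopf_scheme
      \<Rightarrow> ('k, 'x::ab_group_add, 'h, 'z) yd_alg_scheme \<Rightarrow> bool" where
  "yd_module_algebra H X \<longleftrightarrow>
     hopf_algebra_bij H \<and> module_algebra H X \<and> comodule_algebra H X \<and>
     (\<forall>h\<in>carr H. \<forall>x\<in>carr X.
        sw H h (\<lambda>h1 h2. cosw H X (act X h1 x) (\<lambda>g y. tens H X (mul H g h2) y)) =
        sw H h (\<lambda>h1 h2. cosw H X x (\<lambda>g x0. tens H X (mul H h1 g) (act X h2 x0))))"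

definition braided_commutative ::
    "('k::field, 'h::ab_group_add, 'y) hopf_scheme
      \<Rightarrow> ('k, 'x::ab_group_add, 'h, 'z) yd_alg_scheme \<Rightarrow> bool" where
  "braided_commutative H X \<longleftrightarrow>
     (\<forall>x\<in>carr X. \<forall>y\<in>carr X. mul X y x = cosw H X y (\<lambda>g y0. mul X (act X g x) y0))"

definition braiding ::
    "('k::field, 'h::ab_group_add, 'y) hopf_scheme
      \<Rightarrow> ('k, 'u::ab_group_add, 'h, 'z) yd_alg_scheme \<Rightarrow> ('k, 'v::ab_group_add, 'h, 'w) yd_alg_scheme
      \<Rightarrow> ('k, 'u, 'v) tensor \<Rightarrow> ('k, 'v, 'u) tensor" where
  "braiding H U V t =
     tsum U V t (\<lambda>u v. cosw H U u (\<lambda>g u0. tens V U (act V g v) u0))"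

definition braided_symmetric ::
    "('k::field, 'h::ab_group_add, 'y) hopf_scheme
      \<Rightarrow> ('k, 'u::ab_group_add, 'h, 'z) yd_alg_scheme \<Rightarrow> ('k, 'v::ab_group_add, 'h, 'w) yd_alg_scheme
      \<Rightarrow> bool" where
  "braided_symmetric H U V \<longleftrightarrow>
     bij_betw (braiding H V U) (carr (tspace V U)) (carr (tspace U V)) \<and>
     (\<forall>t\<in>carr (tspace U V).
        braiding H U V t = inv_into (carr (tspace V U)) (braiding H V U) t)"

definition braided_product ::
    "('k::field, 'h::ab_group_add, 'y) hopf_scheme
      \<Rightarrow> ('k, 'u::ab_group_add, 'h, 'z) yd_alg_scheme \<Rightarrow> ('k, 'v::ab_group_add, 'h, 'w) yd_alg_scheme
      \<Rightarrow> ('k, ('k, 'u, 'v) tensor, 'h) yd_alg" where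
  "braided_product H X Y =
     \<lparr>carr = carr (tspace X Y),
      scal = scal (tspace X Y),
      mul = (\<lambda>s t. tsum X Y s (\<lambda>x y. tsum X Y t (\<lambda>v u.
               cosw H Y y (\<lambda>g y0. tens X Y (mul X x (act X g v)) (mul Y y0 u))))),
      unity = tens X Y (unity X) (unity Y),
      act = (\<lambda>h t. tsum X Y t (\<lambda>x y. sw H h (\<lambda>h1 h2. tens X Y (act X h1 x) (act Y h2 y)))),
      coact = (\<lambda>t. tsum X Y t (\<lambda>x y. cosw H X x (\<lambda>g x0. cosw H Y y (\<lambda>h y0.
                tens H (tspace X Y) (mul H g h) (tens X Y x0 y0)))))\<rparr>"

definition same_yd_algebra ::
    "('k::field, 'h::ab_group_add, 'y) hopf_scheme
      \<Rightarrow> ('k, 'x::ab_group_add, 'h, 'z) yd_alg_scheme \<Rightarrow> ('k, 'x, 'h, 'w) yd_alg_scheme \<Rightarrow> bool" where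
  "same_yd_algebra H X Y \<longleftrightarrow>
     carr X = carr Y \<and> scal X = scal Y \<and> unity X = unity Y \<and>
     (\<forall>x\<in>carr X. \<forall>y\<in>carr X. mul X x y = mul Y x y) \<and>
     (\<forall>h\<in>carr H. \<forall>x\<in>carr X. act X h x = act Y h x) \<and>
     (\<forall>x\<in>carr X. coact X x = coact Y x)"


section \<open>The three Yetter--Drinfeld algebras over the double\<close>

text \<open>\<open>B\<^sup>*\<^sup>c\<^sup>o\<^sup>p\<close>: only its algebra structure, which is that of \<open>B\<^sup>*\<close>, enters.\<close>

definition dual_yd ::
    "('k::field, 'b::ab_group_add, 'z) hopf_scheme
      \<Rightarrow> ('k, 'b \<Rightarrow> 'k, ('k, 'b \<Rightarrow> 'k, 'b) tensor) yd_alg" where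
  "dual_yd B =
     \<lparr>carr = carr (dual B),
      scal = scal (dual B),
      mul = mul (dual B),
      unity = unity (dual B),
      act = (\<lambda>h \<beta>. dsum B h (\<lambda>\<mu> m. sw (dual B) \<mu> (\<lambda>\<mu>1 \<mu>2.
               mul (dual B) (mul (dual B) \<mu>2 (lreg B m \<beta>)) (antip_inv (dual B) \<mu>1)))),
      coact = (\<lambda>\<beta>. sw (dual B) \<beta> (\<lambda>\<beta>1 \<beta>2. tens (dspace B) (dual B) (dtens B \<beta>2 (unity B)) \<beta>1))\<rparr>"

definition self_yd ::
    "('k::field, 'b::ab_group_add, 'z) hopf_scheme
      \<Rightarrow> ('k, 'b, ('k, 'b \<Rightarrow> 'k, 'b) tensor) yd_alg" where
  "self_yd B =
     \<lparr>carr = carr B,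
      scal = scal B,
      mul = mul B,
      unity = unity B,
      act = (\<lambda>h b. dsum B h (\<lambda>\<mu> m. sw B m (\<lambda>m1 m2.
               rreg_alg B (mul B (mul B m1 b) (antip B m2)) (antip_inv (dual B) \<mu>)))),
      coact = (\<lambda>b. sw B b (\<lambda>b1 b2. tens (dspace B) B (dtens B (unity (dual B)) b1) b2))\<rparr>"

definition heisenberg ::
    "('k::field, 'b::ab_group_add, 'z) hopf_scheme
      \<Rightarrow> ('k, ('k, 'b \<Rightarrow> 'k, 'b) tensor, ('k, 'b \<Rightarrow> 'k, 'b) tensor) yd_alg" where
  "heisenberg B =
     \<lparr>carr = carr (dspace B),
      scal = scal (dspace B),
      mul = (\<lambda>s t. dsum B s (\<lambda>\<alpha> a. dsum B t (\<lambda>\<beta> b. sw B a (\<lambda>a1 a2.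
               dtens B (mul (dual B) \<alpha> (lreg B a1 \<beta>)) (mul B a2 b))))),
      unity = dtens B (unity (dual B)) (unity B),
      act = (\<lambda>h t. dsum B h (\<lambda>\<mu> m. dsum B t (\<lambda>\<alpha> a.
               sw3 (dual B) \<mu> (\<lambda>\<mu>1 \<mu>2 \<mu>3. sw3 B m (\<lambda>m1 m2 m3.
                 dtens B
                   (mul (dual B) (mul (dual B) \<mu>3 (lreg B m1 \<alpha>)) (antip_inv (dual B) \<mu>2))
                   (rreg_alg B (mul B (mul B m2 a) (antip B m3)) (antip_inv (dual B) \<mu>1))))))),
      coact = (\<lambda>t. dsum B t (\<lambda>\<beta> b. sw (dual B) \<beta> (\<lambda>\<beta>1 \<beta>2. sw B b (\<lambda>b1 b2.
                tens (dspace B) (dspace B) (dtens B \<beta>2 b1) (dtens B \<beta>1 b2)))))\<rparr>"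

end

theory Submission
  imports Defs
begin

text \<open>The structure maps of the Drinfeld double and of the Heisenberg double are given by formulas in
  which the coproduct of \<open>B\<^sup>*\<close> occurs; that coproduct only becomes visible after pairing with
  elements of \<open>B\<close>. So every identity is tested against the functionals
  \<open>\<alpha> \<otimes> a \<mapsto> \<langle>\<alpha>, x\<rangle> \<phi>(a)\<close>, or \<open>\<alpha> \<otimes> a \<mapsto> \<langle>\<alpha>, x'\<rangle> \<phi>(x''a)\<close>, with \<open>x \<in> B\<close> and a linear form \<open>\<phi>\<close> on
  \<open>B\<close>: both families separate points, and under them the Sweedler components of elements of \<open>B\<^sup>*\<close>
  disappear, which leaves an identity between Sweedler sums in \<open>B\<close> alone. The second family
  consists of the matrix coefficients of the right representation \<open>x \<mapsto> \<langle>\<alpha>, x'\<rangle> x''a\<close> of the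
  Heisenberg double on \<open>B\<close>; identities that involve its product are short in terms of them.

  \<open>B\<^sup>*\<close> and \<open>B\<close> sit inside the Heisenberg double as \<open>\<beta> # 1\<close> and \<open>\<epsilon> # b\<close>, stable under product, action
  and coaction, so they inherit the Yetter--Drinfeld condition and braided commutativity from it.\<close>

section \<open>Tensors and functionals\<close>

lemma vspace_scalars [simp]: "vspace scalars"
  unfolding vspace_def scalars_def
  by (simp add: module.subspace_UNIV module_iff_vector_space vector_space_def algebra_simps)

lemma vspace_tspace [simp]:
  fixes U :: "('a::field, 'b::ab_group_add, 'c) vs_scheme" and V :: "('a, 'd::ab_group_add, 'e) vs_scheme"
  shows "vspace (tspace U V)"
proof -
  interpret F: vector_space "\<lambda>(c::'a) (t::('b \<Rightarrow> 'd \<Rightarrow> 'a) \<Rightarrow> 'a) \<phi>. c * t \<phi>"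
    by (rule vector_space_fun)
  show ?thesis
    using F.vector_space_axioms F.subspace_span by (simp add: vspace_def tspace_def)
qed

lemma carr_scalars [simp]: "x \<in> carr scalars"
  by (simp add: scalars_def)

lemma scal_scalars [simp]: "scal scalars c x = c * x"
  by (simp add: scalars_def)

lemma vspace_vector_space: "vspace V \<Longrightarrow> vector_space (scal V)"
  by (simp add: vspace_def)

lemma vspace_add: "vspace V \<Longrightarrow> x \<in> carr V \<Longrightarrow> y \<in> carr V \<Longrightarrow> x + y \<in> carr V"
  unfolding vspace_def by (metis module.subspace_add module_iff_vector_space)

lemma vspace_zero: "vspace V \<Longrightarrow> 0 \<in> carr V"
  unfolding vspace_def by (metis module.subspace_0 module_iff_vector_space)

lemma vspace_diff: "vspace V \<Longrightarrow> x \<in> carr V \<Longrightarrow> y \<in> carr V \<Longrightarrow> x - y \<in> carr V"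
  unfolding vspace_def by (metis module.subspace_diff module_iff_vector_space)

lemma vspace_sum_list:
  "vspace V \<Longrightarrow> (\<And>z. z \<in> set zs \<Longrightarrow> f z \<in> carr V) \<Longrightarrow> (\<Sum>z\<leftarrow>zs. f z) \<in> carr V"
  by (induction zs) (auto simp: vspace_zero vspace_add)

lemma linmap_mem: "linmap V W f \<Longrightarrow> x \<in> carr V \<Longrightarrow> f x \<in> carr W"
  by (simp add: linmap_def)

lemma linmap_add: "linmap V W f \<Longrightarrow> x \<in> carr V \<Longrightarrow> y \<in> carr V \<Longrightarrow> f (x + y) = f x + f y"
  by (simp add: linmap_def)

lemma linmap_scal: "linmap V W f \<Longrightarrow> x \<in> carr V \<Longrightarrow> f (scal V c x) = scal W c (f x)"
  by (simp add: linmap_def)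

lemma linmap_zero: "linmap V W f \<Longrightarrow> vspace V \<Longrightarrow> f 0 = 0"
  using linmap_add[of V W f 0 0] vspace_zero[of V] by simp

lemma linmap_diff:
  "linmap V W f \<Longrightarrow> vspace V \<Longrightarrow> x \<in> carr V \<Longrightarrow> y \<in> carr V \<Longrightarrow> f (x - y) = f x - f y"
  using linmap_add[of V W f "x - y" y] vspace_diff[of V x y] by simp

lemma linmap_sum_list:
  assumes "linmap V W g" "vspace V" "\<And>z. z \<in> set zs \<Longrightarrow> f z \<in> carr V"
  shows "g (\<Sum>z\<leftarrow>zs. f z) = (\<Sum>z\<leftarrow>zs. g (f z))"
  using assms(3)
  by (induction zs)
    (simp_all add: linmap_zero[OF assms(1,2)] linmap_add[OF assms(1)] vspace_sum_list[OF assms(2)])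

lemma vspace_sum: "vspace V \<Longrightarrow> (\<And>z. z \<in> S \<Longrightarrow> f z \<in> carr V) \<Longrightarrow> (\<Sum>z\<in>S. f z) \<in> carr V"
  by (induction S rule: infinite_finite_induct) (auto simp: vspace_zero vspace_add)

lemma linmap_sum:
  assumes "linmap V W g" "vspace V" "\<And>z. z \<in> S \<Longrightarrow> f z \<in> carr V"
  shows "g (\<Sum>z\<in>S. f z) = (\<Sum>z\<in>S. g (f z))"
  using assms(3)
  by (induction S rule: infinite_finite_induct)
    (simp_all add: linmap_zero[OF assms(1,2)] linmap_add[OF assms(1)] vspace_sum[OF assms(2)])

lemma linmap_comp: "linmap W Z f \<Longrightarrow> linmap V W g \<Longrightarrow> linmap V Z (\<lambda>z. f (g z))"
  by (simp add: linmap_def)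

lemma linmap_cong:
  "(\<And>x. x \<in> carr V \<Longrightarrow> f x = g x) \<Longrightarrow> vspace V \<Longrightarrow> linmap V W f \<longleftrightarrow> linmap V W g"
  by (simp add: linmap_def vspace_add vspace_scal)

lemma bilinI:
  assumes "\<And>u. u \<in> carr U \<Longrightarrow> linmap V W (f u)" "\<And>v. v \<in> carr V \<Longrightarrow> linmap U W (\<lambda>u. f u v)"
  shows "bilin U V W f"
  using assms by (simp add: bilin_def)

lemma bilin_left: "bilin U V W f \<Longrightarrow> v \<in> carr V \<Longrightarrow> linmap U W (\<lambda>u. f u v)"
  and bilin_right: "bilin U V W f \<Longrightarrow> u \<in> carr U \<Longrightarrow> linmap V W (f u)"
  by (simp_all add: bilin_def)

lemma bilin_mem: "bilin U V W f \<Longrightarrow> u \<in> carr U \<Longrightarrow> v \<in> carr V \<Longrightarrow> f u v \<in> carr W"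
  by (simp add: bilin_def linmap_def)

lemma bilin_linmap_comp: "linmap W Z g \<Longrightarrow> bilin U V W f \<Longrightarrow> bilin U V Z (\<lambda>u v. g (f u v))"
  by (rule bilinI; rule linmap_comp[of W Z g]; simp add: bilin_left bilin_right)

text \<open>The list chosen by \<open>tsum\<close>: sums over it can be exchanged and scaled without any linearity.\<close>

definition tlist ::
    "('k::field, 'a::ab_group_add, 'y) vs_scheme \<Rightarrow> ('k, 'b::ab_group_add, 'z) vs_scheme
      \<Rightarrow> ('k, 'a, 'b) tensor \<Rightarrow> ('a \<times> 'b) list" where
  "tlist U V t = (SOME xs. set xs \<subseteq> carr U \<times> carr V \<and> t = (\<Sum>(u, v)\<leftarrow>xs. tens U V u v))"

lemma tsum_tlist: "tsum U V t f = (\<Sum>z\<leftarrow>tlist U V t. f (fst z) (snd z))"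
  by (simp add: tsum_def tlist_def case_prod_unfold)

lemma tlist:
  assumes "vspace U" "t \<in> carr (tspace U V)"
  shows "z \<in> set (tlist U V t) \<Longrightarrow> fst z \<in> carr U" "z \<in> set (tlist U V t) \<Longrightarrow> snd z \<in> carr V"
    "t = (\<Sum>z\<leftarrow>tlist U V t. tens U V (fst z) (snd z))"
proof -
  have *: "set (tlist U V t) \<subseteq> carr U \<times> carr V \<and>
      t = (\<Sum>(u, v)\<leftarrow>tlist U V t. tens U V u v)"
    unfolding tlist_def by (rule someI_ex) (rule tens_rep[OF assms])
  then show "z \<in> set (tlist U V t) \<Longrightarrow> fst z \<in> carr U" "z \<in> set (tlist U V t) \<Longrightarrow> snd z \<in> carr V"
    by auto
  show "t = (\<Sum>z\<leftarrow>tlist U V t. tens U V (fst z) (snd z))"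
    using * by (simp add: case_prod_unfold)
qed

lemma tsum_cong:
  assumes "vspace U" "t \<in> carr (tspace U V)"
    and "\<And>u v. u \<in> carr U \<Longrightarrow> v \<in> carr V \<Longrightarrow> f u v = g u v"
  shows "tsum U V t f = tsum U V t g"
  unfolding tsum_tlist by (intro arg_cong[of _ _ sum_list] map_cong refl assms(3) tlist[OF assms(1,2)])

lemma tsum_swap:
  fixes f :: "_ \<Rightarrow> _ \<Rightarrow> _ \<Rightarrow> _ \<Rightarrow> 'c::ab_group_add"
  shows "tsum U V s (\<lambda>x y. tsum U' V' t (\<lambda>u v. f x y u v))
    = tsum U' V' t (\<lambda>u v. tsum U V s (\<lambda>x y. f x y u v))"
proof -
  have "(\<Sum>z\<leftarrow>zs. \<Sum>w\<leftarrow>ws. g z w) = (\<Sum>w\<leftarrow>ws. \<Sum>z\<leftarrow>zs. g z w)"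
    for g :: "_ \<Rightarrow> _ \<Rightarrow> 'c" and zs ws
    by (induction zs) (simp_all add: sum_list_addf sum_list_0)
  then show ?thesis unfolding tsum_tlist .
qed

lemma tsum_mult_left: "c * tsum U V t f = tsum U V t (\<lambda>u v. c * f u v :: 'c::ring)"
  by (simp add: tsum_tlist sum_list_const_mult)

lemma tsum_mult_right: "tsum U V t f * c = tsum U V t (\<lambda>u v. f u v * c :: 'c::ring)"
  by (simp add: tsum_tlist sum_list_mult_const)

lemma tsum_mem:
  assumes "vspace U" "t \<in> carr (tspace U V)" "vspace W"
    and "\<And>u v. u \<in> carr U \<Longrightarrow> v \<in> carr V \<Longrightarrow> f u v \<in> carr W"
  shows "tsum U V t f \<in> carr W"
  unfolding tsum_tlist by (intro vspace_sum_list assms(3,4) tlist[OF assms(1,2)])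

lemma linmap_tsum:
  assumes "vspace U" "t \<in> carr (tspace U V)" "vspace W" "linmap W Z g"
    and "\<And>u v. u \<in> carr U \<Longrightarrow> v \<in> carr V \<Longrightarrow> f u v \<in> carr W"
  shows "g (tsum U V t f) = tsum U V t (\<lambda>u v. g (f u v))"
  unfolding tsum_tlist
  by (intro linmap_sum_list[OF assms(4,3)] assms(5) tlist[OF assms(1,2)])

lemma tsum_tens:
  "vspace W \<Longrightarrow> bilin U V W f \<Longrightarrow> u \<in> carr U \<Longrightarrow> v \<in> carr V \<Longrightarrow> tsum U V (tens U V u v) f = f u v"
  using tsum_eq[of W U V f "[(u, v)]"] by (simp add: vspace_vector_space)

lemma tens_mem: "vspace U \<Longrightarrow> vspace V \<Longrightarrow> u \<in> carr U \<Longrightarrow> v \<in> carr V \<Longrightarrow> tens U V u v \<in> carr (tspace U V)"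
  using bilin_mem[OF tens_bilin] .

lemma tsum_tsum:
  assumes "vspace U" "vspace V" "vspace W" "bilin U V W g"
    and "vspace U'" "t \<in> carr (tspace U' V')"
    and "\<And>x y. x \<in> carr U' \<Longrightarrow> y \<in> carr V' \<Longrightarrow> f x y \<in> carr (tspace U V)"
  shows "tsum U V (tsum U' V' t f) g = tsum U' V' t (\<lambda>x y. tsum U V (f x y) g)"
  by (rule linmap_tsum[OF assms(5,6) vspace_tspace tsum_linmap[OF assms(1-4)] assms(7)])

subsection \<open>Linearity of iterated sums\<close>

lemma linmap_id: "linmap V V (\<lambda>x. x)"
  by (simp add: linmap_def)

lemma linmap_mult_left: "linmap V scalars f \<Longrightarrow> linmap V scalars (\<lambda>z. c * f z)"
  by (simp add: linmap_def algebra_simps)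

lemma linmap_mult_right: "linmap V scalars f \<Longrightarrow> linmap V scalars (\<lambda>z. f z * c)"
  by (simp add: linmap_def algebra_simps)

lemma linmap_sum_list_fun:
  assumes "vspace W" "\<And>y. y \<in> set ys \<Longrightarrow> linmap V W (\<lambda>z. f z y)"
  shows "linmap V W (\<lambda>z. \<Sum>y\<leftarrow>ys. f z y)"
  using assms(2)
proof (induction ys)
  case Nil
  interpret vector_space "scal W" by (rule vspace_vector_space[OF assms(1)])
  show ?case by (simp add: linmap_def vspace_zero[OF assms(1)])
next
  case (Cons y ys)
  interpret vector_space "scal W" by (rule vspace_vector_space[OF assms(1)])
  from Cons have "linmap V W (\<lambda>z. f z y)" "linmap V W (\<lambda>z. \<Sum>y\<leftarrow>ys. f z y)" by auto
  then show ?case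
    by (simp add: linmap_def vspace_add[OF assms(1)] scale_right_distrib)
qed

lemma linmap_tsum_fun:
  assumes "vspace U" "t \<in> carr (tspace U V')" "vspace W"
    and "\<And>u v. u \<in> carr U \<Longrightarrow> v \<in> carr V' \<Longrightarrow> linmap V W (\<lambda>z. f z u v)"
  shows "linmap V W (\<lambda>z. tsum U V' t (f z))"
  unfolding tsum_tlist
  by (intro linmap_sum_list_fun assms(3,4) tlist[OF assms(1,2)])

lemma linmap_tsum_arg:
  assumes "vspace U" "vspace V'" "vspace W" "bilin U V' W f" "linmap V (tspace U V') g"
  shows "linmap V W (\<lambda>z. tsum U V' (g z) f)"
  by (rule linmap_comp[OF tsum_linmap[OF assms(1-4)] assms(5)])

subsection \<open>Separating families of functionals\<close>

definition separating :: "('k::field, 'a::ab_group_add, 'z) vs_scheme \<Rightarrow> ('a \<Rightarrow> 'k) set \<Rightarrow> bool" where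
  "separating V P \<longleftrightarrow> (\<forall>p\<in>P. linmap V scalars p) \<and> (\<forall>v\<in>carr V. (\<forall>p\<in>P. p v = 0) \<longrightarrow> v = 0)"

lemma separating_linmap: "separating V P \<Longrightarrow> p \<in> P \<Longrightarrow> linmap V scalars p"
  by (simp add: separating_def)

lemma separating_eqI:
  assumes "separating V P" "vspace V" "u \<in> carr V" "v \<in> carr V" "\<And>p. p \<in> P \<Longrightarrow> p u = p v"
  shows "u = v"
proof -
  have "u - v = 0"
    using assms linmap_diff[OF separating_linmap[OF assms(1)] assms(2)] vspace_diff[OF assms(2-4)]
    unfolding separating_def by (metis diff_self)
  then show ?thesis by simp
qed

lemma separating_linmapI:
  assumes "separating W P" "vspace V" "vspace W" "\<And>x. x \<in> carr V \<Longrightarrow> f x \<in> carr W"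
    and "\<And>p. p \<in> P \<Longrightarrow> linmap V scalars (\<lambda>x. p (f x))"
  shows "linmap V W f"
  unfolding linmap_def
proof (intro conjI ballI allI)
  fix x y c assume x: "x \<in> carr V"
  then show "f x \<in> carr W" by (rule assms(4))
  note mem = assms(4) vspace_scal[OF assms(2)] vspace_scal[OF assms(3)]
    vspace_add[OF assms(2)] vspace_add[OF assms(3)]
  note lin = linmap_scal[OF assms(5)] linmap_scal[OF separating_linmap[OF assms(1)]]
    linmap_add[OF assms(5)] linmap_add[OF separating_linmap[OF assms(1)]]
  show "f (scal V c x) = scal W c (f x)"
    by (rule separating_eqI[OF assms(1,3)]) (simp_all add: x mem lin)
  assume y: "y \<in> carr V"
  show "f (x + y) = f x + f y"
    by (rule separating_eqI[OF assms(1,3)]) (simp_all add: x y mem lin)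
qed

definition tform ::
    "('k::field, 'a::ab_group_add, 'y) vs_scheme \<Rightarrow> ('k, 'b::ab_group_add, 'z) vs_scheme
      \<Rightarrow> ('a \<Rightarrow> 'k) \<Rightarrow> ('b \<Rightarrow> 'k) \<Rightarrow> ('k, 'a, 'b) tensor \<Rightarrow> 'k" where
  "tform U V p q t = tsum U V t (\<lambda>u v. p u * q v)"

lemma bilin_tform:
  "linmap U scalars p \<Longrightarrow> linmap V scalars q \<Longrightarrow> bilin U V scalars (\<lambda>u v. p u * q v)"
  by (simp add: bilin_def linmap_mult_left linmap_mult_right)

lemma linmap_tform:
  "vspace U \<Longrightarrow> vspace V \<Longrightarrow> linmap U scalars p \<Longrightarrow> linmap V scalars q \<Longrightarrow>
    linmap (tspace U V) scalars (tform U V p q)"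
  unfolding tform_def[abs_def] by (intro tsum_linmap bilin_tform) auto

lemma tform_tens:
  "linmap U scalars p \<Longrightarrow> linmap V scalars q \<Longrightarrow> u \<in> carr U \<Longrightarrow> v \<in> carr V \<Longrightarrow>
    tform U V p q (tens U V u v) = p u * q v"
  unfolding tform_def by (rule tsum_tens[OF vspace_scalars bilin_tform])

text \<open>An expression of minimal length for a tensor has linearly independent right legs, so
  functionals on the left legs detect it.\<close>

lemma tens_zero_left: "vspace U \<Longrightarrow> v \<in> carr V \<Longrightarrow> tens U V 0 v = 0"
  by (rule ext) (simp add: tens_def bilin_def linmap_zero[of U scalars "\<lambda>u. _ u v"])

lemma tens_rep_independent:
  fixes U :: "('a::field, 'b::ab_group_add, 'c) vs_scheme" and V :: "('a, 'd::ab_group_add, 'e) vs_scheme"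
  assumes U: "vspace U" and V: "vspace V" and t: "t \<in> carr (tspace U V)"
  shows "\<exists>S f. finite S \<and> S \<subseteq> carr V \<and> \<not> module.dependent (scal V) S \<and> f ` S \<subseteq> carr U \<and>
    t = (\<Sum>v\<in>S. tens U V (f v) v)"
proof -
  interpret V: vector_space "scal V" by (rule vspace_vector_space[OF V])
  interpret F: vector_space "\<lambda>(c::'a) (t::('b \<Rightarrow> 'd \<Rightarrow> 'a) \<Rightarrow> 'a) \<phi>. c * t \<phi>"
    by (rule vector_space_fun)
  have subV: "V.subspace (carr V)" using V by (simp add: vspace_def)
  let ?xs = "tlist U V t"
  obtain S where S: "S \<subseteq> snd ` set ?xs" "V.independent S" "snd ` set ?xs \<subseteq> V.span S"
    using V.maximal_independent_subset[of "snd ` set ?xs"] by blast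
  have fin: "finite S" using S(1) by (rule finite_subset) simp
  have SV: "S \<subseteq> carr V" using S(1) tlist(2)[OF U t] by auto
  have lin: "linmap V (tspace U V) (tens U V u)" if "u \<in> carr U" for u
    using tens_bilin[OF U V] that by (simp add: bilin_def)
  have linl: "linmap U (tspace U V) (\<lambda>u. tens U V u v)" if "v \<in> carr V" for v
    using tens_bilin[OF U V] that by (simp add: bilin_def)
  define g where "g z v = scal U (V.representation S (snd z) v) (fst z)" for z v
  have gU: "g z v \<in> carr U" if "z \<in> set ?xs" for z v
    unfolding g_def using tlist(1)[OF U t that] by (rule vspace_scal[OF U])
  have *: "tens U V (fst z) (snd z) = (\<Sum>v\<in>S. tens U V (g z v) v)" if z: "z \<in> set ?xs" for z
  proof -
    have z1: "fst z \<in> carr U" using tlist(1)[OF U t z] .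
    have "snd z \<in> V.span S" using S(3) z by auto
    then have r: "snd z = (\<Sum>v\<in>S. scal V (V.representation S (snd z) v) v)"
      using V.sum_representation_eq[OF S(2) _ fin order_refl] by simp
    have v: "v \<in> carr V" "scal V c v \<in> carr V" if "v \<in> S" for v c
      using that SV vspace_scal[OF V] by auto
    have "tens U V (fst z) (scal V c v) = tens U V (scal U c (fst z)) v" if "v \<in> S" for v c
      using linmap_scal[OF lin[OF z1] v(1)[OF that]] linmap_scal[OF linl[OF v(1)[OF that]] z1] by simp
    then show ?thesis
      unfolding g_def by (subst r) (simp add: linmap_sum[OF lin[OF z1] V] v)
  qed
  have "t = (\<Sum>z\<leftarrow>?xs. \<Sum>v\<in>S. tens U V (g z v) v)"
    by (subst tlist(3)[OF U t]) (intro arg_cong[of _ _ sum_list] map_cong refl *)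
  also have "\<dots> = (\<Sum>v\<in>S. \<Sum>z\<leftarrow>?xs. tens U V (g z v) v)"
  proof -
    have "(\<Sum>z\<leftarrow>zs. \<Sum>v\<in>S. tens U V (g z v) v) = (\<Sum>v\<in>S. \<Sum>z\<leftarrow>zs. tens U V (g z v) v)" for zs
      by (induction zs) (simp_all only: list.map sum_list.Nil sum_list.Cons sum.neutral_const sum.distrib)
    then show ?thesis .
  qed
  also have "\<dots> = (\<Sum>v\<in>S. tens U V (\<Sum>z\<leftarrow>?xs. g z v) v)"
    using SV by (intro sum.cong refl linmap_sum_list[OF linl U, symmetric] gU) auto
  finally have "t = (\<Sum>v\<in>S. tens U V (\<Sum>z\<leftarrow>?xs. g z v) v)" .
  moreover have "(\<Sum>z\<leftarrow>?xs. g z v) \<in> carr U" for v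
    by (intro vspace_sum_list U gU)
  ultimately show ?thesis using fin SV S(2) by (intro exI[of _ S] exI[of _ "\<lambda>v. \<Sum>z\<leftarrow>?xs. g z v"]) auto
qed

lemma separating_tens:
  fixes U :: "('a::field, 'b::ab_group_add, 'c) vs_scheme" and V :: "('a, 'd::ab_group_add, 'e) vs_scheme"
  assumes U: "vspace U" and V: "vspace V" and P: "separating U P" and Q: "separating V Q"
  shows "separating (tspace U V) {tform U V p q | p q. p \<in> P \<and> q \<in> Q}"
  unfolding separating_def
proof (intro conjI ballI impI)
  fix f assume "f \<in> {tform U V p q | p q. p \<in> P \<and> q \<in> Q}"
  then show "linmap (tspace U V) scalars f"
    using linmap_tform[OF U V] separating_linmap[OF P] separating_linmap[OF Q] by auto
next
  fix t assume t: "t \<in> carr (tspace U V)"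
    and z: "\<forall>f\<in>{tform U V p q | p q. p \<in> P \<and> q \<in> Q}. f t = 0"
  interpret V: vector_space "scal V" by (rule vspace_vector_space[OF V])
  obtain S f where S: "finite S" "S \<subseteq> carr V" "V.independent S" "f ` S \<subseteq> carr U"
    "t = (\<Sum>v\<in>S. tens U V (f v) v)"
    using tens_rep_independent[OF U V t] by blast
  have fS: "f v \<in> carr U" "v \<in> carr V" if "v \<in> S" for v using S that by auto
  have "f v = 0" if v: "v \<in> S" for v
  proof -
    have "p (f v) = 0" if p: "p \<in> P" for p
    proof -
      have lp: "linmap U scalars p" using separating_linmap[OF P p] .
      let ?w = "\<Sum>v\<in>S. scal V (p (f v)) v"
      have w: "scal V (p (f v)) v \<in> carr V" if "v \<in> S" for v
        using vspace_scal[OF V] fS that by auto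
      have "q ?w = 0" if q: "q \<in> Q" for q
      proof -
        have lq: "linmap V scalars q" using separating_linmap[OF Q q] .
        have "tform U V p q t = (\<Sum>v\<in>S. tform U V p q (tens U V (f v) v))"
          unfolding S(5) by (intro linmap_sum[OF linmap_tform[OF U V lp lq]] vspace_tspace tens_mem[OF U V] fS)
        also have "\<dots> = q ?w"
          by (simp add: linmap_sum[OF lq V] w tform_tens[OF lp lq] fS linmap_scal[OF lq])
        finally have "tform U V p q t = q ?w" .
        moreover have "tform U V p q t = 0" using z p q by blast
        ultimately show ?thesis by simp
      qed
      moreover have "?w \<in> carr V"
        by (intro vspace_sum V w)
      ultimately have "?w = 0" using Q by (simp add: separating_def)
      then show ?thesis
        using V.independentD[OF S(3,1) order_refl, of "\<lambda>v. p (f v)"] v by simp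
    qed
    then show ?thesis using P fS(1)[OF v] by (simp add: separating_def)
  qed
  then show "t = 0" using S fS by (simp add: tens_zero_left[OF U] sum.neutral)
qed

lemma separating_all_linmaps:
  assumes "vspace V"
  shows "separating V {p. linmap V scalars p}"
  unfolding separating_def
proof (intro conjI ballI impI)
  fix v assume v: "v \<in> carr V" "\<forall>p\<in>{p. linmap V scalars p}. p v = 0"
  show "v = 0"
  proof (rule ccontr)
    assume "v \<noteq> 0"
    then obtain g where g: "Vector_Spaces.linear (scal V) (*) g" "g v \<noteq> 0"
      using exists_functional[OF vspace_vector_space[OF assms]] by blast
    interpret G: Vector_Spaces.linear "scal V" "(*)" g by fact
    have "linmap V scalars g" by (simp add: linmap_def G.add G.scale)
    then show False using v g by auto
  qed
qed auto

subsection \<open>Tensors only depend on carrier and scaling\<close>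

lemma linmap_vs_cong:
  "carr V = carr V' \<Longrightarrow> scal V = scal V' \<Longrightarrow> carr W = carr W' \<Longrightarrow> scal W = scal W' \<Longrightarrow>
    linmap V W f = linmap V' W' f"
  by (simp add: linmap_def)

lemma bilin_vs_cong:
  "carr U = carr U' \<Longrightarrow> scal U = scal U' \<Longrightarrow> carr V = carr V' \<Longrightarrow> scal V = scal V' \<Longrightarrow>
    carr W = carr W' \<Longrightarrow> scal W = scal W' \<Longrightarrow> bilin U V W f = bilin U' V' W' f"
  by (simp add: bilin_def linmap_def)

lemma tens_vs_cong:
  assumes "carr U = carr U'" "scal U = scal U'" "carr V = carr V'" "scal V = scal V'"
  shows "tens U V = tens U' V'" "tspace U V = tspace U' V'" "tsum U V = tsum U' V'"
proof -
  have "bilin U V scalars = bilin U' V' scalars"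
    using bilin_vs_cong[OF assms refl refl] by (rule ext)
  then show t: "tens U V = tens U' V'" by (intro ext) (simp add: tens_def)
  show "tspace U V = tspace U' V'" by (simp add: tspace_def t assms(1,3))
  show "tsum U V = tsum U' V'"
    unfolding tsum_def t assms(1,3) by (rule refl)
qed

lemma separating_zero: "separating V P \<Longrightarrow> v \<in> carr V \<Longrightarrow> (\<And>p. p \<in> P \<Longrightarrow> p v = 0) \<Longrightarrow> v = 0"
  by (simp add: separating_def)

subsection \<open>Transfer of the Yetter--Drinfeld structure along an injective map\<close>

lemma linmap_cong': "linmap V W g \<Longrightarrow> (\<And>x. x \<in> carr V \<Longrightarrow> f x = g x) \<Longrightarrow> vspace V \<Longrightarrow> linmap V W f"
  using linmap_cong by blast

lemma linmap_lift:
  assumes "linmap V Y (\<lambda>z. \<iota> (f z))" "vspace V" "vspace X" "linmap X Y \<iota>" "inj_on \<iota> (carr X)"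
    and f: "\<And>z. z \<in> carr V \<Longrightarrow> f z \<in> carr X"
  shows "linmap V X f"
  unfolding linmap_def
proof (intro conjI ballI allI)
  note inj = inj_onD[OF assms(5)]
  note simps = linmap_add[OF assms(4)] linmap_add[OF assms(1)] linmap_scal[OF assms(4)] linmap_scal[OF assms(1)]
    vspace_add[OF assms(2)] vspace_add[OF assms(3)] vspace_scal[OF assms(2)] vspace_scal[OF assms(3)] f
  fix x assume x: "x \<in> carr V"
  then show "f x \<in> carr X" by (rule f)
  show "f (scal V c x) = scal X c (f x)" for c
    by (rule inj) (simp_all add: simps x)
  fix y assume y: "y \<in> carr V"
  show "f (x + y) = f x + f y"
    by (rule inj) (simp_all add: simps x y)
qed

locale yd_embedding =
  fixes H :: "('k::field, 'h::ab_group_add) hopf" and X :: "('k, 'x::ab_group_add, 'h) yd_alg"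
    and Y :: "('k, 'y::ab_group_add, 'h) yd_alg" and \<iota> :: "'x \<Rightarrow> 'y"
  assumes Y: "yd_module_algebra H Y"
    and vX: "vspace X" and \<iota>: "linmap X Y \<iota>" and inj: "inj_on \<iota> (carr X)"
    and mul_closed: "\<And>x y. x \<in> carr X \<Longrightarrow> y \<in> carr X \<Longrightarrow> mul X x y \<in> carr X"
    and \<iota>_mul: "\<And>x y. x \<in> carr X \<Longrightarrow> y \<in> carr X \<Longrightarrow> \<iota> (mul X x y) = mul Y (\<iota> x) (\<iota> y)"
    and unity_closed: "unity X \<in> carr X" and \<iota>_unity: "\<iota> (unity X) = unity Y"
    and act_closed: "\<And>h x. h \<in> carr H \<Longrightarrow> x \<in> carr X \<Longrightarrow> act X h x \<in> carr X"
    and \<iota>_act: "\<And>h x. h \<in> carr H \<Longrightarrow> x \<in> carr X \<Longrightarrow> \<iota> (act X h x) = act Y h (\<iota> x)"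
    and coact_closed: "\<And>x. x \<in> carr X \<Longrightarrow> coact X x \<in> carr (tspace H X)"
    and \<iota>_coact: "\<And>x F. x \<in> carr X \<Longrightarrow> bilin H Y scalars F \<Longrightarrow>
      cosw H Y (\<iota> x) F = cosw H X x (\<lambda>g x0. F g (\<iota> x0))"
begin

lemma modY: "module_algebra H Y" and comodY: "comodule_algebra H Y" and hopfH: "hopf_algebra_bij H"
  using Y by (simp_all add: yd_module_algebra_def)

lemma algY: "algebra Y"
  using modY by (simp add: module_algebra_def)

lemma vY: "vspace Y"
  using algY by (simp add: algebra_def)

lemma vH: "vspace H"
  using hopfH by (simp add: hopf_algebra_bij_def hopf_algebra_def bialgebra_def algebra_def)

lemma linmap_comulH: "linmap H (tspace H H) (comul H)"
  using hopfH by (simp add: hopf_algebra_bij_def hopf_algebra_def bialgebra_def coalgebra_def)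

lemma comulH: "h \<in> carr H \<Longrightarrow> comul H h \<in> carr (tspace H H)"
  by (rule linmap_mem[OF linmap_comulH])

lemma bilin_mulH: "bilin H H H (mul H)"
  using hopfH unfolding hopf_algebra_bij_def hopf_algebra_def bialgebra_def algebra_def by blast

lemma bilin_mulY: "bilin Y Y Y (mul Y)"
  using algY by (simp add: algebra_def)

lemma bilin_actY: "bilin H Y Y (act Y)"
  using modY by (simp add: module_algebra_def)

lemma coactY: "linmap Y (tspace H Y) (coact Y)"
  using comodY by (simp add: comodule_algebra_def)

lemma unityH: "unity H \<in> carr H"
  using hopfH by (simp add: hopf_algebra_bij_def hopf_algebra_def bialgebra_def algebra_def)

lemma counitH: "linmap H scalars (counit H)"
  using hopfH by (simp add: hopf_algebra_bij_def hopf_algebra_def bialgebra_def coalgebra_def)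

lemmas closed [simp] = vX vY vH comulH mul_closed unity_closed act_closed coact_closed unityH
  linmap_mem[OF \<iota>] linmap_mem[OF coactY] bilin_mem[OF bilin_mulH] bilin_mem[OF bilin_mulY] bilin_mem[OF bilin_actY]

lemma \<iota>_eqI: "x \<in> carr X \<Longrightarrow> y \<in> carr X \<Longrightarrow> \<iota> x = \<iota> y \<Longrightarrow> x = y"
  using inj by (auto dest: inj_onD)

lemma sepX: "separating X {\<lambda>x. q (\<iota> x) | q. linmap Y scalars q}"
  unfolding separating_def
proof (intro conjI ballI impI)
  fix p assume "p \<in> {\<lambda>x. q (\<iota> x) | q. linmap Y scalars q}"
  then show "linmap X scalars p" using linmap_comp[OF _ \<iota>] by auto
next
  fix v assume v: "v \<in> carr X" "\<forall>p\<in>{\<lambda>x. q (\<iota> x) | q. linmap Y scalars q}. p v = 0"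
  have "\<iota> v = 0"
    by (rule separating_zero[OF separating_all_linmaps[OF vY]]) (use v in auto)
  then show "v = 0"
    using v(1) by (intro \<iota>_eqI) (simp_all add: vspace_zero linmap_zero[OF \<iota>])
qed

lemma X_eqI:
  assumes "u \<in> carr X" "v \<in> carr X" "\<And>q. linmap Y scalars q \<Longrightarrow> q (\<iota> u) = q (\<iota> v)"
  shows "u = v"
  by (rule separating_eqI[OF sepX vX assms(1,2)]) (use assms(3) in auto)

lemma tens_X_eqI:
  assumes "vspace V" "s \<in> carr (tspace V X)" "t \<in> carr (tspace V X)"
    and "\<And>p q. linmap V scalars p \<Longrightarrow> linmap Y scalars q \<Longrightarrow>
      tsum V X s (\<lambda>g x. p g * q (\<iota> x)) = tsum V X t (\<lambda>g x. p g * q (\<iota> x))"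
  shows "s = t"
  by (rule separating_eqI[OF separating_tens[OF assms(1) vX separating_all_linmaps[OF assms(1)] sepX] vspace_tspace
    assms(2,3)])
    (auto simp: tform_def assms(4))

lemma cosw_cong:
  "coact Z x \<in> carr (tspace H Z) \<Longrightarrow> (\<And>g y. g \<in> carr H \<Longrightarrow> y \<in> carr Z \<Longrightarrow> f g y = f' g y) \<Longrightarrow>
    cosw H Z x f = cosw H Z x f'"
  unfolding cosw_def by (rule tsum_cong; simp)

lemma swH_cong:
  "h \<in> carr H \<Longrightarrow> (\<And>g y. g \<in> carr H \<Longrightarrow> y \<in> carr H \<Longrightarrow> f g y = f' g y) \<Longrightarrow> sw H h f = sw H h f'"
  unfolding sw_def by (rule tsum_cong; simp)

lemma cosw_mem:
  "coact Z x \<in> carr (tspace H Z) \<Longrightarrow> vspace W \<Longrightarrow> (\<And>g y. g \<in> carr H \<Longrightarrow> y \<in> carr Z \<Longrightarrow> f g y \<in> carr W) \<Longrightarrow>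
    cosw H Z x f \<in> carr W"
  unfolding cosw_def by (rule tsum_mem; simp)

lemma swH_mem:
  "h \<in> carr H \<Longrightarrow> vspace W \<Longrightarrow> (\<And>g y. g \<in> carr H \<Longrightarrow> y \<in> carr H \<Longrightarrow> f g y \<in> carr W) \<Longrightarrow> sw H h f \<in> carr W"
  unfolding sw_def by (rule tsum_mem; simp)

lemma linmap_cosw:
  "linmap W Z G \<Longrightarrow> vspace W \<Longrightarrow> coact V x \<in> carr (tspace H V) \<Longrightarrow>
    (\<And>g y. g \<in> carr H \<Longrightarrow> y \<in> carr V \<Longrightarrow> f g y \<in> carr W) \<Longrightarrow>
    G (cosw H V x f) = cosw H V x (\<lambda>g y. G (f g y))"
  unfolding cosw_def by (rule linmap_tsum[where g=G and f=f and W=W]; simp)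

lemma linmap_swH:
  "linmap W Z G \<Longrightarrow> vspace W \<Longrightarrow> h \<in> carr H \<Longrightarrow> (\<And>g y. g \<in> carr H \<Longrightarrow> y \<in> carr H \<Longrightarrow> f g y \<in> carr W) \<Longrightarrow>
    G (sw H h f) = sw H h (\<lambda>g y. G (f g y))"
  unfolding sw_def by (rule linmap_tsum[where g=G and f=f and W=W]; simp)

lemma algX: "algebra X"
  unfolding algebra_def
proof (intro conjI ballI)
  show "bilin X X X (mul X)"
  proof (rule bilinI)
    fix x assume x: "x \<in> carr X"
    show "linmap X X (mul X x)"
      by (rule linmap_lift[OF _ vX vX \<iota> inj], rule linmap_cong'[OF linmap_comp[OF bilin_right[OF bilin_mulY, of "\<iota> x"]
        \<iota>]])
        (simp_all add: \<iota>_mul x)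
    show "linmap X X (\<lambda>z. mul X z x)"
      by (rule linmap_lift[OF _ vX vX \<iota> inj], rule linmap_cong'[OF linmap_comp[OF bilin_left[OF bilin_mulY, of "\<iota> x"]
        \<iota>]])
        (simp_all add: \<iota>_mul x)
  qed
  fix x y z assume "x \<in> carr X" "y \<in> carr X" "z \<in> carr X"
  then show "mul X (mul X x y) z = mul X x (mul X y z)"
    using algY by (intro \<iota>_eqI) (simp_all add: \<iota>_mul algebra_def)
next
  fix x assume "x \<in> carr X"
  then show "mul X (unity X) x = x" "mul X x (unity X) = x"
    using algY by (auto intro!: \<iota>_eqI simp: \<iota>_mul \<iota>_unity algebra_def)
qed simp_all

lemma modX: "module_algebra H X"
  unfolding module_algebra_def
proof (intro conjI ballI algX)
  show "bilin H X X (act X)"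
  proof (rule bilinI)
    fix h assume h: "h \<in> carr H"
    show "linmap X X (act X h)"
      by (rule linmap_lift[OF _ vX vX \<iota> inj], rule linmap_cong'[OF linmap_comp[OF bilin_right[OF bilin_actY, of h]
        \<iota>]])
        (simp_all add: \<iota>_act h)
  next
    fix x assume x: "x \<in> carr X"
    show "linmap H X (\<lambda>h. act X h x)"
      by (rule linmap_lift[OF _ vH vX \<iota> inj], rule linmap_cong'[OF bilin_left[OF bilin_actY, of "\<iota> x"]])
        (simp_all add: \<iota>_act x)
  qed
next
  fix x assume "x \<in> carr X"
  then show "act X (unity H) x = x"
    using modY by (intro \<iota>_eqI) (simp_all add: \<iota>_act module_algebra_def)
next
  fix g h x assume "g \<in> carr H" "h \<in> carr H" "x \<in> carr X"
  then show "act X (mul H g h) x = act X g (act X h x)"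
    using modY by (intro \<iota>_eqI) (simp_all add: \<iota>_act module_algebra_def)
next
  fix h assume "h \<in> carr H"
  then show "act X h (unity X) = scal X (counit H h) (unity X)"
    using modY by (intro \<iota>_eqI) (simp_all add: \<iota>_act \<iota>_unity vspace_scal linmap_scal[OF \<iota>] module_algebra_def)
next
  fix h x y assume a [simp]: "h \<in> carr H" "x \<in> carr X" "y \<in> carr X"
  show "act X h (mul X x y) = sw H h (\<lambda>h1 h2. mul X (act X h1 x) (act X h2 y))"
  proof (rule \<iota>_eqI)
    have "\<iota> (sw H h (\<lambda>h1 h2. mul X (act X h1 x) (act X h2 y))) =
      sw H h (\<lambda>h1 h2. mul Y (act Y h1 (\<iota> x)) (act Y h2 (\<iota> y)))"
      by (simp add: linmap_swH[OF \<iota>] \<iota>_mul \<iota>_act cong: swH_cong)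
    also have "\<dots> = \<iota> (act X h (mul X x y))"
      using modY by (simp add: \<iota>_act \<iota>_mul module_algebra_def)
    finally show "\<iota> (act X h (mul X x y)) = \<iota> (sw H h (\<lambda>h1 h2. mul X (act X h1 x) (act X h2 y)))" by simp
  qed (simp_all add: swH_mem)
qed

lemma tens_mem_HX: "g \<in> carr H \<Longrightarrow> x \<in> carr X \<Longrightarrow> tens H X g x \<in> carr (tspace H X)"
  "g \<in> carr H \<Longrightarrow> y \<in> carr Y \<Longrightarrow> tens H Y g y \<in> carr (tspace H Y)"
  by (rule tens_mem; simp)+

lemma q\<iota>: "linmap Y scalars q \<Longrightarrow> linmap X scalars (\<lambda>x. q (\<iota> x))"
  by (rule linmap_comp[OF _ \<iota>])

context
  fixes p q
  assumes p: "linmap H scalars p" and q: "linmap Y scalars q"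
begin

lemma pX_lin: "linmap (tspace H X) scalars (\<lambda>t. tsum H X t (\<lambda>g x. p g * q (\<iota> x)))"
  using linmap_tform[OF vH vX p q\<iota>[OF q]] by (simp add: tform_def[abs_def])

lemma pY_lin: "linmap (tspace H Y) scalars (\<lambda>t. tsum H Y t (\<lambda>g x. p g * q x))"
  using linmap_tform[OF vH vY p q] by (simp add: tform_def[abs_def])

lemma pX_tens: "g \<in> carr H \<Longrightarrow> x \<in> carr X \<Longrightarrow> tsum H X (tens H X g x) (\<lambda>g x. p g * q (\<iota> x)) = p g * q (\<iota> x)"
  using tform_tens[OF p q\<iota>[OF q]] by (simp add: tform_def)

lemma pY_tens: "g \<in> carr H \<Longrightarrow> y \<in> carr Y \<Longrightarrow> tsum H Y (tens H Y g y) (\<lambda>g x. p g * q x) = p g * q y"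
  using tform_tens[OF p q] by (simp add: tform_def)

lemma pX_coact: "x \<in> carr X \<Longrightarrow> tsum H X (coact X x) (\<lambda>g x. p g * q (\<iota> x)) =
    tsum H Y (coact Y (\<iota> x)) (\<lambda>g x. p g * q x)"
  using \<iota>_coact[OF _ bilin_tform[OF p q]] by (simp add: cosw_def)

end

lemma coact_bilin:
  assumes "bilin H Y scalars F"
  shows "linmap Y scalars (\<lambda>y. cosw H Y y F)"
  unfolding cosw_def by (rule linmap_comp[OF tsum_linmap[OF vH vY vspace_scalars assms] coactY])

lemma form_cosw_fun:
  "y \<in> carr Y \<Longrightarrow> (\<And>g z. g \<in> carr H \<Longrightarrow> z \<in> carr Y \<Longrightarrow> linmap V scalars (\<lambda>v. F v g z)) \<Longrightarrow>
    linmap V scalars (\<lambda>v. cosw H Y y (F v))"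
  unfolding cosw_def by (rule linmap_tsum_fun; simp)

lemma form_swH_fun:
  "h \<in> carr H \<Longrightarrow> (\<And>g z. g \<in> carr H \<Longrightarrow> z \<in> carr H \<Longrightarrow> linmap V scalars (\<lambda>v. F v g z)) \<Longrightarrow>
    linmap V scalars (\<lambda>v. sw H h (F v))"
  unfolding sw_def by (rule linmap_tsum_fun; simp)

lemma cosw_\<iota>:
  "x \<in> carr X \<Longrightarrow> bilin H Y scalars F \<Longrightarrow> cosw H X x (\<lambda>g x0. F g (\<iota> x0)) = cosw H Y (\<iota> x) F"
  by (simp add: \<iota>_coact)

lemma linmap_q_mul:
  assumes q: "linmap Y scalars q"
  shows "y \<in> carr Y \<Longrightarrow> linmap Y scalars (\<lambda>z. q (mul Y y z))" "y \<in> carr Y \<Longrightarrow> linmap Y scalars (\<lambda>z. q (mul Y z y))"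
    "y \<in> carr Y \<Longrightarrow> linmap H scalars (\<lambda>h. q (act Y h y))" "h \<in> carr H \<Longrightarrow> linmap Y scalars (\<lambda>y. q (act Y h y))"
  by (rule linmap_comp[OF q bilin_right[OF bilin_mulY]] linmap_comp[OF q bilin_left[OF bilin_mulY]]
    linmap_comp[OF q bilin_right[OF bilin_actY]] linmap_comp[OF q bilin_left[OF bilin_actY]]; assumption)+

lemma linmap_p_mul:
  assumes p: "linmap H scalars p"
  shows "g \<in> carr H \<Longrightarrow> linmap H scalars (\<lambda>h. p (mul H g h))" "g \<in> carr H \<Longrightarrow> linmap H scalars (\<lambda>h. p (mul H h g))"
  by (rule linmap_comp[OF p bilin_right[OF bilin_mulH]] linmap_comp[OF p bilin_left[OF bilin_mulH]]; assumption)+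

lemma linmap_coact: "linmap X (tspace H X) (coact X)"
proof (rule separating_linmapI[OF separating_tens[OF vH vX separating_all_linmaps[OF vH] sepX] vX vspace_tspace])
  fix r assume "r \<in> {tform H X p q |p q. p \<in> {p. linmap H scalars p} \<and> q \<in> {\<lambda>x. q (\<iota> x) |q. linmap Y scalars q}}"
  then obtain p q where p: "linmap H scalars p" and q: "linmap Y scalars q" and r: "r = tform H X p (\<lambda>x. q (\<iota> x))"
    by blast
  show "linmap X scalars (\<lambda>x. r (coact X x))"
    by (rule linmap_cong'[OF linmap_comp[OF coact_bilin[OF bilin_tform[OF p q]] \<iota>]])
      (simp_all add: r tform_def pX_coact[OF p q] cosw_def)
qed simp

lemma coact_coassoc:
  assumes x [simp]: "x \<in> carr X"
  shows "cosw H X x (\<lambda>g x0. sw H g (\<lambda>g1 g2. tens3 H H X g1 g2 x0)) =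
    cosw H X x (\<lambda>g1 y. cosw H X y (\<lambda>g2 x0. tens3 H H X g1 g2 x0))"
proof -
  have m: "tens H H a b \<in> carr (tspace H H)" if "a \<in> carr H" "b \<in> carr H" for a b
    using that by (simp add: tens_mem)
  have mX: "tens3 H H X a b c \<in> carr (tspace (tspace H H) X)" if "a \<in> carr H" "b \<in> carr H" "c \<in> carr X" for a b c
    unfolding tens3_def using that m by (simp add: tens_mem)
  have mY: "tens3 H H Y a b c \<in> carr (tspace (tspace H H) Y)" if "a \<in> carr H" "b \<in> carr H" "c \<in> carr Y" for a b c
    unfolding tens3_def using that m by (simp add: tens_mem)
  show ?thesis
  proof (rule tens_X_eqI)
    fix p q assume p: "linmap (tspace H H) scalars p" and q: "linmap Y scalars q"
    let ?L = "\<lambda>t. tsum (tspace H H) X t (\<lambda>g x. p g * q (\<iota> x))"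
    let ?M = "\<lambda>t. tsum (tspace H H) Y t (\<lambda>g x. p g * q x)"
    have L: "linmap (tspace (tspace H H) X) scalars ?L" and M: "linmap (tspace (tspace H H) Y) scalars ?M"
      by (rule tsum_linmap[OF vspace_tspace vX vspace_scalars bilin_tform[OF p q\<iota>[OF q]]]
        tsum_linmap[OF vspace_tspace vY vspace_scalars bilin_tform[OF p q]])+
    have Lt: "?L (tens3 H H X a b c) = p (tens H H a b) * q (\<iota> c)" if "a \<in> carr H" "b \<in> carr H" "c \<in> carr X" for a b c
      unfolding tens3_def by (rule tsum_tens[OF vspace_scalars bilin_tform[OF p q\<iota>[OF q]]]) (use that m in simp_all)
    have Mt: "?M (tens3 H H Y a b c) = p (tens H H a b) * q c" if "a \<in> carr H" "b \<in> carr H" "c \<in> carr Y" for a b c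
      unfolding tens3_def by (rule tsum_tens[OF vspace_scalars bilin_tform[OF p q]]) (use that m in simp_all)
    have pl: "bilin H H scalars (\<lambda>a b. p (tens H H a b))"
      by (rule bilin_linmap_comp[OF p tens_bilin[OF vH vH]])
    have swl: "linmap H scalars (\<lambda>g. sw H g (\<lambda>a b. p (tens H H a b) * c))" for c
      unfolding sw_def
      by (rule linmap_comp[OF tsum_linmap[OF vH vH vspace_scalars bilinI] linmap_comulH])
        (simp_all add: linmap_mult_right bilin_left[OF pl] bilin_right[OF pl])
    have F: "bilin H Y scalars (\<lambda>g y. sw H g (\<lambda>a b. p (tens H H a b) * q y))"
      by (rule bilinI[OF form_swH_fun swl]) (simp_all add: q linmap_mult_left)
    have G1: "bilin H Y scalars (\<lambda>g y. p (tens H H a g) * q y)" if "a \<in> carr H" for a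
      by (rule bilin_tform[OF bilin_right[OF pl that] q])
    have G: "bilin H Y scalars (\<lambda>g1 y. cosw H Y y (\<lambda>g2 x0. p (tens H H g1 g2) * q x0))"
      by (rule bilinI[OF coact_bilin[OF G1] form_cosw_fun]) (simp_all add: linmap_mult_right bilin_left[OF pl])
    have "?L (cosw H X x (\<lambda>g x0. sw H g (\<lambda>g1 g2. tens3 H H X g1 g2 x0))) =
        cosw H X x (\<lambda>g x0. sw H g (\<lambda>g1 g2. p (tens H H g1 g2) * q (\<iota> x0)))"
      by (simp add: linmap_cosw[OF L] linmap_swH[OF L] swH_mem mX Lt cong: cosw_cong swH_cong)
    also have "\<dots> = cosw H Y (\<iota> x) (\<lambda>g y. sw H g (\<lambda>g1 g2. p (tens H H g1 g2) * q y))"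
      by (rule cosw_\<iota>[OF x F])
    also have "\<dots> = ?M (cosw H Y (\<iota> x) (\<lambda>g x0. sw H g (\<lambda>g1 g2. tens3 H H Y g1 g2 x0)))"
      by (simp add: linmap_cosw[OF M] linmap_swH[OF M] swH_mem mY Mt cong: cosw_cong swH_cong)
    also have "\<dots> = ?M (cosw H Y (\<iota> x) (\<lambda>g1 y. cosw H Y y (\<lambda>g2 x0. tens3 H H Y g1 g2 x0)))"
      using comodY by (simp add: comodule_algebra_def)
    also have "\<dots> = cosw H Y (\<iota> x) (\<lambda>g1 y. cosw H Y y (\<lambda>g2 x0. p (tens H H g1 g2) * q x0))"
      by (simp add: linmap_cosw[OF M] cosw_mem mY Mt cong: cosw_cong)
    also have "\<dots> = cosw H X x (\<lambda>g1 y. cosw H Y (\<iota> y) (\<lambda>g2 x0. p (tens H H g1 g2) * q x0))"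
      by (rule cosw_\<iota>[OF x G, symmetric])
    also have "\<dots> = cosw H X x (\<lambda>g1 y. cosw H X y (\<lambda>g2 x0. p (tens H H g1 g2) * q (\<iota> x0)))"
      by (rule cosw_cong[OF coact_closed[OF x]]) (rule cosw_\<iota>[OF _ G1, symmetric])
    also have "\<dots> = ?L (cosw H X x (\<lambda>g1 y. cosw H X y (\<lambda>g2 x0. tens3 H H X g1 g2 x0)))"
      by (simp add: linmap_cosw[OF L] cosw_mem mX Lt cong: cosw_cong)
    finally show "?L (cosw H X x (\<lambda>g x0. sw H g (\<lambda>g1 g2. tens3 H H X g1 g2 x0))) =
      ?L (cosw H X x (\<lambda>g1 y. cosw H X y (\<lambda>g2 x0. tens3 H H X g1 g2 x0)))" .
  qed (simp_all add: cosw_mem swH_mem mX)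
qed

lemma coact_mul:
  assumes x [simp]: "x \<in> carr X" and y [simp]: "y \<in> carr X"
  shows "coact X (mul X x y) = cosw H X x (\<lambda>g x0. cosw H X y (\<lambda>h y0. tens H X (mul H g h) (mul X x0 y0)))"
proof (rule tens_X_eqI)
  fix p q assume p: "linmap H scalars p" and q: "linmap Y scalars q"
  note lins = linmap_mult_left linmap_mult_right linmap_q_mul[OF q] linmap_p_mul[OF p]
  have G1: "bilin H Y scalars (\<lambda>h z. p (mul H g h) * q (mul Y v z))" if "g \<in> carr H" "v \<in> carr Y" for g v
    using that by (intro bilinI) (simp_all add: lins)
  have G: "bilin H Y scalars (\<lambda>g v. cosw H Y (\<iota> y) (\<lambda>h z. p (mul H g h) * q (mul Y v z)))"
    by (intro bilinI form_cosw_fun) (simp_all add: lins)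
  let ?L = "\<lambda>t. tsum H X t (\<lambda>g x. p g * q (\<iota> x))"
  let ?M = "\<lambda>t. tsum H Y t (\<lambda>g x. p g * q x)"
  have "?L (cosw H X x (\<lambda>g x0. cosw H X y (\<lambda>h y0. tens H X (mul H g h) (mul X x0 y0)))) =
    cosw H X x (\<lambda>g x0. cosw H X y (\<lambda>h y0. p (mul H g h) * q (mul Y (\<iota> x0) (\<iota> y0))))"
    by (simp add: linmap_cosw[OF pX_lin[OF p q]] cosw_mem tens_mem_HX pX_tens[OF p q] \<iota>_mul cong: cosw_cong)
  also have "\<dots> = cosw H X x (\<lambda>g x0. cosw H Y (\<iota> y) (\<lambda>h z. p (mul H g h) * q (mul Y (\<iota> x0) z)))"
    by (rule cosw_cong[OF coact_closed[OF x]]) (rule cosw_\<iota>[OF y G1], simp_all)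
  also have "\<dots> = cosw H Y (\<iota> x) (\<lambda>g v. cosw H Y (\<iota> y) (\<lambda>h z. p (mul H g h) * q (mul Y v z)))"
    by (rule cosw_\<iota>[OF x G])
  also have "\<dots> = ?M (cosw H Y (\<iota> x) (\<lambda>g v. cosw H Y (\<iota> y) (\<lambda>h z. tens H Y (mul H g h) (mul Y v z))))"
    by (simp add: linmap_cosw[OF pY_lin[OF p q]] cosw_mem tens_mem_HX pY_tens[OF p q] cong: cosw_cong)
  also have "\<dots> = ?M (coact Y (\<iota> (mul X x y)))"
    using comodY by (simp add: comodule_algebra_def \<iota>_mul)
  also have "\<dots> = ?L (coact X (mul X x y))"
    by (simp add: pX_coact[OF p q])
  finally show "?L (coact X (mul X x y)) =
    ?L (cosw H X x (\<lambda>g x0. cosw H X y (\<lambda>h y0. tens H X (mul H g h) (mul X x0 y0))))" ..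
qed (simp_all add: cosw_mem tens_mem_HX)

lemma comodX: "comodule_algebra H X"
  unfolding comodule_algebra_def
proof (intro conjI ballI algX linmap_coact coact_coassoc coact_mul)
  fix x assume x [simp]: "x \<in> carr X"
  have cm: "scal X (counit H g) z \<in> carr X" if "z \<in> carr X" for g z
    using that by (simp add: vspace_scal)
  show "cosw H X x (\<lambda>g x0. scal X (counit H g) x0) = x"
  proof (rule X_eqI)
    fix q assume q: "linmap Y scalars q"
    have "q (\<iota> (cosw H X x (\<lambda>g x0. scal X (counit H g) x0))) = cosw H X x (\<lambda>g x0. counit H g * q (\<iota> x0))"
      by (simp add: linmap_cosw[OF q\<iota>[OF q]] cm linmap_scal[OF q\<iota>[OF q]] cong: cosw_cong)
    also have "\<dots> = cosw H Y (\<iota> x) (\<lambda>g y. counit H g * q y)"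
      by (rule cosw_\<iota>[OF x bilin_tform[OF counitH q]])
    also have "\<dots> = q (cosw H Y (\<iota> x) (\<lambda>g y. scal Y (counit H g) y))"
      by (simp add: linmap_cosw[OF q] vspace_scal linmap_scal[OF q] cong: cosw_cong)
    also have "\<dots> = q (\<iota> x)"
      using comodY by (simp add: comodule_algebra_def)
    finally show "q (\<iota> (cosw H X x (\<lambda>g x0. scal X (counit H g) x0))) = q (\<iota> x)" .
  qed (simp_all add: cosw_mem cm)
next
  show "coact X (unity X) = tens H X (unity H) (unity X)"
  proof (rule tens_X_eqI)
    fix p q assume p: "linmap H scalars p" and q: "linmap Y scalars q"
    have "unity Y \<in> carr Y" using algY by (simp add: algebra_def)
    moreover have "coact Y (unity Y) = tens H Y (unity H) (unity Y)"
      using comodY by (simp add: comodule_algebra_def)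
    ultimately show "tsum H X (coact X (unity X)) (\<lambda>g x. p g * q (\<iota> x)) =
        tsum H X (tens H X (unity H) (unity X)) (\<lambda>g x. p g * q (\<iota> x))"
      by (simp add: pX_coact[OF p q] pX_tens[OF p q] pY_tens[OF p q] \<iota>_unity)
  qed (simp_all add: tens_mem_HX)
qed

lemma yd_module_algebraX: "yd_module_algebra H X"
  unfolding yd_module_algebra_def
proof (intro conjI ballI hopfH modX comodX)
  fix h x assume h [simp]: "h \<in> carr H" and x [simp]: "x \<in> carr X"
  show "sw H h (\<lambda>h1 h2. cosw H X (act X h1 x) (\<lambda>g y. tens H X (mul H g h2) y)) =
    sw H h (\<lambda>h1 h2. cosw H X x (\<lambda>g x0. tens H X (mul H h1 g) (act X h2 x0)))" (is "?s = ?t")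
  proof (rule tens_X_eqI)
    fix p q assume p: "linmap H scalars p" and q: "linmap Y scalars q"
    note lins = linmap_mult_left linmap_mult_right linmap_q_mul[OF q] linmap_p_mul[OF p] q
    let ?L = "\<lambda>t. tsum H X t (\<lambda>g x. p g * q (\<iota> x))"
    let ?M = "\<lambda>t. tsum H Y t (\<lambda>g x. p g * q x)"
    have F: "bilin H Y scalars (\<lambda>g y. p (mul H g a) * q y)" if "a \<in> carr H" for a
      using that by (intro bilinI) (simp_all add: lins)
    have G: "bilin H Y scalars (\<lambda>g y. p (mul H a g) * q (act Y b y))" if "a \<in> carr H" "b \<in> carr H" for a b
      using that by (intro bilinI) (simp_all add: lins)
    have "?L ?s = sw H h (\<lambda>h1 h2. cosw H X (act X h1 x) (\<lambda>g y. p (mul H g h2) * q (\<iota> y)))"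
      by (simp add: linmap_swH[OF pX_lin[OF p q]] linmap_cosw[OF pX_lin[OF p q]] cosw_mem tens_mem_HX pX_tens[OF p q]
        cong: swH_cong cosw_cong)
    also have "\<dots> = sw H h (\<lambda>h1 h2. cosw H Y (act Y h1 (\<iota> x)) (\<lambda>g y. p (mul H g h2) * q y))"
      by (rule swH_cong[OF h]) (simp add: cosw_\<iota>[OF _ F] \<iota>_act)
    also have "\<dots> = ?M (sw H h (\<lambda>h1 h2. cosw H Y (act Y h1 (\<iota> x)) (\<lambda>g y. tens H Y (mul H g h2) y)))"
      by (simp add: linmap_swH[OF pY_lin[OF p q]] linmap_cosw[OF pY_lin[OF p q]] cosw_mem tens_mem_HX pY_tens[OF p q]
        cong: swH_cong cosw_cong)
    also have "\<dots> = ?M (sw H h (\<lambda>h1 h2. cosw H Y (\<iota> x) (\<lambda>g x0. tens H Y (mul H h1 g) (act Y h2 x0))))"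
      using Y by (simp add: yd_module_algebra_def)
    also have "\<dots> = sw H h (\<lambda>h1 h2. cosw H Y (\<iota> x) (\<lambda>g x0. p (mul H h1 g) * q (act Y h2 x0)))"
      by (simp add: linmap_swH[OF pY_lin[OF p q]] linmap_cosw[OF pY_lin[OF p q]] cosw_mem tens_mem_HX pY_tens[OF p q]
        cong: swH_cong cosw_cong)
    also have "\<dots> = sw H h (\<lambda>h1 h2. cosw H X x (\<lambda>g x0. p (mul H h1 g) * q (act Y h2 (\<iota> x0))))"
      by (rule swH_cong[OF h]) (simp add: cosw_\<iota>[OF _ G])
    also have "\<dots> = ?L ?t"
      by (simp add: linmap_swH[OF pX_lin[OF p q]] linmap_cosw[OF pX_lin[OF p q]] cosw_mem tens_mem_HX pX_tens[OF p q]
        \<iota>_act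
        cong: swH_cong cosw_cong)
    finally show "?L ?s = ?L ?t" .
  qed (simp_all add: swH_mem cosw_mem tens_mem_HX)
qed

lemma braided_commutativeX:
  assumes "braided_commutative H Y"
  shows "braided_commutative H X"
  unfolding braided_commutative_def
proof (intro ballI X_eqI)
  fix x y q assume x [simp]: "x \<in> carr X" and y [simp]: "y \<in> carr X" and q: "linmap Y scalars q"
  have F: "bilin H Y scalars (\<lambda>g y. q (mul Y (act Y g (\<iota> x)) y))"
    by (intro bilinI linmap_comp[OF linmap_q_mul(2)[OF q] bilin_left[OF bilin_actY]])
      (simp_all add: linmap_q_mul[OF q])
  have "q (\<iota> (cosw H X y (\<lambda>g y0. mul X (act X g x) y0))) = cosw H X y (\<lambda>g y0. q (mul Y (act Y g (\<iota> x)) (\<iota> y0)))"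
    by (simp add: linmap_cosw[OF q\<iota>[OF q]] \<iota>_mul \<iota>_act cong: cosw_cong)
  also have "\<dots> = cosw H Y (\<iota> y) (\<lambda>g y. q (mul Y (act Y g (\<iota> x)) y))"
    by (rule cosw_\<iota>[OF y F])
  also have "\<dots> = q (cosw H Y (\<iota> y) (\<lambda>g y. mul Y (act Y g (\<iota> x)) y))"
    by (simp add: linmap_cosw[OF q] cong: cosw_cong)
  also have "\<dots> = q (\<iota> (mul X y x))"
    using assms by (simp add: braided_commutative_def \<iota>_mul)
  finally show "q (\<iota> (mul X y x)) = q (\<iota> (cosw H X y (\<lambda>g y0. mul X (act X g x) y0)))" ..
qed (simp_all add: cosw_mem)

end

section \<open>Sweedler calculus in a Hopf algebra\<close>

locale hopf_bij =
  fixes B :: "('k::field, 'b::ab_group_add) hopf"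
  assumes hopf: "hopf_algebra_bij B"
begin

abbreviation C :: "'b set" where "C \<equiv> carr B"
abbreviation mult (infixr "\<cdot>" 70) where "a \<cdot> b \<equiv> mul B a b"
abbreviation one ("\<one>") where "\<one> \<equiv> unity B"
abbreviation S where "S \<equiv> antip B"
abbreviation T where "T \<equiv> antip_inv B"
abbreviation \<epsilon> where "\<epsilon> \<equiv> counit B"
abbreviation form where "form \<equiv> linmap B scalars"

lemma alg: "algebra B" and coalg: "coalgebra B"
  using hopf by (auto simp: hopf_algebra_bij_def hopf_algebra_def bialgebra_def)

lemma vspace_B [simp]: "vspace B"
  using alg by (simp add: algebra_def)

lemma mult_bilin: "bilin B B B (mul B)"
  using alg by (simp add: algebra_def)

lemma mult_closed [simp]: "a \<in> C \<Longrightarrow> b \<in> C \<Longrightarrow> a \<cdot> b \<in> C"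
  by (rule bilin_mem[OF mult_bilin])

lemma one_closed [simp]: "\<one> \<in> C"
  using alg by (simp add: algebra_def)

lemma mult_assoc [simp]: "a \<in> C \<Longrightarrow> b \<in> C \<Longrightarrow> c \<in> C \<Longrightarrow> (a \<cdot> b) \<cdot> c = a \<cdot> b \<cdot> c"
  using alg by (simp add: algebra_def)

lemma mult_one [simp]: "a \<in> C \<Longrightarrow> \<one> \<cdot> a = a" "a \<in> C \<Longrightarrow> a \<cdot> \<one> = a"
  using alg by (auto simp: algebra_def)

lemma scal_closed [simp]: "a \<in> C \<Longrightarrow> scal B c a \<in> C"
  by (rule vspace_scal[OF vspace_B])

lemma S_lin: "linmap B B S" and S_bij: "bij_betw S C C"
  using hopf by (simp_all add: hopf_algebra_bij_def hopf_algebra_def)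

lemma S_closed [simp]: "a \<in> C \<Longrightarrow> S a \<in> C"
  by (rule linmap_mem[OF S_lin])

lemma T_closed [simp]: "a \<in> C \<Longrightarrow> T a \<in> C"
  unfolding antip_inv_def using S_bij by (metis bij_betw_imp_surj_on inv_into_into)

lemma S_T [simp]: "a \<in> C \<Longrightarrow> S (T a) = a"
  unfolding antip_inv_def using S_bij by (metis bij_betw_inv_into_right)

lemma T_S [simp]: "a \<in> C \<Longrightarrow> T (S a) = a"
  unfolding antip_inv_def using S_bij by (metis bij_betw_inv_into_left)

lemma S_inj: "a \<in> C \<Longrightarrow> b \<in> C \<Longrightarrow> S a = S b \<Longrightarrow> a = b"
  by (metis T_S)

lemma T_lin: "linmap B B T"
  unfolding linmap_def
proof (intro conjI ballI allI)
  fix x y c assume x: "x \<in> C"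
  then show "T x \<in> C" by simp
  show "T (scal B c x) = scal B c (T x)"
    by (rule S_inj) (simp_all add: x linmap_scal[OF S_lin])
  assume y: "y \<in> C"
  show "T (x + y) = T x + T y"
    by (rule S_inj) (simp_all add: x y linmap_add[OF S_lin] vspace_add)
qed

lemma comul_lin: "linmap B (tspace B B) (comul B)"
  using coalg by (simp add: coalgebra_def)

lemma comul_closed [simp]: "b \<in> C \<Longrightarrow> comul B b \<in> carr (tspace B B)"
  by (rule linmap_mem[OF comul_lin])

lemma counit_lin: "form \<epsilon>"
  using coalg by (simp add: coalgebra_def)

subsection \<open>Sweedler sums\<close>

text \<open>The value \<open>0\<close> outside the carrier makes the congruence rule unconditional.\<close>

definition SW :: "'b \<Rightarrow> ('b \<Rightarrow> 'b \<Rightarrow> 'c::ab_group_add) \<Rightarrow> 'c" where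
  "SW b f = (if b \<in> C then sw B b f else 0)"

lemma sw_eq_SW: "b \<in> C \<Longrightarrow> sw B b f = SW b f"
  by (simp add: SW_def)

lemma SW_tsum: "b \<in> C \<Longrightarrow> SW b f = tsum B B (comul B b) f"
  by (simp add: SW_def sw_def)

lemma SW_cong:
  "b = b' \<Longrightarrow> (\<And>x y. x \<in> C \<Longrightarrow> y \<in> C \<Longrightarrow> f x y = g x y) \<Longrightarrow> SW b f = SW b' g"
  using tsum_cong[of B "comul B b'" B f g] by (simp add: SW_def sw_def)

lemma tsum_zero: "tsum U V t (\<lambda>x y. 0) = 0"
  by (simp add: tsum_tlist sum_list_0)

lemma SW_swap: "SW a (\<lambda>x y. SW b (\<lambda>u v. f x y u v)) = SW b (\<lambda>u v. SW a (\<lambda>x y. f x y u v))"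
  by (auto simp: SW_def sw_def tsum_zero intro: tsum_swap)

lemma SW_mult_left: "c * SW b f = SW b (\<lambda>x y. c * f x y :: 'k)"
  by (simp add: SW_def sw_def tsum_mult_left)

lemma SW_mult_right: "SW b f * c = SW b (\<lambda>x y. f x y * c :: 'k)"
  by (simp add: SW_def sw_def tsum_mult_right)

lemma SW_mem:
  "vspace W \<Longrightarrow> (\<And>u v. u \<in> C \<Longrightarrow> v \<in> C \<Longrightarrow> f u v \<in> carr W) \<Longrightarrow> SW b f \<in> carr W"
  by (simp add: SW_def sw_def tsum_mem vspace_zero)

lemma linmap_SW:
  "linmap W Z g \<Longrightarrow> vspace W \<Longrightarrow> (\<And>u v. u \<in> C \<Longrightarrow> v \<in> C \<Longrightarrow> f u v \<in> carr W) \<Longrightarrow>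
    g (SW b f) = SW b (\<lambda>u v. g (f u v))"
  by (simp add: SW_def sw_def linmap_tsum linmap_zero)

lemma form_zero: "linmap V scalars (\<lambda>z. 0)"
  by (simp add: linmap_def)

lemma form_SW_fun:
  "(\<And>u v. u \<in> C \<Longrightarrow> v \<in> C \<Longrightarrow> linmap V scalars (\<lambda>z. f z u v)) \<Longrightarrow>
    linmap V scalars (\<lambda>z. SW b (f z))"
  unfolding SW_def sw_def by (cases "b \<in> C") (simp_all add: linmap_tsum_fun form_zero)

lemma form_SW_arg:
  assumes "\<And>u. u \<in> C \<Longrightarrow> form (f u)" "\<And>v. v \<in> C \<Longrightarrow> form (\<lambda>u. f u v)" "linmap V B g" "vspace V"
  shows "linmap V scalars (\<lambda>z. SW (g z) f)"
proof -
  have "linmap V scalars (\<lambda>z. tsum B B (comul B (g z)) f)"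
    using assms by (intro linmap_tsum_arg linmap_comp[OF comul_lin]) (simp_all add: bilinI)
  then show ?thesis
    by (rule iffD2[OF linmap_cong[OF _ assms(4)], rotated])
      (simp add: SW_tsum linmap_mem[OF assms(3)])
qed

lemma lin_mult_left: "c \<in> C \<Longrightarrow> linmap V B g \<Longrightarrow> linmap V B (\<lambda>z. c \<cdot> g z)"
  by (rule linmap_comp[OF bilin_right[OF mult_bilin]])

lemma lin_mult_right: "c \<in> C \<Longrightarrow> linmap V B g \<Longrightarrow> linmap V B (\<lambda>z. g z \<cdot> c)"
  by (rule linmap_comp[OF bilin_left[OF mult_bilin]])

lemma lin_S: "linmap V B g \<Longrightarrow> linmap V B (\<lambda>z. S (g z))"
  by (rule linmap_comp[OF S_lin])

lemma lin_T: "linmap V B g \<Longrightarrow> linmap V B (\<lambda>z. T (g z))"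
  by (rule linmap_comp[OF T_lin])

lemma form_counit: "linmap V B g \<Longrightarrow> linmap V scalars (\<lambda>z. \<epsilon> (g z))"
  by (rule linmap_comp[OF counit_lin])

lemmas lin_rules = linmap_id linmap_mult_left linmap_mult_right form_SW_fun form_SW_arg
  lin_mult_left lin_mult_right lin_S lin_T form_counit

lemma SW_tens:
  assumes "a \<in> C" "b \<in> C" "c \<in> C" "comul B c = tens B B a b"
    "\<And>u. u \<in> C \<Longrightarrow> form (f u)" "\<And>v. v \<in> C \<Longrightarrow> form (\<lambda>u. f u v)"
  shows "SW c f = f a b"
  using assms by (simp add: SW_tsum tsum_tens[OF vspace_scalars] bilinI)

lemma SW_one:
  assumes "\<And>u. u \<in> C \<Longrightarrow> form (f u)" "\<And>v. v \<in> C \<Longrightarrow> form (\<lambda>u. f u v)"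
  shows "SW \<one> f = f \<one> \<one>"
  using hopf by (intro SW_tens assms) (simp_all add: hopf_algebra_bij_def hopf_algebra_def bialgebra_def)

lemma counit_one [simp]: "\<epsilon> \<one> = 1"
  using hopf by (simp add: hopf_algebra_bij_def hopf_algebra_def bialgebra_def)

lemma counit_mult [simp]: "a \<in> C \<Longrightarrow> b \<in> C \<Longrightarrow> \<epsilon> (a \<cdot> b) = \<epsilon> a * \<epsilon> b"
  using hopf by (simp add: hopf_algebra_bij_def hopf_algebra_def bialgebra_def)

lemma SW_mult:
  assumes "a \<in> C" "b \<in> C" "\<And>u. u \<in> C \<Longrightarrow> form (f u)" "\<And>v. v \<in> C \<Longrightarrow> form (\<lambda>u. f u v)"
  shows "SW (a \<cdot> b) f = SW a (\<lambda>a1 a2. SW b (\<lambda>b1 b2. f (a1 \<cdot> b1) (a2 \<cdot> b2)))"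
proof -
  have bil: "bilin B B scalars f" using assms by (intro bilinI)
  have c: "comul B (a \<cdot> b) = tsum B B (comul B a) (\<lambda>a1 a2. tsum B B (comul B b)
      (\<lambda>b1 b2. tens B B (a1 \<cdot> b1) (a2 \<cdot> b2)))"
    using hopf assms(1,2) by (simp add: hopf_algebra_bij_def hopf_algebra_def bialgebra_def sw_def)
  have "tsum B B (comul B (a \<cdot> b)) f = tsum B B (comul B a) (\<lambda>a1 a2. tsum B B (comul B b)
      (\<lambda>b1 b2. tsum B B (tens B B (a1 \<cdot> b1) (a2 \<cdot> b2)) f))"
    unfolding c using assms bil
    by (simp add: tsum_tsum[of B B scalars f B _ B] tsum_mem tens_mem cong: tsum_cong)
  also have "\<dots> = tsum B B (comul B a) (\<lambda>a1 a2. tsum B B (comul B b) (\<lambda>b1 b2. f (a1 \<cdot> b1) (a2 \<cdot> b2)))"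
    using assms(1,2) by (intro tsum_cong tsum_tens[OF vspace_scalars bil]) auto
  finally show ?thesis using assms(1,2) by (simp add: SW_tsum cong: tsum_cong)
qed

lemma SW_counit_left:
  assumes "b \<in> C" "form f"
  shows "SW b (\<lambda>x y. \<epsilon> x * f y) = f b"
proof -
  have "f b = f (SW b (\<lambda>c1 c2. scal B (\<epsilon> c1) c2))"
    using coalg assms by (simp add: coalgebra_def sw_eq_SW)
  also have "\<dots> = SW b (\<lambda>x y. f (scal B (\<epsilon> x) y))"
    using assms by (simp add: SW_tsum linmap_tsum[of _ _ _ B scalars])
  also have "\<dots> = SW b (\<lambda>x y. \<epsilon> x * f y)"
    using assms by (intro SW_cong) (auto simp: linmap_def)
  finally show ?thesis by simp
qed

lemma SW_counit_right:
  assumes "b \<in> C" "form f"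
  shows "SW b (\<lambda>x y. \<epsilon> y * f x) = f b"
proof -
  have "f b = f (SW b (\<lambda>c1 c2. scal B (\<epsilon> c2) c1))"
    using coalg assms by (simp add: coalgebra_def sw_eq_SW)
  also have "\<dots> = SW b (\<lambda>x y. f (scal B (\<epsilon> y) x))"
    using assms by (simp add: SW_tsum linmap_tsum[of _ _ _ B scalars])
  also have "\<dots> = SW b (\<lambda>x y. \<epsilon> y * f x)"
    using assms by (intro SW_cong) (auto simp: linmap_def)
  finally show ?thesis by simp
qed

lemma SW_coassoc:
  assumes b: "b \<in> C"
    and f: "\<And>v w. v \<in> C \<Longrightarrow> w \<in> C \<Longrightarrow> form (\<lambda>u. f u v w)"
      "\<And>u w. u \<in> C \<Longrightarrow> w \<in> C \<Longrightarrow> form (\<lambda>v. f u v w)"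
      "\<And>u v. u \<in> C \<Longrightarrow> v \<in> C \<Longrightarrow> form (\<lambda>w. f u v w)"
  shows "SW b (\<lambda>x w. SW x (\<lambda>u v. f u v w)) = SW b (\<lambda>u x. SW x (\<lambda>v w. f u v w))"
proof -
  let ?g = "\<lambda>s w. tsum B B s (\<lambda>u v. f u v w)"
  let ?G = "\<lambda>t. tsum (tspace B B) B t ?g"
  have bil: "bilin (tspace B B) B scalars ?g"
    using f by (intro bilinI linmap_tsum_fun tsum_linmap) auto
  have lin: "linmap (tspace (tspace B B) B) scalars ?G"
    by (intro tsum_linmap bil) auto
  have t3: "tens3 B B B u v w \<in> carr (tspace (tspace B B) B)" "?G (tens3 B B B u v w) = f u v w"
    if "u \<in> C" "v \<in> C" "w \<in> C" for u v w
  proof -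
    show "tens3 B B B u v w \<in> carr (tspace (tspace B B) B)"
      unfolding tens3_def using that by (intro tens_mem) auto
    have "?G (tens3 B B B u v w) = tsum B B (tens B B u v) (\<lambda>u v. f u v w)"
      unfolding tens3_def using that by (intro tsum_tens[OF vspace_scalars bil] tens_mem) auto
    also have "\<dots> = f u v w"
      using that f by (intro tsum_tens[OF vspace_scalars] bilinI) auto
    finally show "?G (tens3 B B B u v w) = f u v w" .
  qed
  have "SW b (\<lambda>x w. SW x (\<lambda>u v. tens3 B B B u v w)) =
      SW b (\<lambda>u x. SW x (\<lambda>v w. tens3 B B B u v w))"
    using coalg b by (simp add: coalgebra_def sw_eq_SW cong: SW_cong)
  then have "?G (SW b (\<lambda>x w. SW x (\<lambda>u v. tens3 B B B u v w))) =
      ?G (SW b (\<lambda>u x. SW x (\<lambda>v w. tens3 B B B u v w)))" by simp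
  moreover have "?G (SW b (\<lambda>x w. SW x (\<lambda>u v. tens3 B B B u v w))) =
      SW b (\<lambda>x w. SW x (\<lambda>u v. f u v w))"
    using t3 by (simp add: linmap_SW[OF lin] SW_mem cong: SW_cong)
  moreover have "?G (SW b (\<lambda>u x. SW x (\<lambda>v w. tens3 B B B u v w))) =
      SW b (\<lambda>u x. SW x (\<lambda>v w. f u v w))"
    using t3 by (simp add: linmap_SW[OF lin] SW_mem cong: SW_cong)
  ultimately show ?thesis by simp
qed

lemma SW_S_left:
  assumes "b \<in> C" "form f"
  shows "SW b (\<lambda>x y. f (S x \<cdot> y)) = \<epsilon> b * f \<one>"
proof -
  have "SW b (\<lambda>x y. f (S x \<cdot> y)) = f (SW b (\<lambda>x y. S x \<cdot> y))"
    using assms by (simp add: SW_tsum linmap_tsum[of _ _ _ B scalars])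
  also have "\<dots> = f (scal B (\<epsilon> b) \<one>)"
    using hopf assms(1) by (simp add: hopf_algebra_bij_def hopf_algebra_def sw_eq_SW)
  finally show ?thesis using linmap_scal[OF assms(2)] by simp
qed

definition trilin :: "('b \<Rightarrow> 'b \<Rightarrow> 'b \<Rightarrow> 'k) \<Rightarrow> bool" where
  "trilin f \<longleftrightarrow> (\<forall>v\<in>C. \<forall>w\<in>C. form (\<lambda>u. f u v w)) \<and> (\<forall>u\<in>C. \<forall>w\<in>C. form (\<lambda>v. f u v w)) \<and>
    (\<forall>u\<in>C. \<forall>v\<in>C. form (\<lambda>w. f u v w))"

lemma trilinI [simp]:
  "(\<And>v w. v \<in> C \<Longrightarrow> w \<in> C \<Longrightarrow> form (\<lambda>u. f u v w)) \<Longrightarrow>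
    (\<And>u w. u \<in> C \<Longrightarrow> w \<in> C \<Longrightarrow> form (\<lambda>v. f u v w)) \<Longrightarrow>
    (\<And>u v. u \<in> C \<Longrightarrow> v \<in> C \<Longrightarrow> form (\<lambda>w. f u v w)) \<Longrightarrow> trilin f"
  by (simp add: trilin_def)

lemma SW_coassoc_under:
  assumes "a \<in> C" "trilin G" and g: "\<And>x w. g x w = SW x (\<lambda>p q. G p q w)"
  shows "SW a g = SW a (\<lambda>p z. SW z (\<lambda>q w. G p q w))"
proof -
  have "SW a (\<lambda>x w. SW x (\<lambda>p q. G p q w)) = SW a (\<lambda>p z. SW z (\<lambda>q w. G p q w))"
    by (rule SW_coassoc[OF assms(1)]) (use assms(2) in \<open>simp_all add: trilin_def\<close>)
  moreover have "g = (\<lambda>x w. SW x (\<lambda>p q. G p q w))" by (intro ext g)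
  ultimately show ?thesis by simp
qed

text \<open>Rewriting brings nested sums into right comb form; these two families see through the sums that
  may stand between the two that have to be reassociated.\<close>

lemma SW_coassoc1:
  assumes "a \<in> C" "trilin (\<lambda>p q w. SW (b1 w) (\<lambda>u1 v1. f p q w u1 v1))"
  shows "SW a (\<lambda>x w. SW (b1 w) (\<lambda>u1 v1. SW x (\<lambda>p q. f p q w u1 v1))) =
    SW a (\<lambda>p z. SW z (\<lambda>q w. SW (b1 w) (\<lambda>u1 v1. f p q w u1 v1)))"
  apply (rule SW_coassoc_under[OF assms])
  subgoal for x w by (simp only: SW_swap[where b=x])
  done

lemma SW_right1:
  "SW a (\<lambda>x w. SW (b1 x) (\<lambda>u1 v1. SW w (\<lambda>p q. f x p q u1 v1))) =
    SW a (\<lambda>x w. SW w (\<lambda>p q. SW (b1 x) (\<lambda>u1 v1. f x p q u1 v1)))"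
  apply (rule SW_cong[OF refl])
  subgoal for x w by (simp only: SW_swap[where b=w])
  done

lemma SW_coassoc2:
  assumes "a \<in> C" "trilin (\<lambda>p q w. SW (b1 w) (\<lambda>u1 v1. SW (b2 w u1 v1) (\<lambda>u2 v2. f p q w u1 v1 u2 v2)))"
  shows "SW a (\<lambda>x w. SW (b1 w) (\<lambda>u1 v1. SW (b2 w u1 v1) (\<lambda>u2 v2. SW x (\<lambda>p q. f p q w u1 v1 u2 v2)))) =
    SW a (\<lambda>p z. SW z (\<lambda>q w. SW (b1 w) (\<lambda>u1 v1. SW (b2 w u1 v1) (\<lambda>u2 v2. f p q w u1 v1 u2 v2))))"
  apply (rule SW_coassoc_under[OF assms])
  subgoal for x w by (simp only: SW_swap[where b=x])
  done

lemma SW_right2: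
  "SW a (\<lambda>x w. SW (b1 x) (\<lambda>u1 v1. SW (b2 x u1 v1) (\<lambda>u2 v2. SW w (\<lambda>p q. f x p q u1 v1 u2 v2)))) =
    SW a (\<lambda>x w. SW w (\<lambda>p q. SW (b1 x) (\<lambda>u1 v1. SW (b2 x u1 v1) (\<lambda>u2 v2. f x p q u1 v1 u2 v2))))"
  apply (rule SW_cong[OF refl])
  subgoal for x w by (simp only: SW_swap[where b=w])
  done

lemma SW_coassoc3:
  assumes "a \<in> C" "trilin (\<lambda>p q w. SW (b1 w) (\<lambda>u1 v1. SW (b2 w u1 v1) (\<lambda>u2 v2. SW (b3 w u1 v1 u2 v2) (\<lambda>u3 v3. f p q w
    u1 v1 u2 v2 u3 v3))))"
  shows "SW a (\<lambda>x w. SW (b1 w) (\<lambda>u1 v1. SW (b2 w u1 v1) (\<lambda>u2 v2. SW (b3 w u1 v1 u2 v2) (\<lambda>u3 v3. SW x (\<lambda>p q. f p q w u1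
    v1 u2 v2 u3 v3))))) =
    SW a (\<lambda>p z. SW z (\<lambda>q w. SW (b1 w) (\<lambda>u1 v1. SW (b2 w u1 v1) (\<lambda>u2 v2. SW (b3 w u1 v1 u2 v2) (\<lambda>u3 v3. f p q w u1 v1
      u2 v2 u3 v3)))))"
  apply (rule SW_coassoc_under[OF assms])
  subgoal for x w by (simp only: SW_swap[where b=x])
  done

lemma SW_right3:
  "SW a (\<lambda>x w. SW (b1 x) (\<lambda>u1 v1. SW (b2 x u1 v1) (\<lambda>u2 v2. SW (b3 x u1 v1 u2 v2) (\<lambda>u3 v3. SW w (\<lambda>p q. f x p q u1 v1 u2
    v2 u3 v3))))) =
    SW a (\<lambda>x w. SW w (\<lambda>p q. SW (b1 x) (\<lambda>u1 v1. SW (b2 x u1 v1) (\<lambda>u2 v2. SW (b3 x u1 v1 u2 v2) (\<lambda>u3 v3. f x p q u1 v1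
      u2 v2 u3 v3)))))"
  apply (rule SW_cong[OF refl])
  subgoal for x w by (simp only: SW_swap[where b=w])
  done

lemma SW_coassoc4:
  assumes "a \<in> C" "trilin (\<lambda>p q w. SW (b1 w) (\<lambda>u1 v1. SW (b2 w u1 v1) (\<lambda>u2 v2. SW (b3 w u1 v1 u2 v2) (\<lambda>u3 v3. SW (b4 w
    u1 v1 u2 v2 u3 v3) (\<lambda>u4 v4. f p q w u1 v1 u2 v2 u3 v3 u4 v4)))))"
  shows "SW a (\<lambda>x w. SW (b1 w) (\<lambda>u1 v1. SW (b2 w u1 v1) (\<lambda>u2 v2. SW (b3 w u1 v1 u2 v2) (\<lambda>u3 v3. SW (b4 w u1 v1 u2 v2
    u3 v3) (\<lambda>u4 v4. SW x (\<lambda>p q. f p q w u1 v1 u2 v2 u3 v3 u4 v4)))))) =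
    SW a (\<lambda>p z. SW z (\<lambda>q w. SW (b1 w) (\<lambda>u1 v1. SW (b2 w u1 v1) (\<lambda>u2 v2. SW (b3 w u1 v1 u2 v2) (\<lambda>u3 v3. SW (b4 w u1 v1
      u2 v2 u3 v3) (\<lambda>u4 v4. f p q w u1 v1 u2 v2 u3 v3 u4 v4))))))"
  apply (rule SW_coassoc_under[OF assms])
  subgoal for x w by (simp only: SW_swap[where b=x])
  done

lemma SW_right4:
  "SW a (\<lambda>x w. SW (b1 x) (\<lambda>u1 v1. SW (b2 x u1 v1) (\<lambda>u2 v2. SW (b3 x u1 v1 u2 v2) (\<lambda>u3 v3. SW (b4 x u1 v1 u2 v2 u3 v3)
    (\<lambda>u4 v4. SW w (\<lambda>p q. f x p q u1 v1 u2 v2 u3 v3 u4 v4)))))) =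
    SW a (\<lambda>x w. SW w (\<lambda>p q. SW (b1 x) (\<lambda>u1 v1. SW (b2 x u1 v1) (\<lambda>u2 v2. SW (b3 x u1 v1 u2 v2) (\<lambda>u3 v3. SW (b4 x u1 v1
      u2 v2 u3 v3) (\<lambda>u4 v4. f x p q u1 v1 u2 v2 u3 v3 u4 v4))))))"
  apply (rule SW_cong[OF refl])
  subgoal for x w by (simp only: SW_swap[where b=w])
  done

lemma SW_coassoc5:
  assumes "a \<in> C" "trilin (\<lambda>p q w. SW (b1 w) (\<lambda>u1 v1. SW (b2 w u1 v1) (\<lambda>u2 v2. SW (b3 w u1 v1 u2 v2) (\<lambda>u3 v3. SW (b4 w
    u1 v1 u2 v2 u3 v3) (\<lambda>u4 v4. SW (b5 w u1 v1 u2 v2 u3 v3 u4 v4) (\<lambda>u5 v5. f p q w u1 v1 u2 v2 u3 v3 u4 v4 u5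
    v5))))))"
  shows "SW a (\<lambda>x w. SW (b1 w) (\<lambda>u1 v1. SW (b2 w u1 v1) (\<lambda>u2 v2. SW (b3 w u1 v1 u2 v2) (\<lambda>u3 v3. SW (b4 w u1 v1 u2 v2
    u3 v3) (\<lambda>u4 v4. SW (b5 w u1 v1 u2 v2 u3 v3 u4 v4) (\<lambda>u5 v5. SW x (\<lambda>p q. f p q w u1 v1 u2 v2 u3 v3 u4 v4 u5
    v5))))))) =
    SW a (\<lambda>p z. SW z (\<lambda>q w. SW (b1 w) (\<lambda>u1 v1. SW (b2 w u1 v1) (\<lambda>u2 v2. SW (b3 w u1 v1 u2 v2) (\<lambda>u3 v3. SW (b4 w u1 v1
      u2 v2 u3 v3) (\<lambda>u4 v4. SW (b5 w u1 v1 u2 v2 u3 v3 u4 v4) (\<lambda>u5 v5. f p q w u1 v1 u2 v2 u3 v3 u4 v4 u5 v5)))))))"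
  apply (rule SW_coassoc_under[OF assms])
  subgoal for x w by (simp only: SW_swap[where b=x])
  done

lemma SW_right5:
  "SW a (\<lambda>x w. SW (b1 x) (\<lambda>u1 v1. SW (b2 x u1 v1) (\<lambda>u2 v2. SW (b3 x u1 v1 u2 v2) (\<lambda>u3 v3. SW (b4 x u1 v1 u2 v2 u3 v3)
    (\<lambda>u4 v4. SW (b5 x u1 v1 u2 v2 u3 v3 u4 v4) (\<lambda>u5 v5. SW w (\<lambda>p q. f x p q u1 v1 u2 v2 u3 v3 u4 v4 u5 v5))))))) =
    SW a (\<lambda>x w. SW w (\<lambda>p q. SW (b1 x) (\<lambda>u1 v1. SW (b2 x u1 v1) (\<lambda>u2 v2. SW (b3 x u1 v1 u2 v2) (\<lambda>u3 v3. SW (b4 x u1 v1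
      u2 v2 u3 v3) (\<lambda>u4 v4. SW (b5 x u1 v1 u2 v2 u3 v3 u4 v4) (\<lambda>u5 v5. f x p q u1 v1 u2 v2 u3 v3 u4 v4 u5 v5)))))))"
  apply (rule SW_cong[OF refl])
  subgoal for x w by (simp only: SW_swap[where b=w])
  done

lemma SW_coassoc6:
  assumes "a \<in> C" "trilin (\<lambda>p q w. SW (b1 w) (\<lambda>u1 v1. SW (b2 w u1 v1) (\<lambda>u2 v2. SW (b3 w u1 v1 u2 v2) (\<lambda>u3 v3. SW (b4 w
    u1 v1 u2 v2 u3 v3) (\<lambda>u4 v4. SW (b5 w u1 v1 u2 v2 u3 v3 u4 v4) (\<lambda>u5 v5. SW (b6 w u1 v1 u2 v2 u3 v3 u4 v4 u5 v5)
    (\<lambda>u6 v6. f p q w u1 v1 u2 v2 u3 v3 u4 v4 u5 v5 u6 v6)))))))"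
  shows "SW a (\<lambda>x w. SW (b1 w) (\<lambda>u1 v1. SW (b2 w u1 v1) (\<lambda>u2 v2. SW (b3 w u1 v1 u2 v2) (\<lambda>u3 v3. SW (b4 w u1 v1 u2 v2
    u3 v3) (\<lambda>u4 v4. SW (b5 w u1 v1 u2 v2 u3 v3 u4 v4) (\<lambda>u5 v5. SW (b6 w u1 v1 u2 v2 u3 v3 u4 v4 u5 v5) (\<lambda>u6 v6. SW x
    (\<lambda>p q. f p q w u1 v1 u2 v2 u3 v3 u4 v4 u5 v5 u6 v6)))))))) =
    SW a (\<lambda>p z. SW z (\<lambda>q w. SW (b1 w) (\<lambda>u1 v1. SW (b2 w u1 v1) (\<lambda>u2 v2. SW (b3 w u1 v1 u2 v2) (\<lambda>u3 v3. SW (b4 w u1 v1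
      u2 v2 u3 v3) (\<lambda>u4 v4. SW (b5 w u1 v1 u2 v2 u3 v3 u4 v4) (\<lambda>u5 v5. SW (b6 w u1 v1 u2 v2 u3 v3 u4 v4 u5 v5) (\<lambda>u6
      v6. f p q w u1 v1 u2 v2 u3 v3 u4 v4 u5 v5 u6 v6))))))))"
  apply (rule SW_coassoc_under[OF assms])
  subgoal for x w by (simp only: SW_swap[where b=x])
  done

lemma SW_right6:
  "SW a (\<lambda>x w. SW (b1 x) (\<lambda>u1 v1. SW (b2 x u1 v1) (\<lambda>u2 v2. SW (b3 x u1 v1 u2 v2) (\<lambda>u3 v3. SW (b4 x u1 v1 u2 v2 u3 v3)
    (\<lambda>u4 v4. SW (b5 x u1 v1 u2 v2 u3 v3 u4 v4) (\<lambda>u5 v5. SW (b6 x u1 v1 u2 v2 u3 v3 u4 v4 u5 v5) (\<lambda>u6 v6. SW w (\<lambda>p q. f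
    x p q u1 v1 u2 v2 u3 v3 u4 v4 u5 v5 u6 v6)))))))) =
    SW a (\<lambda>x w. SW w (\<lambda>p q. SW (b1 x) (\<lambda>u1 v1. SW (b2 x u1 v1) (\<lambda>u2 v2. SW (b3 x u1 v1 u2 v2) (\<lambda>u3 v3. SW (b4 x u1 v1
      u2 v2 u3 v3) (\<lambda>u4 v4. SW (b5 x u1 v1 u2 v2 u3 v3 u4 v4) (\<lambda>u5 v5. SW (b6 x u1 v1 u2 v2 u3 v3 u4 v4 u5 v5) (\<lambda>u6
      v6. f x p q u1 v1 u2 v2 u3 v3 u4 v4 u5 v5 u6 v6))))))))"
  apply (rule SW_cong[OF refl])
  subgoal for x w by (simp only: SW_swap[where b=w])
  done

lemma SW_coassoc7:
  assumes "a \<in> C" "trilin (\<lambda>p q w. SW (b1 w) (\<lambda>u1 v1. SW (b2 w u1 v1) (\<lambda>u2 v2. SW (b3 w u1 v1 u2 v2) (\<lambda>u3 v3. SW (b4 w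
    u1 v1 u2 v2 u3 v3) (\<lambda>u4 v4. SW (b5 w u1 v1 u2 v2 u3 v3 u4 v4) (\<lambda>u5 v5. SW (b6 w u1 v1 u2 v2 u3 v3 u4 v4 u5 v5)
    (\<lambda>u6 v6. SW (b7 w u1 v1 u2 v2 u3 v3 u4 v4 u5 v5 u6 v6) (\<lambda>u7 v7. f p q w u1 v1 u2 v2 u3 v3 u4 v4 u5 v5 u6 v6 u7
    v7))))))))"
  shows "SW a (\<lambda>x w. SW (b1 w) (\<lambda>u1 v1. SW (b2 w u1 v1) (\<lambda>u2 v2. SW (b3 w u1 v1 u2 v2) (\<lambda>u3 v3. SW (b4 w u1 v1 u2 v2
    u3 v3) (\<lambda>u4 v4. SW (b5 w u1 v1 u2 v2 u3 v3 u4 v4) (\<lambda>u5 v5. SW (b6 w u1 v1 u2 v2 u3 v3 u4 v4 u5 v5) (\<lambda>u6 v6. SW (b7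
    w u1 v1 u2 v2 u3 v3 u4 v4 u5 v5 u6 v6) (\<lambda>u7 v7. SW x (\<lambda>p q. f p q w u1 v1 u2 v2 u3 v3 u4 v4 u5 v5 u6 v6 u7
    v7))))))))) =
    SW a (\<lambda>p z. SW z (\<lambda>q w. SW (b1 w) (\<lambda>u1 v1. SW (b2 w u1 v1) (\<lambda>u2 v2. SW (b3 w u1 v1 u2 v2) (\<lambda>u3 v3. SW (b4 w u1 v1
      u2 v2 u3 v3) (\<lambda>u4 v4. SW (b5 w u1 v1 u2 v2 u3 v3 u4 v4) (\<lambda>u5 v5. SW (b6 w u1 v1 u2 v2 u3 v3 u4 v4 u5 v5) (\<lambda>u6
      v6. SW (b7 w u1 v1 u2 v2 u3 v3 u4 v4 u5 v5 u6 v6) (\<lambda>u7 v7. f p q w u1 v1 u2 v2 u3 v3 u4 v4 u5 v5 u6 v6 u7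
      v7)))))))))"
  apply (rule SW_coassoc_under[OF assms])
  subgoal for x w by (simp only: SW_swap[where b=x])
  done

lemma SW_right7:
  "SW a (\<lambda>x w. SW (b1 x) (\<lambda>u1 v1. SW (b2 x u1 v1) (\<lambda>u2 v2. SW (b3 x u1 v1 u2 v2) (\<lambda>u3 v3. SW (b4 x u1 v1 u2 v2 u3 v3)
    (\<lambda>u4 v4. SW (b5 x u1 v1 u2 v2 u3 v3 u4 v4) (\<lambda>u5 v5. SW (b6 x u1 v1 u2 v2 u3 v3 u4 v4 u5 v5) (\<lambda>u6 v6. SW (b7 x u1
    v1 u2 v2 u3 v3 u4 v4 u5 v5 u6 v6) (\<lambda>u7 v7. SW w (\<lambda>p q. f x p q u1 v1 u2 v2 u3 v3 u4 v4 u5 v5 u6 v6 u7 v7)))))))))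
    =
    SW a (\<lambda>x w. SW w (\<lambda>p q. SW (b1 x) (\<lambda>u1 v1. SW (b2 x u1 v1) (\<lambda>u2 v2. SW (b3 x u1 v1 u2 v2) (\<lambda>u3 v3. SW (b4 x u1 v1
      u2 v2 u3 v3) (\<lambda>u4 v4. SW (b5 x u1 v1 u2 v2 u3 v3 u4 v4) (\<lambda>u5 v5. SW (b6 x u1 v1 u2 v2 u3 v3 u4 v4 u5 v5) (\<lambda>u6
      v6. SW (b7 x u1 v1 u2 v2 u3 v3 u4 v4 u5 v5 u6 v6) (\<lambda>u7 v7. f x p q u1 v1 u2 v2 u3 v3 u4 v4 u5 v5 u6 v6 u7
      v7)))))))))"
  apply (rule SW_cong[OF refl])
  subgoal for x w by (simp only: SW_swap[where b=w])
  done

lemma SW_coassoc8: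
  assumes "a \<in> C" "trilin (\<lambda>p q w. SW (b1 w) (\<lambda>u1 v1. SW (b2 w u1 v1) (\<lambda>u2 v2. SW (b3 w u1 v1 u2 v2) (\<lambda>u3 v3. SW (b4 w
    u1 v1 u2 v2 u3 v3) (\<lambda>u4 v4. SW (b5 w u1 v1 u2 v2 u3 v3 u4 v4) (\<lambda>u5 v5. SW (b6 w u1 v1 u2 v2 u3 v3 u4 v4 u5 v5)
    (\<lambda>u6 v6. SW (b7 w u1 v1 u2 v2 u3 v3 u4 v4 u5 v5 u6 v6) (\<lambda>u7 v7. SW (b8 w u1 v1 u2 v2 u3 v3 u4 v4 u5 v5 u6 v6 u7
    v7) (\<lambda>u8 v8. f p q w u1 v1 u2 v2 u3 v3 u4 v4 u5 v5 u6 v6 u7 v7 u8 v8)))))))))"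
  shows "SW a (\<lambda>x w. SW (b1 w) (\<lambda>u1 v1. SW (b2 w u1 v1) (\<lambda>u2 v2. SW (b3 w u1 v1 u2 v2) (\<lambda>u3 v3. SW (b4 w u1 v1 u2 v2
    u3 v3) (\<lambda>u4 v4. SW (b5 w u1 v1 u2 v2 u3 v3 u4 v4) (\<lambda>u5 v5. SW (b6 w u1 v1 u2 v2 u3 v3 u4 v4 u5 v5) (\<lambda>u6 v6. SW (b7
    w u1 v1 u2 v2 u3 v3 u4 v4 u5 v5 u6 v6) (\<lambda>u7 v7. SW (b8 w u1 v1 u2 v2 u3 v3 u4 v4 u5 v5 u6 v6 u7 v7) (\<lambda>u8 v8. SW x
    (\<lambda>p q. f p q w u1 v1 u2 v2 u3 v3 u4 v4 u5 v5 u6 v6 u7 v7 u8 v8)))))))))) =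
    SW a (\<lambda>p z. SW z (\<lambda>q w. SW (b1 w) (\<lambda>u1 v1. SW (b2 w u1 v1) (\<lambda>u2 v2. SW (b3 w u1 v1 u2 v2) (\<lambda>u3 v3. SW (b4 w u1 v1
      u2 v2 u3 v3) (\<lambda>u4 v4. SW (b5 w u1 v1 u2 v2 u3 v3 u4 v4) (\<lambda>u5 v5. SW (b6 w u1 v1 u2 v2 u3 v3 u4 v4 u5 v5) (\<lambda>u6
      v6. SW (b7 w u1 v1 u2 v2 u3 v3 u4 v4 u5 v5 u6 v6) (\<lambda>u7 v7. SW (b8 w u1 v1 u2 v2 u3 v3 u4 v4 u5 v5 u6 v6 u7 v7)
      (\<lambda>u8 v8. f p q w u1 v1 u2 v2 u3 v3 u4 v4 u5 v5 u6 v6 u7 v7 u8 v8))))))))))"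
  apply (rule SW_coassoc_under[OF assms])
  subgoal for x w by (simp only: SW_swap[where b=x])
  done

lemma SW_right8:
  "SW a (\<lambda>x w. SW (b1 x) (\<lambda>u1 v1. SW (b2 x u1 v1) (\<lambda>u2 v2. SW (b3 x u1 v1 u2 v2) (\<lambda>u3 v3. SW (b4 x u1 v1 u2 v2 u3 v3)
    (\<lambda>u4 v4. SW (b5 x u1 v1 u2 v2 u3 v3 u4 v4) (\<lambda>u5 v5. SW (b6 x u1 v1 u2 v2 u3 v3 u4 v4 u5 v5) (\<lambda>u6 v6. SW (b7 x u1
    v1 u2 v2 u3 v3 u4 v4 u5 v5 u6 v6) (\<lambda>u7 v7. SW (b8 x u1 v1 u2 v2 u3 v3 u4 v4 u5 v5 u6 v6 u7 v7) (\<lambda>u8 v8. SW w (\<lambda>p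
    q. f x p q u1 v1 u2 v2 u3 v3 u4 v4 u5 v5 u6 v6 u7 v7 u8 v8)))))))))) =
    SW a (\<lambda>x w. SW w (\<lambda>p q. SW (b1 x) (\<lambda>u1 v1. SW (b2 x u1 v1) (\<lambda>u2 v2. SW (b3 x u1 v1 u2 v2) (\<lambda>u3 v3. SW (b4 x u1 v1
      u2 v2 u3 v3) (\<lambda>u4 v4. SW (b5 x u1 v1 u2 v2 u3 v3 u4 v4) (\<lambda>u5 v5. SW (b6 x u1 v1 u2 v2 u3 v3 u4 v4 u5 v5) (\<lambda>u6
      v6. SW (b7 x u1 v1 u2 v2 u3 v3 u4 v4 u5 v5 u6 v6) (\<lambda>u7 v7. SW (b8 x u1 v1 u2 v2 u3 v3 u4 v4 u5 v5 u6 v6 u7 v7)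
      (\<lambda>u8 v8. f x p q u1 v1 u2 v2 u3 v3 u4 v4 u5 v5 u6 v6 u7 v7 u8 v8))))))))))"
  apply (rule SW_cong[OF refl])
  subgoal for x w by (simp only: SW_swap[where b=w])
  done

lemmas SW_nest = SW_coassoc SW_coassoc1 SW_right1 SW_coassoc2 SW_right2 SW_coassoc3 SW_right3 SW_coassoc4 SW_right4
  SW_coassoc5 SW_right5 SW_coassoc6 SW_right6 SW_coassoc7 SW_right7 SW_coassoc8 SW_right8

text \<open>Tags on the variables make the exchange of sums an oriented rewrite rule: every sum inherits the
  tag of the variable that it splits, and sums are sorted by tag. Two Sweedler expressions that differ
  only by exchange of sums and coassociativity then become syntactically equal. Cancellations of an
  antipode have to be stated separately, because sorting separates the two sums that cancel.\<close>

definition tag :: "nat \<Rightarrow> 'b \<Rightarrow> 'b" where "tag i x = x"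

definition SWt :: "nat \<Rightarrow> 'b \<Rightarrow> ('b \<Rightarrow> 'b \<Rightarrow> 'k) \<Rightarrow> 'k" where "SWt i b f = SW b f"

lemma SW_tag: "SW b f = SWt i b (\<lambda>u v. f (tag i u) (tag i v))"
  by (simp add: SWt_def tag_def)

lemma SW_tagged: "SW (tag i b) f = SWt i b (\<lambda>u v. f (tag i u) (tag i v))"
  by (simp add: SWt_def tag_def)

lemma SWt_sort:
  "i < j \<Longrightarrow> SWt j a (\<lambda>x y. SWt i b (\<lambda>u v. f x y u v)) = SWt i b (\<lambda>u v. SWt j a (\<lambda>x y. f x y u v))"
  unfolding SWt_def by (rule SW_swap)

lemmas untag = SWt_def tag_def

lemmas prenex = SW_mult_left SW_mult_right

declare lin_rules [simp]

lemma form_comp: "form f \<Longrightarrow> linmap V B g \<Longrightarrow> linmap V scalars (\<lambda>z. f (g z))"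
  by (rule linmap_comp)

lemma SW_closed [simp]:
  "(\<And>u v. u \<in> C \<Longrightarrow> v \<in> C \<Longrightarrow> f u v \<in> C) \<Longrightarrow> SW b f \<in> C"
  by (rule SW_mem) simp_all

lemma SW_linmap_in:
  "linmap B W g \<Longrightarrow> (\<And>u v. u \<in> C \<Longrightarrow> v \<in> C \<Longrightarrow> f u v \<in> C) \<Longrightarrow>
    SW b (\<lambda>u v. g (f u v)) = g (SW b f)"
  by (rule linmap_SW[OF _ vspace_B, symmetric])

lemma SW_mult_in:
  "c \<in> C \<Longrightarrow> (\<And>u v. u \<in> C \<Longrightarrow> v \<in> C \<Longrightarrow> f u v \<in> C) \<Longrightarrow>
    SW b (\<lambda>u v. c \<cdot> f u v) = c \<cdot> SW b f"
  by (rule SW_linmap_in[OF bilin_right[OF mult_bilin]])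

lemma scal_out: "a \<in> C \<Longrightarrow> c \<in> C \<Longrightarrow> c \<cdot> scal B k a = scal B k (c \<cdot> a)"
  "a \<in> C \<Longrightarrow> c \<in> C \<Longrightarrow> scal B k a \<cdot> c = scal B k (a \<cdot> c)"
  "a \<in> C \<Longrightarrow> S (scal B k a) = scal B k (S a)"
  "a \<in> C \<Longrightarrow> T (scal B k a) = scal B k (T a)"
  "form f \<Longrightarrow> a \<in> C \<Longrightarrow> f (scal B k a) = k * f a"
  using linmap_scal[OF bilin_right[OF mult_bilin]] linmap_scal[OF bilin_left[OF mult_bilin]]
    linmap_scal[OF S_lin] linmap_scal[OF T_lin] linmap_scal[of B scalars f]
  by auto

lemma SW_S1: "b \<in> C \<Longrightarrow> SW b (\<lambda>u v. S u \<cdot> v) = scal B (\<epsilon> b) \<one>"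
  "b \<in> C \<Longrightarrow> SW b (\<lambda>u v. u \<cdot> S v) = scal B (\<epsilon> b) \<one>"
  using hopf by (simp_all add: hopf_algebra_bij_def hopf_algebra_def sw_eq_SW)

lemma SW_S2:
  assumes "b \<in> C" "c \<in> C"
  shows "SW b (\<lambda>u v. S u \<cdot> v \<cdot> c) = scal B (\<epsilon> b) c"
  "SW b (\<lambda>u v. u \<cdot> S v \<cdot> c) = scal B (\<epsilon> b) c"
proof -
  have "SW b (\<lambda>u v. S u \<cdot> v \<cdot> c) = SW b (\<lambda>u v. S u \<cdot> v) \<cdot> c"
    using assms SW_linmap_in[OF bilin_left[OF mult_bilin assms(2)], of "\<lambda>u v. S u \<cdot> v"]
    by (simp cong: SW_cong)
  then show "SW b (\<lambda>u v. S u \<cdot> v \<cdot> c) = scal B (\<epsilon> b) c"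
    using assms by (simp add: SW_S1 scal_out)
  have "SW b (\<lambda>u v. u \<cdot> S v \<cdot> c) = SW b (\<lambda>u v. u \<cdot> S v) \<cdot> c"
    using assms SW_linmap_in[OF bilin_left[OF mult_bilin assms(2)], of "\<lambda>u v. u \<cdot> S v"]
    by (simp cong: SW_cong)
  then show "SW b (\<lambda>u v. u \<cdot> S v \<cdot> c) = scal B (\<epsilon> b) c"
    using assms by (simp add: SW_S1 scal_out)
qed

lemma SW_arg_S:
  assumes "x \<in> C" "\<And>u. u \<in> C \<Longrightarrow> form (f u)" "\<And>v. v \<in> C \<Longrightarrow> form (\<lambda>u. f u v)"
  shows "SW x (\<lambda>u v. SW (S u \<cdot> v) f) = \<epsilon> x * f \<one> \<one>"
  using SW_S_left[of x "\<lambda>z. SW z f"] assms by (simp add: SW_one)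

lemma counit_front:
  "NO_MATCH (\<epsilon> z) c \<Longrightarrow> c * (\<epsilon> x * d) = \<epsilon> x * (c * d)"
  "NO_MATCH (\<epsilon> z) c \<Longrightarrow> c * \<epsilon> x = \<epsilon> x * c"
  by (simp_all add: ac_simps)

lemmas cancel = mult.assoc counit_front SW_mult_left[symmetric] SW_mult_right[symmetric] SW_mult_in scal_out SW_S1
  SW_S2
  SW_counit_left SW_counit_right

lemma form_S_mult:
  assumes f: "form f" and a: "a \<in> C" and b: "b \<in> C"
  shows "f (S (a \<cdot> b)) = f (S b \<cdot> S a)"
proof -
  note [simp] = a b lin_rules form_comp[OF f] f scal_out(5)[OF f]
  note [cong] = SW_cong
  have "f (S (a \<cdot> b)) = SW a (\<lambda>a1 r. SW b (\<lambda>b1 s. SW r (\<lambda>a2 a3.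
        SW s (\<lambda>b2 b3. f (S (a1 \<cdot> b1) \<cdot> a2 \<cdot> (b2 \<cdot> S b3) \<cdot> S a3)))))"
    by (simp add: cancel SW_linmap_in[OF f])
  also have "\<dots> = SW a (\<lambda>x a3. SW b (\<lambda>y b3. SW (x \<cdot> y) (\<lambda>p q. f (S p \<cdot> q \<cdot> S b3 \<cdot> S a3))))"
    by (simp add: prenex SW_mult, simp only: SW_swap[where b=b], simp only: SW_swap[where b=a], simp add: SW_nest)
  also have "\<dots> = f (S b \<cdot> S a)"
    by (simp add: cancel SW_linmap_in[OF f])
  finally show ?thesis .
qed

lemma S_mult: "a \<in> C \<Longrightarrow> b \<in> C \<Longrightarrow> S (a \<cdot> b) = S b \<cdot> S a"
  by (rule separating_eqI[OF separating_all_linmaps[OF vspace_B] vspace_B]) (auto intro: form_S_mult)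

lemma form_scal: "form f \<Longrightarrow> a \<in> C \<Longrightarrow> f (scal B k a) = k * f a"
  by (simp add: linmap_scal)

lemma S_one [simp]: "S \<one> = \<one>"
proof -
  have "f (S \<one>) = f \<one>" if f: "form f" for f
    using SW_S_left[OF one_closed f] by (simp add: SW_one form_comp[OF f])
  then show ?thesis
    by (intro separating_eqI[OF separating_all_linmaps[OF vspace_B] vspace_B]) auto
qed

lemma counit_S [simp]: "a \<in> C \<Longrightarrow> \<epsilon> (S a) = \<epsilon> a"
proof -
  assume a: "a \<in> C"
  have "\<epsilon> (S a) = SW a (\<lambda>x y. \<epsilon> y * \<epsilon> (S x))"
    using a by (simp add: SW_counit_right)
  also have "\<dots> = SW a (\<lambda>x y. \<epsilon> (S x \<cdot> y))"
    using a by (simp add: mult.commute cong: SW_cong)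
  also have "\<dots> = \<epsilon> a"
    using a by (simp add: SW_S_left counit_lin)
  finally show "\<epsilon> (S a) = \<epsilon> a" .
qed

lemma T_mult: "a \<in> C \<Longrightarrow> b \<in> C \<Longrightarrow> T (a \<cdot> b) = T b \<cdot> T a"
  by (rule S_inj) (simp_all add: S_mult)

lemma T_one [simp]: "T \<one> = \<one>"
  by (rule S_inj) simp_all

lemma counit_T [simp]: "a \<in> C \<Longrightarrow> \<epsilon> (T a) = \<epsilon> a"
  using counit_S[of "T a"] by simp

lemma SW_S:
  assumes a: "a \<in> C" and f: "\<And>u. u \<in> C \<Longrightarrow> form (f u)" "\<And>v. v \<in> C \<Longrightarrow> form (\<lambda>u. f u v)"
  shows "SW (S a) f = SW a (\<lambda>u v. f (S v) (S u))"
proof -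
  have f1: "linmap V scalars (\<lambda>z. f (g z) v)" if "linmap V B g" "v \<in> C" for V :: "('k, 'b) hopf" and g v
    using linmap_comp[OF f(2) that(1)] that by simp
  have f2: "linmap V scalars (\<lambda>z. f u (g z))" if "linmap V B g" "u \<in> C" for V :: "('k, 'b) hopf" and g u
    using linmap_comp[OF f(1) that(1)] that by simp
  have i1: "SW b (\<lambda>u v. f (g u v) w) = f (SW b g) w" if "b \<in> C" "w \<in> C" "\<And>u v. u \<in> C \<Longrightarrow> v \<in> C \<Longrightarrow> g u v \<in> C" for b w g
    using SW_linmap_in[OF f(2)] that by simp
  have i2: "SW b (\<lambda>u v. f w (g u v)) = f w (SW b g)" if "b \<in> C" "w \<in> C" "\<And>u v. u \<in> C \<Longrightarrow> v \<in> C \<Longrightarrow> g u v \<in> C" for b w g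
    using SW_linmap_in[OF f(1)] that by simp
  have s1: "f (scal B k b) w = k * f b w" "f w (scal B k b) = k * f w b" if "b \<in> C" "w \<in> C" for k b w
    using linmap_scal[OF f(1)] linmap_scal[OF f(2)] that by simp_all
  note [simp] = a f1 f2 s1
  note [cong] = SW_cong
  have "SW (S a) f = SW a (\<lambda>a1 r. SW (S a1) (\<lambda>p q. SW r (\<lambda>a2 s. SW s (\<lambda>x a5. SW x (\<lambda>a3 a4.
     f (p \<cdot> a2 \<cdot> S a5) (q \<cdot> a3 \<cdot> S a4))))))"
    by (simp add: cancel i1 i2)
  also have "\<dots> = SW a (\<lambda>x y. SW x (\<lambda>u v. SW (S u \<cdot> v) (\<lambda>p q. SW y (\<lambda>c d. f (p \<cdot> S d) (q \<cdot> S c)))))"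
    by (simp add: prenex SW_mult, simp add: SW_nest)
  also have "\<dots> = SW a (\<lambda>u v. f (S v) (S u))"
    by (simp add: SW_arg_S SW_counit_left)
  finally show ?thesis .
qed

lemma SW_T:
  assumes a: "a \<in> C" and f: "\<And>u. u \<in> C \<Longrightarrow> form (f u)" "\<And>v. v \<in> C \<Longrightarrow> form (\<lambda>u. f u v)"
  shows "SW (T a) f = SW a (\<lambda>u v. f (T v) (T u))"
proof -
  have "linmap B scalars (\<lambda>z. f (T z) v)" if "v \<in> C" for v
    using linmap_comp[OF f(2) T_lin] that by simp
  moreover have "linmap B scalars (\<lambda>z. f u (T z))" if "u \<in> C" for u
    using linmap_comp[OF f(1) T_lin] that by simp
  ultimately have "SW (S (T a)) (\<lambda>u v. f (T v) (T u)) = SW (T a) (\<lambda>u v. f (T (S u)) (T (S v)))"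
    using a by (intro SW_S) simp_all
  then show ?thesis using a by (simp cong: SW_cong)
qed

lemma SW_T1:
  assumes "b \<in> C"
  shows "SW b (\<lambda>u v. T v \<cdot> u) = scal B (\<epsilon> b) \<one>" "SW b (\<lambda>u v. v \<cdot> T u) = scal B (\<epsilon> b) \<one>"
proof -
  have "SW b (\<lambda>u v. T v \<cdot> u) = SW b (\<lambda>u v. T (S u \<cdot> v))"
    by (simp add: T_mult cong: SW_cong)
  also have "\<dots> = T (scal B (\<epsilon> b) \<one>)"
    using assms by (simp add: SW_linmap_in[OF T_lin] SW_S1)
  finally show "SW b (\<lambda>u v. T v \<cdot> u) = scal B (\<epsilon> b) \<one>" by (simp add: scal_out)
  have "SW b (\<lambda>u v. v \<cdot> T u) = SW b (\<lambda>u v. T (u \<cdot> S v))"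
    by (simp add: T_mult cong: SW_cong)
  also have "\<dots> = T (scal B (\<epsilon> b) \<one>)"
    using assms by (simp add: SW_linmap_in[OF T_lin] SW_S1)
  finally show "SW b (\<lambda>u v. v \<cdot> T u) = scal B (\<epsilon> b) \<one>" by (simp add: scal_out)
qed

lemma SW_T2:
  assumes "b \<in> C" "c \<in> C"
  shows "SW b (\<lambda>u v. T v \<cdot> u \<cdot> c) = scal B (\<epsilon> b) c"
  "SW b (\<lambda>u v. v \<cdot> T u \<cdot> c) = scal B (\<epsilon> b) c"
proof -
  have "SW b (\<lambda>u v. T v \<cdot> u \<cdot> c) = SW b (\<lambda>u v. T v \<cdot> u) \<cdot> c"
    using assms SW_linmap_in[OF bilin_left[OF mult_bilin assms(2)], of "\<lambda>u v. T v \<cdot> u"]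
    by (simp cong: SW_cong)
  then show "SW b (\<lambda>u v. T v \<cdot> u \<cdot> c) = scal B (\<epsilon> b) c"
    using assms by (simp add: SW_T1 scal_out)
  have "SW b (\<lambda>u v. v \<cdot> T u \<cdot> c) = SW b (\<lambda>u v. v \<cdot> T u) \<cdot> c"
    using assms SW_linmap_in[OF bilin_left[OF mult_bilin assms(2)], of "\<lambda>u v. v \<cdot> T u"]
    by (simp cong: SW_cong)
  then show "SW b (\<lambda>u v. v \<cdot> T u \<cdot> c) = scal B (\<epsilon> b) c"
    using assms by (simp add: SW_T1 scal_out)
qed

lemmas collapse = cancel SW_T1 SW_T2
lemmas expand = prenex SW_mult SW_S SW_T SW_one S_mult T_mult

section \<open>The finite dual\<close>

abbreviation A where "A \<equiv> carr (dual B)"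

lemma carr_dual: "carr (dual B) = carr (dual_vs B)" and scal_dual: "scal (dual B) = (\<lambda>c \<beta> b. c * \<beta> b)"
  by (simp_all add: dual_def dual_vs_def)

lemma dual_form: "\<beta> \<in> A \<Longrightarrow> form \<beta>"
  by (simp add: carr_dual dual_vs_def)

lemma dual_outside: "\<beta> \<in> A \<Longrightarrow> b \<notin> C \<Longrightarrow> \<beta> b = 0"
  by (simp add: carr_dual dual_vs_def)

lemma dual_eqI:
  assumes "\<alpha> \<in> A" "\<beta> \<in> A" "\<And>x. x \<in> C \<Longrightarrow> \<alpha> x = \<beta> x"
  shows "\<alpha> = \<beta>"
proof
  fix x show "\<alpha> x = \<beta> x" using assms(3) dual_outside[OF assms(1)] dual_outside[OF assms(2)]
    by (cases "x \<in> C") simp_all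
qed

lemma ext0_outside: "b \<notin> C \<Longrightarrow> ext0 B f b = 0"
  by (simp add: ext0_def)

lemma form_ext0 [simp]: "form (ext0 B f) \<longleftrightarrow> form f"
  by (rule linmap_cong) (simp_all add: ext0_def)

lemma ext0_apply [simp]: "b \<in> C \<Longrightarrow> ext0 B f b = f b"
  by (simp add: ext0_def)

interpretation V: vector_space "scal B"
  by (rule vspace_vector_space[OF vspace_B])

lemma subspace_C: "V.subspace C"
  using vspace_B by (simp add: vspace_def)

lemma finite_codim_coordinates:
  assumes I: "V.subspace I" "I \<subseteq> C" and fc: "finite_codim B I"
  shows "\<exists>D e. finite D \<and> D \<subseteq> C \<and> (\<forall>d\<in>D. form (e d) \<and> (\<forall>x\<in>I. e d x = 0)) \<and>
    (\<forall>x\<in>C. x - (\<Sum>d\<in>D. scal B (e d x) d) \<in> I)"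
proof -
  obtain F where F: "finite F" "F \<subseteq> C" "C = V.span (F \<union> I)"
    using fc by (auto simp: finite_codim_def)
  obtain K where K: "K \<subseteq> I" "V.independent K" "I \<subseteq> V.span K"
    using V.maximal_independent_subset[of I] by blast
  obtain E where E: "K \<subseteq> E" "E \<subseteq> K \<union> F" "V.independent E" "K \<union> F \<subseteq> V.span E"
    using V.maximal_independent_subset_extend[of K "K \<union> F"] K(2) by blast
  have "I \<subseteq> V.span E" using K(3) V.span_mono[OF E(1)] by blast
  then have CE: "C \<subseteq> V.span E"
    unfolding F(3) using E(4) by (intro V.span_minimal V.subspace_span) auto
  define D where "D = E - K"
  define e where "e d x = V.representation E x d" for d x
  have D: "finite D" "D \<subseteq> C" using E(2) F(1,2) by (auto simp: D_def intro: finite_subset)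
  have "form (e d)" for d
    using CE V.representation_add[OF E(3)] V.representation_scale[OF E(3)]
    by (auto simp: linmap_def e_def subset_iff)
  moreover have "e d x = 0" if "d \<in> D" "x \<in> I" for d x
  proof -
    have "e d x = V.representation K x d"
      using that K(3) V.representation_extend[OF E(3) _ E(1), of x] by (auto simp: e_def)
    moreover have "d \<notin> K" using that by (simp add: D_def)
    ultimately show ?thesis using V.representation_ne_zero[of K x d] by auto
  qed
  moreover have "x - (\<Sum>d\<in>D. scal B (e d x) d) \<in> I" if x: "x \<in> C" for x
  proof -
    let ?N = "{b. V.representation E x b \<noteq> 0}"
    have N: "finite ?N" "?N \<subseteq> E"
      using V.finite_representation V.representation_ne_zero by auto
    have "x = (\<Sum>b\<in>?N. scal B (e b x) b)"
      unfolding e_def using V.sum_nonzero_representation_eq[OF E(3), of x] CE x by auto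
    also have "\<dots> = (\<Sum>b\<in>(?N \<inter> K) \<union> D. scal B (e b x) b)"
      using N D(1) by (intro sum.mono_neutral_left) (auto simp: D_def e_def)
    also have "\<dots> = (\<Sum>b\<in>?N \<inter> K. scal B (e b x) b) + (\<Sum>d\<in>D. scal B (e d x) d)"
      using N D(1) by (intro sum.union_disjoint) (auto simp: D_def)
    finally have "x - (\<Sum>d\<in>D. scal B (e d x) d) = (\<Sum>b\<in>?N \<inter> K. scal B (e b x) b)"
      by (simp add: algebra_simps)
    also have "\<dots> \<in> I"
      using K(1) by (intro V.subspace_sum[OF I(1)] V.subspace_scale[OF I(1)]) auto
    finally show ?thesis .
  qed
  ultimately show ?thesis using D by (intro exI[of _ D] exI[of _ e]) auto
qed

lemma kernels_finite_codim:
  assumes J: "V.subspace J" "J \<subseteq> C" and P: "finite P" "\<And>p. p \<in> P \<Longrightarrow> form p"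
    and sub: "\<And>x. x \<in> C \<Longrightarrow> (\<forall>p\<in>P. p x = 0) \<Longrightarrow> x \<in> J"
  shows "finite_codim B J"
proof -
  have "\<exists>F. finite F \<and> F \<subseteq> C \<and> (\<forall>x\<in>C. \<exists>y\<in>V.span F. \<forall>p\<in>P. p (x - y) = 0)"
    using P
  proof (induction P)
    case empty
    show ?case using V.span_zero by (intro exI[of _ "{}"]) auto
  next
    case (insert q P)
    then obtain F where F: "finite F" "F \<subseteq> C" "\<forall>x\<in>C. \<exists>y\<in>V.span F. \<forall>p\<in>P. p (x - y) = 0"
      by blast
    have spanF: "V.span F \<subseteq> C" by (rule V.span_minimal[OF F(2) subspace_C])
    have q: "form q" using insert by simp
    note [simp] = linmap_diff[OF _ vspace_B] linmap_add[of B scalars] linmap_scal[of B scalars]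
    show ?case
    proof (cases "\<exists>g\<in>C. (\<forall>p\<in>P. p g = 0) \<and> q g \<noteq> 0")
      case False
      have "\<exists>y\<in>V.span F. \<forall>p\<in>insert q P. p (x - y) = 0" if x: "x \<in> C" for x
      proof -
        obtain y where y: "y \<in> V.span F" "\<forall>p\<in>P. p (x - y) = 0" using F(3) x by blast
        then have "q (x - y) = 0" using False x spanF vspace_diff[OF vspace_B, of x y] by blast
        then show ?thesis using y by auto
      qed
      then show ?thesis using F(1,2) by blast
    next
      case True
      then obtain g where g: "g \<in> C" "\<forall>p\<in>P. p g = 0" "q g \<noteq> 0" by blast
      have "\<exists>y\<in>V.span (insert g F). \<forall>p\<in>insert q P. p (x - y) = 0" if x: "x \<in> C" for x
      proof -
        obtain y where y: "y \<in> V.span F" "\<forall>p\<in>P. p (x - y) = 0" using F(3) x by blast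
        define w where "w = scal B (q (x - y) / q g) g"
        have yC: "y \<in> C" "x - y \<in> C" using y spanF x vspace_diff[OF vspace_B] by auto
        have w: "w \<in> C" "w \<in> V.span (insert g F)"
          unfolding w_def using g(1) by (auto intro: V.span_scale V.span_base)
        have pw: "p (x - (y + w)) = p (x - y) - p w" if "form p" for p
          using linmap_diff[OF that vspace_B yC(2) w(1)] by (simp add: diff_diff_eq)
        have sc: "p w = q (x - y) / q g * p g" if "form p" for p
          unfolding w_def using linmap_scal[OF that g(1)] by simp
        have "p (x - (y + w)) = 0" if "p \<in> insert q P" for p
          using pw[OF insert.prems[OF that]] sc[OF insert.prems[OF that]] that y(2) g(2,3) by auto
        moreover have "y + w \<in> V.span (insert g F)"
          using w(2) y(1) V.span_mono[of F "insert g F"] by (auto intro: V.span_add)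
        ultimately show ?thesis by blast
      qed
      then show ?thesis using F(1,2) g(1) by (intro exI[of _ "insert g F"]) auto
    qed
  qed
  then obtain F where F: "finite F" "F \<subseteq> C" "\<forall>x\<in>C. \<exists>y\<in>V.span F. \<forall>p\<in>P. p (x - y) = 0"
    by blast
  have "C = V.span (F \<union> J)"
  proof (intro equalityI V.span_minimal subspace_C subsetI)
    fix x assume x: "x \<in> C"
    obtain y where y: "y \<in> V.span F" "\<forall>p\<in>P. p (x - y) = 0" using F(3) x by blast
    have "y \<in> C" using y(1) V.span_minimal[OF F(2) subspace_C] by blast
    then have "x - y \<in> J" using sub y(2) vspace_diff[OF vspace_B x] by blast
    then have "y + (x - y) \<in> V.span (F \<union> J)"
      using y(1) V.span_mono[of F "F \<union> J"] by (intro V.span_add) (auto intro: V.span_base)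
    then show "x \<in> V.span (F \<union> J)" by simp
  qed (use F(2) J(2) in auto)
  then show ?thesis using F(1,2) by (auto simp: finite_codim_def)
qed

definition decomposable :: "('b \<Rightarrow> 'b \<Rightarrow> 'k) \<Rightarrow> bool" where
  "decomposable f \<longleftrightarrow> (\<exists>ps. (\<forall>z\<in>set ps. form (fst z) \<and> form (snd z)) \<and>
     (\<forall>a\<in>C. \<forall>b\<in>C. f a b = (\<Sum>z\<leftarrow>ps. fst z a * snd z b)))"

lemma decomposable_mult: "form p \<Longrightarrow> form q \<Longrightarrow> decomposable (\<lambda>a b. p a * q b)"
  unfolding decomposable_def by (rule exI[of _ "[(p, q)]"]) simp

lemma decomposable_cong:
  "decomposable g \<Longrightarrow> (\<And>a b. a \<in> C \<Longrightarrow> b \<in> C \<Longrightarrow> f a b = g a b) \<Longrightarrow> decomposable f"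
  by (simp add: decomposable_def)

lemma decomposable_add:
  assumes "decomposable f" "decomposable g"
  shows "decomposable (\<lambda>a b. f a b + g a b)"
proof -
  obtain ps where "\<forall>z\<in>set ps. form (fst z) \<and> form (snd z)"
    "\<forall>a\<in>C. \<forall>b\<in>C. f a b = (\<Sum>z\<leftarrow>ps. fst z a * snd z b)"
    using assms(1) unfolding decomposable_def by blast
  moreover obtain qs where "\<forall>z\<in>set qs. form (fst z) \<and> form (snd z)"
    "\<forall>a\<in>C. \<forall>b\<in>C. g a b = (\<Sum>z\<leftarrow>qs. fst z a * snd z b)"
    using assms(2) unfolding decomposable_def by blast
  ultimately show ?thesis unfolding decomposable_def by (intro exI[of _ "ps @ qs"]) auto
qed

lemma decomposable_sum_list:
  "(\<And>z. z \<in> set zs \<Longrightarrow> decomposable (f z)) \<Longrightarrow> decomposable (\<lambda>a b. \<Sum>z\<leftarrow>zs. f z a b)"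
proof (induction zs)
  case Nil
  show ?case unfolding decomposable_def by (rule exI[of _ "[]"]) simp
next
  case (Cons z zs)
  then show ?case by (simp add: decomposable_add)
qed

text \<open>The ideal is \<open>J = {x. \<forall>a b. \<beta> (a x b) = 0}\<close>. The subspace \<open>R = {y. \<forall>a. \<beta> (a y) = 0}\<close> has finite
  codimension by the decomposition, and \<open>\<beta> (a x b)\<close> depends on \<open>b\<close> only modulo \<open>R\<close>, so \<open>J\<close> is cut out
  by the finitely many conditions that arise from a finite complement of \<open>R\<close>.\<close>

lemma dual_memI:
  assumes \<beta>: "form \<beta>" "\<And>b. b \<notin> C \<Longrightarrow> \<beta> b = 0" and dec: "decomposable (\<lambda>a b. \<beta> (a \<cdot> b))"
  shows "\<beta> \<in> A"
proof -
  obtain ps where ps: "\<And>z. z \<in> set ps \<Longrightarrow> form (fst z)" "\<And>z. z \<in> set ps \<Longrightarrow> form (snd z)"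
    and \<beta>ps: "\<And>a b. a \<in> C \<Longrightarrow> b \<in> C \<Longrightarrow> \<beta> (a \<cdot> b) = (\<Sum>z\<leftarrow>ps. fst z a * snd z b)"
    using dec unfolding decomposable_def by blast
  have mult0: "a \<cdot> 0 = 0" "0 \<cdot> a = 0" if "a \<in> C" for a
    using linmap_zero[OF bilin_right[OF mult_bilin that] vspace_B]
      linmap_zero[OF bilin_left[OF mult_bilin that] vspace_B] by simp_all
  have \<beta>0: "\<beta> 0 = 0" by (rule linmap_zero[OF \<beta>(1) vspace_B])
  have dist: "a \<cdot> (b + c) = a \<cdot> b + a \<cdot> c" "(b + c) \<cdot> a = b \<cdot> a + c \<cdot> a"
    "a \<cdot> scal B k b = scal B k (a \<cdot> b)" "scal B k b \<cdot> a = scal B k (b \<cdot> a)"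
    if "a \<in> C" "b \<in> C" "c \<in> C" for a b c k
    using linmap_add[OF bilin_right[OF mult_bilin that(1)] that(2,3)]
      linmap_add[OF bilin_left[OF mult_bilin that(1)] that(2,3)] that by (simp_all add: scal_out)
  note [simp] = vspace_zero[OF vspace_B] vspace_add[OF vspace_B] mult0 \<beta>0 dist
    linmap_add[OF \<beta>(1)] form_scal[OF \<beta>(1)]
  define R where "R = {y \<in> C. \<forall>a\<in>C. \<beta> (a \<cdot> y) = 0}"
  have R: "V.subspace R" "R \<subseteq> C" by (auto simp: R_def intro!: V.subspaceI)
  have vanish: "\<beta> (a \<cdot> y) = 0" if "a \<in> C" "y \<in> C" "\<And>z. z \<in> set ps \<Longrightarrow> snd z y = 0" for a y
  proof -
    have "(\<Sum>z\<leftarrow>ps. fst z a * snd z y) = (\<Sum>z\<leftarrow>ps. 0)"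
      by (intro arg_cong[of _ _ sum_list] map_cong refl) (simp add: that(3))
    then show ?thesis by (simp add: \<beta>ps that(1,2))
  qed
  have "finite_codim B R"
    by (rule kernels_finite_codim[OF R, of "snd ` set ps"]) (use ps(2) in \<open>blast | simp add: R_def vanish\<close>)+
  then obtain D e where D: "finite D" "D \<subseteq> C" and e: "\<And>d x. d \<in> D \<Longrightarrow> form (e d)"
    and De: "\<And>x. x \<in> C \<Longrightarrow> x - (\<Sum>d\<in>D. scal B (e d x) d) \<in> R"
    using finite_codim_coordinates[OF R] by blast
  define J where "J = {x \<in> C. \<forall>a\<in>C. \<forall>b\<in>C. \<beta> (a \<cdot> x \<cdot> b) = 0}"
  have J: "V.subspace J" "J \<subseteq> C" by (auto simp: J_def intro!: V.subspaceI)
  have "finite_codim B J"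
  proof (rule kernels_finite_codim[OF J, of "(\<lambda>(z, d) x. snd z (x \<cdot> d)) ` (set ps \<times> D)"])
    fix p assume "p \<in> (\<lambda>(z, d) x. snd z (x \<cdot> d)) ` (set ps \<times> D)"
    then obtain z d where p: "p = (\<lambda>x. snd z (x \<cdot> d))" "z \<in> set ps" "d \<in> C" using D(2) by auto
    show "form p"
      unfolding p(1) by (rule form_comp[OF ps(2)[OF p(2)]]) (simp add: p(3))
  next
    fix x assume x: "x \<in> C" and z: "\<forall>p\<in>(\<lambda>(z, d) x. snd z (x \<cdot> d)) ` (set ps \<times> D). p x = 0"
    have xd: "\<beta> (a \<cdot> x \<cdot> d) = 0" if "a \<in> C" "d \<in> D" for a d
      using that D(2) x z by (intro vanish) auto
    have "\<beta> (a \<cdot> x \<cdot> b) = 0" if a: "a \<in> C" and b: "b \<in> C" for a b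
    proof -
      let ?s = "\<Sum>d\<in>D. scal B (e d b) d"
      have sC: "?s \<in> C" using D(2) by (intro vspace_sum) auto
      have lin: "form (\<lambda>b. \<beta> (a \<cdot> x \<cdot> b))"
        by (rule form_comp[OF \<beta>(1)]) (simp add: a x)
      have "\<beta> (a \<cdot> x \<cdot> ?s) = (\<Sum>d\<in>D. \<beta> (a \<cdot> x \<cdot> scal B (e d b) d))"
        using D(2) by (intro linmap_sum[OF lin vspace_B]) auto
      also have "\<dots> = 0"
        using D(2) xd[OF a] by (intro sum.neutral ballI) (auto simp: subset_iff linmap_scal[OF lin])
      finally have s0: "\<beta> (a \<cdot> x \<cdot> ?s) = 0" .
      have "\<beta> (a \<cdot> x \<cdot> (b - ?s)) = 0"
        using De[OF b] a x by (auto simp: R_def mult_assoc[symmetric] simp del: mult_assoc)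
      then show ?thesis using s0 linmap_diff[OF lin vspace_B b sC] by simp
    qed
    then show "x \<in> J" using x by (simp add: J_def)
  qed (use D(1) in simp)
  moreover have "ideal B J"
    unfolding ideal_def
  proof (intro conjI ballI J)
    fix c x assume c: "c \<in> C" and "x \<in> J"
    then have x: "x \<in> C" "\<And>a b. a \<in> C \<Longrightarrow> b \<in> C \<Longrightarrow> \<beta> (a \<cdot> x \<cdot> b) = 0" by (auto simp: J_def)
    have "\<beta> (a \<cdot> c \<cdot> x \<cdot> b) = 0" if "a \<in> C" "b \<in> C" for a b
      using x(2)[of "a \<cdot> c" b] that c x(1) by simp
    then show "c \<cdot> x \<in> J" using c x(1) by (simp add: J_def)
    show "x \<cdot> c \<in> J" using c x by (simp add: J_def)
  qed
  moreover have "\<beta> x = 0" if "x \<in> J" for x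
    using that unfolding J_def by (auto dest!: bspec[OF _ one_closed])
  ultimately show ?thesis using \<beta> by (auto simp: carr_dual dual_vs_def)
qed

lemma dual_decomposition:
  assumes \<beta>: "\<beta> \<in> A"
  shows "\<exists>ps. set ps \<subseteq> A \<times> A \<and> (\<forall>a\<in>C. \<forall>b\<in>C. \<beta> (a \<cdot> b) = (\<Sum>(p, q)\<leftarrow>ps. p a * q b))"
proof -
  have form\<beta>: "form \<beta>" by (rule dual_form[OF \<beta>])
  obtain I where I: "ideal B I" "finite_codim B I" "\<And>x. x \<in> I \<Longrightarrow> \<beta> x = 0"
    using \<beta> by (auto simp: carr_dual dual_vs_def)
  have subI: "V.subspace I" "I \<subseteq> C" using I(1) by (auto simp: ideal_def)
  obtain D e where D: "finite D" "D \<subseteq> C" and e: "\<And>d. d \<in> D \<Longrightarrow> form (e d)"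
    "\<And>d x. d \<in> D \<Longrightarrow> x \<in> I \<Longrightarrow> e d x = 0"
    and De: "\<And>x. x \<in> C \<Longrightarrow> x - (\<Sum>d\<in>D. scal B (e d x) d) \<in> I"
    using finite_codim_coordinates[OF subI I(2)] by blast
  obtain ds where ds: "set ds = D" "distinct ds" using finite_distinct_list[OF D(1)] by blast
  let ?p = "\<lambda>d. ext0 B (\<lambda>a. \<beta> (a \<cdot> d))" and ?q = "\<lambda>d. ext0 B (e d)"
  have fp: "form (\<lambda>a. \<beta> (a \<cdot> d))" if "d \<in> D" for d
    using that D(2) by (intro form_comp[OF form\<beta>]) auto
  have memA: "ext0 B f \<in> A" if "form f" "\<And>x. x \<in> I \<Longrightarrow> f x = 0" for f
    using that I(1,2) by (auto simp: carr_dual dual_vs_def ext0_def[of B f] intro!: exI[of _ I])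
      (use form_ext0[of f] in \<open>simp add: ext0_def\<close>)
  have mem: "?p d \<in> A" "?q d \<in> A" if "d \<in> D" for d
  proof -
    show "?q d \<in> A" using e that by (intro memA)
    have "\<beta> (x \<cdot> d) = 0" if "x \<in> I" for x
      using I(1,3) D(2) that \<open>d \<in> D\<close> by (auto simp: ideal_def)
    then show "?p d \<in> A" by (intro memA fp that)
  qed
  have "\<beta> (a \<cdot> b) = (\<Sum>(p, q)\<leftarrow>map (\<lambda>d. (?p d, ?q d)) ds. p a * q b)" if a: "a \<in> C" and b: "b \<in> C" for a b
  proof -
    let ?s = "\<Sum>d\<in>D. scal B (e d b) d"
    have sC: "?s \<in> C" using D(2) by (intro vspace_sum) auto
    have lin: "form (\<lambda>b. \<beta> (a \<cdot> b))"
      by (rule form_comp[OF form\<beta>]) (simp add: a)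
    have "\<beta> (a \<cdot> (b - ?s)) = 0"
      using De[OF b] I(1,3) a by (auto simp: ideal_def)
    then have "\<beta> (a \<cdot> b) = \<beta> (a \<cdot> ?s)" using linmap_diff[OF lin vspace_B b sC] by simp
    also have "\<dots> = (\<Sum>d\<in>D. \<beta> (a \<cdot> scal B (e d b) d))"
      using D(2) by (intro linmap_sum[OF lin vspace_B]) auto
    also have "\<dots> = (\<Sum>d\<in>D. ?p d a * ?q d b)"
      using D(2) by (intro sum.cong refl) (auto simp: subset_iff a b scal_out form_scal[OF form\<beta>])
    also have "\<dots> = (\<Sum>d\<leftarrow>ds. ?p d a * ?q d b)"
      unfolding ds(1)[symmetric] by (rule sum.distinct_set_conv_list[OF ds(2)])
    finally show ?thesis by (simp add: o_def)
  qed
  then show ?thesis using mem ds(1) by (intro exI[of _ "map (\<lambda>d. (?p d, ?q d)) ds"]) auto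
qed

lemma dual_decomposable: "\<beta> \<in> A \<Longrightarrow> decomposable (\<lambda>a b. \<beta> (a \<cdot> b))"
proof -
  assume "\<beta> \<in> A"
  then obtain ps where "set ps \<subseteq> A \<times> A" "\<forall>a\<in>C. \<forall>b\<in>C. \<beta> (a \<cdot> b) = (\<Sum>(p, q)\<leftarrow>ps. p a * q b)"
    using dual_decomposition by blast
  then show ?thesis
    unfolding decomposable_def
    by (intro exI[of _ ps]) (auto simp: case_prod_unfold subset_iff intro: dual_form)
qed

lemma SW_add: "SW b (\<lambda>x y. f x y + g x y) = SW b f + SW b g"
  by (simp add: SW_def sw_def tsum_tlist sum_list_addf)

lemma SW_zero: "SW b (\<lambda>x y. 0) = 0"
  by (simp add: SW_def sw_def tsum_zero)

lemma vspace_dual [simp]: "vspace (dual B)"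
proof -
  have vs: "vector_space (scal (dual B))"
    unfolding scal_dual by (rule vector_space_fun)
  interpret D: vector_space "scal (dual B)" by (rule vs)
  have "D.subspace A"
  proof (rule D.subspaceI)
    show "0 \<in> A"
      by (rule dual_memI)
        (use decomposable_mult[of "\<lambda>_. 0" "\<lambda>_. 0"] in \<open>simp_all add: form_zero zero_fun_def\<close>)
  next
    fix \<alpha> \<beta> assume \<alpha>\<beta>: "\<alpha> \<in> A" "\<beta> \<in> A"
    have "form (\<lambda>x. \<alpha> x + \<beta> x)"
      using dual_form[OF \<alpha>\<beta>(1)] dual_form[OF \<alpha>\<beta>(2)] by (simp add: linmap_def algebra_simps)
    then show "\<alpha> + \<beta> \<in> A"
      using \<alpha>\<beta> decomposable_add[OF dual_decomposable[OF \<alpha>\<beta>(1)] dual_decomposable[OF \<alpha>\<beta>(2)]]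
      by (intro dual_memI) (simp_all add: dual_outside plus_fun_def)
  next
    fix c \<beta> assume \<beta>: "\<beta> \<in> A"
    obtain ps where ps: "\<forall>z\<in>set ps. form (fst z) \<and> form (snd z)"
      "\<forall>a\<in>C. \<forall>b\<in>C. \<beta> (a \<cdot> b) = (\<Sum>z\<leftarrow>ps. fst z a * snd z b)"
      using dual_decomposable[OF \<beta>] unfolding decomposable_def by blast
    have "decomposable (\<lambda>a b. \<Sum>z\<leftarrow>ps. c * fst z a * snd z b)"
      using ps(1) by (intro decomposable_sum_list decomposable_mult) (auto intro: linmap_mult_left)
    then have "decomposable (\<lambda>a b. c * \<beta> (a \<cdot> b))"
      by (rule decomposable_cong) (simp add: ps(2) sum_list_const_mult mult.assoc)
    then show "scal (dual B) c \<beta> \<in> A"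
      using \<beta> by (intro dual_memI) (simp_all add: scal_dual dual_form linmap_mult_left dual_outside)
  qed
  then show ?thesis using vs by (simp add: vspace_def)
qed

lemma separating_dual: "separating (dual B) {\<lambda>\<beta>::'b \<Rightarrow> 'k. \<beta> x | x. x \<in> C}"
  unfolding separating_def
proof (intro conjI ballI impI)
  fix p assume "p \<in> {\<lambda>\<beta>::'b \<Rightarrow> 'k. \<beta> x | x. x \<in> C}"
  then show "linmap (dual B) scalars p" by (auto simp: linmap_def scal_dual)
next
  fix \<beta> assume "\<beta> \<in> A" "\<forall>p\<in>{\<lambda>\<beta>::'b \<Rightarrow> 'k. \<beta> x | x. x \<in> C}. p \<beta> = (0::'k)"
  then show "\<beta> = 0" by (intro dual_eqI vspace_zero[OF vspace_dual]) auto
qed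

lemma separating_forms: "separating B {\<phi>. form \<phi>}"
  by (rule separating_all_linmaps[OF vspace_B])

lemma dual_comul:
  assumes \<beta>: "\<beta> \<in> A"
  shows dual_comul_closed: "comul (dual B) \<beta> \<in> carr (tspace (dual B) (dual B))"
    and dual_pairing: "\<And>a b. a \<in> C \<Longrightarrow> b \<in> C \<Longrightarrow> sw (dual B) \<beta> (\<lambda>\<beta>1 \<beta>2. \<beta>1 a * \<beta>2 b) = \<beta> (a \<cdot> b)"
proof -
  let ?D = "dual B" and ?V = "dual_vs B"
  let ?P = "\<lambda>t. t \<in> carr (tspace ?V ?V) \<and> (\<forall>a\<in>C. \<forall>b\<in>C. \<beta> (a \<cdot> b) = tsum ?V ?V t (\<lambda>\<beta>1 \<beta>2. \<beta>1 a * \<beta>2 b))"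
  have c: "carr ?V = carr ?D" "scal ?V = scal ?D" by (simp_all add: dual_def)
  note eq = tens_vs_cong(2,3)[OF c c]
  obtain ps where ps: "set ps \<subseteq> A \<times> A" "\<forall>a\<in>C. \<forall>b\<in>C. \<beta> (a \<cdot> b) = (\<Sum>(p, q)\<leftarrow>ps. p a * q b)"
    using dual_decomposition[OF \<beta>] by blast
  have ev: "linmap ?D scalars (\<lambda>\<beta>. \<beta> x)" for x
    by (simp add: linmap_def scal_dual)
  have ex: "\<exists>t. ?P t"
  proof (intro exI conjI ballI)
    let ?t = "\<Sum>z\<leftarrow>ps. tens ?D ?D (fst z) (snd z)"
    show "?t \<in> carr (tspace ?V ?V)"
      unfolding eq(1) using ps(1) by (intro vspace_sum_list vspace_tspace tens_mem) auto
    fix a b assume "a \<in> C" "b \<in> C"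
    then have "\<beta> (a \<cdot> b) = (\<Sum>(p, q)\<leftarrow>ps. p a * q b)" using ps(2) by blast
    also have "\<dots> = tsum ?V ?V ?t (\<lambda>\<beta>1 \<beta>2. \<beta>1 a * \<beta>2 b)"
      unfolding eq(2) using ps(1)
      by (intro tsum_eq[OF vspace_vector_space[OF vspace_scalars], symmetric])
        (simp_all add: bilin_tform[OF ev ev] case_prod_unfold)
    finally show "\<beta> (a \<cdot> b) = tsum ?V ?V ?t (\<lambda>\<beta>1 \<beta>2. \<beta>1 a * \<beta>2 b)" .
  qed
  have un: "t = t'" if "?P t" "?P t'" for t t'
  proof (rule separating_eqI[OF separating_tens[OF vspace_dual vspace_dual separating_dual separating_dual]])
    show "t \<in> carr (tspace ?D ?D)" "t' \<in> carr (tspace ?D ?D)" using that by (simp_all add: eq)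
    fix p assume "p \<in> {tform ?D ?D p q | p q. p \<in> {\<lambda>\<beta>::'b \<Rightarrow> 'k. \<beta> x | x. x \<in> C} \<and> q \<in> {\<lambda>\<beta>::'b \<Rightarrow> 'k. \<beta> x | x. x \<in> C}}"
    then obtain x y where p: "p = tform ?D ?D (\<lambda>\<beta>. \<beta> x) (\<lambda>\<beta>. \<beta> y)" "x \<in> C" "y \<in> C" by auto
    show "p t = p t'" using that p(2,3) unfolding p(1) tform_def eq by auto
  qed simp
  have c: "comul ?D \<beta> = (THE t. ?P t)" by (simp add: dual_def)
  obtain t where t: "?P t" using ex by (rule exE)
  have P: "?P (comul ?D \<beta>)" unfolding c by (rule theI[of ?P, OF t un[OF _ t]])
  from P show "comul (dual B) \<beta> \<in> carr (tspace (dual B) (dual B))"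
    unfolding eq by (rule conjunct1)
  fix a b assume "a \<in> C" "b \<in> C"
  then show "sw (dual B) \<beta> (\<lambda>\<beta>1 \<beta>2. \<beta>1 a * \<beta>2 b) = \<beta> (a \<cdot> b)"
    using P unfolding eq sw_def by simp
qed

lemma dual_unit: "x \<in> C \<Longrightarrow> unity (dual B) x = \<epsilon> x"
  by (simp add: dual_def)

lemma dual_mult: "x \<in> C \<Longrightarrow> mul (dual B) \<alpha> \<beta> x = SW x (\<lambda>x1 x2. \<alpha> x1 * \<beta> x2)"
  by (simp add: dual_def sw_eq_SW)

lemma dual_counit: "counit (dual B) \<beta> = \<beta> \<one>"
  by (simp add: dual_def)

lemma dual_antip: "antip (dual B) \<beta> = ext0 B (\<lambda>b. \<beta> (S b))"
  by (simp add: dual_def)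

lemma dual_unit_closed [simp]: "unity (dual B) \<in> A"
proof (rule dual_memI)
  show "form (unity (dual B))" by (simp add: dual_def counit_lin)
  show "decomposable (\<lambda>a b. unity (dual B) (a \<cdot> b))"
    by (rule decomposable_cong[OF decomposable_mult[OF counit_lin counit_lin]]) (simp add: dual_unit)
qed (simp add: dual_def ext0_def)

lemma dual_mult_closed [simp]:
  assumes \<alpha>: "\<alpha> \<in> A" and \<beta>: "\<beta> \<in> A"
  shows "mul (dual B) \<alpha> \<beta> \<in> A"
proof (rule dual_memI)
  note [simp] = form_comp[OF dual_form[OF \<alpha>]] form_comp[OF dual_form[OF \<beta>]]
    dual_form[OF \<alpha>] dual_form[OF \<beta>]
  show "form (mul (dual B) \<alpha> \<beta>)" by (simp add: dual_def sw_eq_SW ext0_def linmap_cong[of B _ "\<lambda>b. SW b (\<lambda>b1 b2. \<alpha> b1 *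
    \<beta> b2)"])
  obtain ps where ps: "\<And>z. z \<in> set ps \<Longrightarrow> form (fst z) \<and> form (snd z)"
    "\<And>a b. a \<in> C \<Longrightarrow> b \<in> C \<Longrightarrow> \<alpha> (a \<cdot> b) = (\<Sum>z\<leftarrow>ps. fst z a * snd z b)"
    using dual_decomposable[OF \<alpha>] unfolding decomposable_def by blast
  obtain qs where qs: "\<And>z. z \<in> set qs \<Longrightarrow> form (fst z) \<and> form (snd z)"
    "\<And>a b. a \<in> C \<Longrightarrow> b \<in> C \<Longrightarrow> \<beta> (a \<cdot> b) = (\<Sum>z\<leftarrow>qs. fst z a * snd z b)"
    using dual_decomposable[OF \<beta>] unfolding decomposable_def by blast
  let ?f = "\<lambda>a b. \<Sum>z\<leftarrow>ps. \<Sum>w\<leftarrow>qs. SW a (\<lambda>a1 a2. fst z a1 * fst w a2) * SW b (\<lambda>b1 b2. snd z b1 * snd w b2)"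
  have dec: "decomposable ?f"
    using ps(1) qs(1) by (intro decomposable_sum_list decomposable_mult) simp_all
  have push: "SW a (\<lambda>x y. \<Sum>z\<leftarrow>zs. g z x y) = (\<Sum>z\<leftarrow>zs. SW a (g z))" for a zs and g :: "_ \<Rightarrow> 'b \<Rightarrow> 'b \<Rightarrow> 'k"
    by (induction zs) (simp_all add: SW_add SW_zero)
  have "mul (dual B) \<alpha> \<beta> (a \<cdot> b) = ?f a b" if "a \<in> C" "b \<in> C" for a b
  proof -
    have "mul (dual B) \<alpha> \<beta> (a \<cdot> b) = SW a (\<lambda>a1 a2. SW b (\<lambda>b1 b2. \<alpha> (a1 \<cdot> b1) * \<beta> (a2 \<cdot> b2)))"
      using that by (simp add: dual_mult SW_mult)
    also have "\<dots> = SW a (\<lambda>a1 a2. SW b (\<lambda>b1 b2. \<Sum>z\<leftarrow>ps. \<Sum>w\<leftarrow>qs. (fst z a1 * fst w a2) * (snd z b1 * snd w b2)))"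
    proof (intro SW_cong refl)
      fix a1 a2 b1 b2 assume [simp]: "a1 \<in> C" "a2 \<in> C" "b1 \<in> C" "b2 \<in> C"
      have "\<alpha> (a1 \<cdot> b1) * \<beta> (a2 \<cdot> b2) = (\<Sum>z\<leftarrow>ps. \<Sum>w\<leftarrow>qs. (fst z a1 * snd z b1) * (fst w a2 * snd w b2))"
        by (simp add: ps(2) qs(2) sum_list_const_mult sum_list_mult_const)
      then show "\<alpha> (a1 \<cdot> b1) * \<beta> (a2 \<cdot> b2) = (\<Sum>z\<leftarrow>ps. \<Sum>w\<leftarrow>qs. (fst z a1 * fst w a2) * (snd z b1 * snd w b2))"
        by (simp only: mult_ac)
    qed
    also have "\<dots> = ?f a b"
      by (simp only: push, simp only: SW_mult_right, simp only: SW_mult_left)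
    finally show ?thesis .
  qed
  then show "decomposable (\<lambda>a b. mul (dual B) \<alpha> \<beta> (a \<cdot> b))"
    by (intro decomposable_cong[OF dec])
qed (simp add: dual_def ext0_def)

lemma dual_antip_closed:
  assumes \<beta>: "\<beta> \<in> A"
  shows "ext0 B (\<lambda>x. \<beta> (S x)) \<in> A" "ext0 B (\<lambda>x. \<beta> (T x)) \<in> A"
proof -
  note [simp] = form_comp[OF dual_form[OF \<beta>]]
  obtain ps where ps: "\<And>z. z \<in> set ps \<Longrightarrow> form (fst z)" "\<And>z. z \<in> set ps \<Longrightarrow> form (snd z)"
    "\<And>a b. a \<in> C \<Longrightarrow> b \<in> C \<Longrightarrow> \<beta> (a \<cdot> b) = (\<Sum>z\<leftarrow>ps. fst z a * snd z b)"
    using dual_decomposable[OF \<beta>] unfolding decomposable_def by blast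
  have "decomposable (\<lambda>a b. \<Sum>z\<leftarrow>ps. snd z (S a) * fst z (S b))"
    using ps(1,2) by (intro decomposable_sum_list decomposable_mult) (auto intro: form_comp)
  then have "decomposable (\<lambda>a b. ext0 B (\<lambda>x. \<beta> (S x)) (a \<cdot> b))"
    by (rule decomposable_cong) (simp add: ps(3) S_mult mult.commute)
  then show "ext0 B (\<lambda>x. \<beta> (S x)) \<in> A"
    by (intro dual_memI) (simp_all add: ext0_outside)
  have "decomposable (\<lambda>a b. \<Sum>z\<leftarrow>ps. snd z (T a) * fst z (T b))"
    using ps(1,2) by (intro decomposable_sum_list decomposable_mult) (auto intro: form_comp)
  then have "decomposable (\<lambda>a b. ext0 B (\<lambda>x. \<beta> (T x)) (a \<cdot> b))"
    by (rule decomposable_cong) (simp add: ps(3) T_mult mult.commute)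
  then show "ext0 B (\<lambda>x. \<beta> (T x)) \<in> A"
    by (intro dual_memI) (simp_all add: ext0_outside)
qed

lemma dual_antip_inv:
  assumes \<beta>: "\<beta> \<in> A"
  shows "antip_inv (dual B) \<beta> = ext0 B (\<lambda>x. \<beta> (T x))"
  unfolding antip_inv_def[of "dual B"]
proof (rule inv_into_f_eq)
  show "inj_on (antip (dual B)) A"
  proof (rule inj_onI, rule dual_eqI)
    fix \<alpha> \<gamma> x assume eq: "antip (dual B) \<alpha> = antip (dual B) \<gamma>" and x: "x \<in> C"
    have "antip (dual B) \<alpha> (T x) = antip (dual B) \<gamma> (T x)" by (simp only: eq)
    then show "\<alpha> x = \<gamma> x" using x by (simp add: dual_antip)
  qed
  show "ext0 B (\<lambda>x. \<beta> (T x)) \<in> A" by (rule dual_antip_closed[OF \<beta>])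
  show "antip (dual B) (ext0 B (\<lambda>x. \<beta> (T x))) = \<beta>"
    using \<beta> by (intro dual_eqI) (simp_all add: dual_antip dual_antip_closed)
qed

lemma dual_antip_inv_closed [simp]: "\<beta> \<in> A \<Longrightarrow> antip_inv (dual B) \<beta> \<in> A"
  by (simp add: dual_antip_inv dual_antip_closed)

lemma dual_antip_inv_apply: "\<beta> \<in> A \<Longrightarrow> x \<in> C \<Longrightarrow> antip_inv (dual B) \<beta> x = \<beta> (T x)"
  by (simp add: dual_antip_inv)

lemma dual_eval: "linmap (dual B) scalars (\<lambda>\<beta>. \<beta> x)"
  by (simp add: linmap_def scal_dual)

lemma sw_dual_mem:
  "\<beta> \<in> A \<Longrightarrow> vspace W \<Longrightarrow> (\<And>\<beta>1 \<beta>2. \<beta>1 \<in> A \<Longrightarrow> \<beta>2 \<in> A \<Longrightarrow> f \<beta>1 \<beta>2 \<in> carr W) \<Longrightarrow>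
    sw (dual B) \<beta> f \<in> carr W"
  unfolding sw_def by (rule tsum_mem[OF vspace_dual dual_comul_closed])

lemma sw_dual_cong:
  "\<beta> \<in> A \<Longrightarrow> (\<And>\<beta>1 \<beta>2. \<beta>1 \<in> A \<Longrightarrow> \<beta>2 \<in> A \<Longrightarrow> f \<beta>1 \<beta>2 = g \<beta>1 \<beta>2) \<Longrightarrow>
    sw (dual B) \<beta> f = sw (dual B) \<beta> g"
  unfolding sw_def by (rule tsum_cong[OF vspace_dual dual_comul_closed])

lemma linmap_sw_dual:
  "linmap W Z g \<Longrightarrow> vspace W \<Longrightarrow> \<beta> \<in> A \<Longrightarrow> (\<And>\<beta>1 \<beta>2. \<beta>1 \<in> A \<Longrightarrow> \<beta>2 \<in> A \<Longrightarrow> f \<beta>1 \<beta>2 \<in> carr W) \<Longrightarrow>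
    g (sw (dual B) \<beta> f) = sw (dual B) \<beta> (\<lambda>\<beta>1 \<beta>2. g (f \<beta>1 \<beta>2))"
  unfolding sw_def by (rule linmap_tsum[OF vspace_dual dual_comul_closed])

lemma lreg:
  assumes "\<beta> \<in> A" "b \<in> C"
  shows lreg_closed [simp]: "lreg B b \<beta> \<in> A"
    and lreg_apply: "\<And>x. x \<in> C \<Longrightarrow> lreg B b \<beta> x = \<beta> (x \<cdot> b)"
proof -
  show "lreg B b \<beta> \<in> A"
    unfolding lreg_def using assms by (intro sw_dual_mem vspace_dual vspace_scal)
  fix x assume x: "x \<in> C"
  have "lreg B b \<beta> x = sw (dual B) \<beta> (\<lambda>\<beta>1 \<beta>2. \<beta>1 x * \<beta>2 b)"
    unfolding lreg_def using assms
    by (subst linmap_sw_dual[OF dual_eval[of x]]) (auto simp: vspace_scal, simp add: scal_dual mult.commute)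
  then show "lreg B b \<beta> x = \<beta> (x \<cdot> b)" using assms x by (simp add: dual_pairing)
qed

lemma rreg:
  assumes "\<beta> \<in> A" "b \<in> C"
  shows rreg_closed [simp]: "rreg B \<beta> b \<in> A"
    and rreg_apply: "\<And>x. x \<in> C \<Longrightarrow> rreg B \<beta> b x = \<beta> (b \<cdot> x)"
proof -
  show "rreg B \<beta> b \<in> A"
    unfolding rreg_def using assms by (intro sw_dual_mem vspace_dual vspace_scal)
  fix x assume x: "x \<in> C"
  have "rreg B \<beta> b x = sw (dual B) \<beta> (\<lambda>\<beta>1 \<beta>2. \<beta>1 b * \<beta>2 x)"
    unfolding rreg_def using assms
    by (subst linmap_sw_dual[OF dual_eval[of x]]) (auto simp: vspace_scal, simp add: scal_dual)
  then show "rreg B \<beta> b x = \<beta> (b \<cdot> x)" using assms x by (simp add: dual_pairing)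
qed

lemma rreg_alg_closed [simp]: "b \<in> C \<Longrightarrow> rreg_alg B b \<beta> \<in> C"
  by (simp add: rreg_alg_def sw_eq_SW)

lemma form_rreg_alg: "form \<phi> \<Longrightarrow> b \<in> C \<Longrightarrow> \<phi> (rreg_alg B b \<beta>) = SW b (\<lambda>b1 b2. \<beta> b1 * \<phi> b2)"
  by (simp add: rreg_alg_def sw_eq_SW linmap_SW form_scal cong: SW_cong)

text \<open>A dual coproduct disappears as soon as both legs are evaluated; the factors that do not
  involve it may stand anywhere in the left-associated product.\<close>

lemma sw_dual_const:
  "sw (dual B) \<beta> (\<lambda>\<beta>1 \<beta>2. c * f \<beta>1 \<beta>2) = c * (sw (dual B) \<beta> f :: 'k)"
  "sw (dual B) \<beta> (\<lambda>\<beta>1 \<beta>2. f \<beta>1 \<beta>2 * c) = sw (dual B) \<beta> f * c"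
  "sw (dual B) \<beta> (\<lambda>\<beta>1 \<beta>2. f \<beta>1 \<beta>2 * c * g \<beta>1 \<beta>2) = sw (dual B) \<beta> (\<lambda>\<beta>1 \<beta>2. f \<beta>1 \<beta>2 * g \<beta>1 \<beta>2) * c"
  unfolding sw_def tsum_mult_left tsum_mult_right by (simp_all add: ac_simps)

lemma sw_dual_pair:
  "\<beta> \<in> A \<Longrightarrow> a \<in> C \<Longrightarrow> b \<in> C \<Longrightarrow> sw (dual B) \<beta> (\<lambda>\<beta>1 \<beta>2. \<beta>1 a * \<beta>2 b) = \<beta> (a \<cdot> b)"
  "\<beta> \<in> A \<Longrightarrow> a \<in> C \<Longrightarrow> b \<in> C \<Longrightarrow> sw (dual B) \<beta> (\<lambda>\<beta>1 \<beta>2. \<beta>2 b * \<beta>1 a) = \<beta> (a \<cdot> b)"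
  using dual_pairing[of \<beta> a b] by (simp_all add: mult.commute)

lemma sw_dual_SW:
  "sw (dual B) \<beta> (\<lambda>\<beta>1 \<beta>2. SW b (\<lambda>u v. f \<beta>1 \<beta>2 u v)) = SW b (\<lambda>u v. sw (dual B) \<beta> (\<lambda>\<beta>1 \<beta>2. f \<beta>1 \<beta>2 u v))"
  by (auto simp: SW_def sw_def tsum_zero intro: tsum_swap)

section \<open>The Drinfeld double\<close>

text \<open>Explicit application, so that linearity of \<open>\<lambda>z. \<alpha> (g z)\<close> is a first-order rewrite rule.\<close>

definition ap :: "('b \<Rightarrow> 'k) \<Rightarrow> 'b \<Rightarrow> 'k" where "ap f x = f x"

lemma ap_form: "form f \<Longrightarrow> linmap V B g \<Longrightarrow> linmap V scalars (\<lambda>z. ap f (g z))"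
  unfolding ap_def by (rule form_comp)

lemma ap_dual: "f \<in> A \<Longrightarrow> linmap V B g \<Longrightarrow> linmap V scalars (\<lambda>z. ap f (g z))"
  by (rule ap_form[OF dual_form])

lemma ap_form': "form f \<Longrightarrow> form (ap f)" "f \<in> A \<Longrightarrow> form (ap f)"
  by (simp_all add: ap_def[abs_def] dual_form)

lemma ap_eval: "linmap (dual B) scalars (\<lambda>\<beta>. ap \<beta> x)"
  unfolding ap_def by (rule dual_eval)

lemma ap_simps:
  "x \<in> C \<Longrightarrow> ap (mul (dual B) \<alpha> \<beta>) x = SW x (\<lambda>x1 x2. ap \<alpha> x1 * ap \<beta> x2)"
  "x \<in> C \<Longrightarrow> ap (unity (dual B)) x = \<epsilon> x"
  "\<beta> \<in> A \<Longrightarrow> b \<in> C \<Longrightarrow> x \<in> C \<Longrightarrow> ap (lreg B b \<beta>) x = ap \<beta> (x \<cdot> b)"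
  "\<beta> \<in> A \<Longrightarrow> b \<in> C \<Longrightarrow> x \<in> C \<Longrightarrow> ap (rreg B \<beta> b) x = ap \<beta> (b \<cdot> x)"
  "\<beta> \<in> A \<Longrightarrow> x \<in> C \<Longrightarrow> ap (antip_inv (dual B) \<beta>) x = ap \<beta> (T x)"
  "x \<in> C \<Longrightarrow> ap (antip (dual B) \<beta>) x = ap \<beta> (S x)"
  by (simp_all add: ap_def dual_mult dual_unit lreg_apply rreg_apply dual_antip_inv_apply dual_antip)

lemma SW_ap_in: "form g \<Longrightarrow> (\<And>u v. u \<in> C \<Longrightarrow> v \<in> C \<Longrightarrow> f u v \<in> C) \<Longrightarrow>
    SW b (\<lambda>u v. ap g (f u v)) = ap g (SW b f)"
  "g \<in> A \<Longrightarrow> (\<And>u v. u \<in> C \<Longrightarrow> v \<in> C \<Longrightarrow> f u v \<in> C) \<Longrightarrow>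
    SW b (\<lambda>u v. ap g (f u v)) = ap g (SW b f)"
  unfolding ap_def using SW_linmap_in[of scalars g] dual_form[of g] by simp_all

lemma ap_scal: "form g \<Longrightarrow> a \<in> C \<Longrightarrow> ap g (scal B k a) = k * ap g a"
  "g \<in> A \<Longrightarrow> a \<in> C \<Longrightarrow> ap g (scal B k a) = k * ap g a"
  unfolding ap_def by (simp_all add: form_scal dual_form)

lemmas lin_ap = ap_form ap_dual ap_form' ap_eval
declare lin_ap [simp]

lemmas ap_collapse = collapse SW_ap_in ap_scal

abbreviation D where "D \<equiv> carr (dspace B)"

definition DS :: "('k, 'b \<Rightarrow> 'k, 'b) tensor \<Rightarrow> (('b \<Rightarrow> 'k) \<Rightarrow> 'b \<Rightarrow> 'c::ab_group_add) \<Rightarrow> 'c" where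
  "DS t f = (if t \<in> D then dsum B t f else 0)"

lemma dsum_eq_DS: "t \<in> D \<Longrightarrow> dsum B t f = DS t f"
  by (simp add: DS_def)

lemma DS_cong:
  "t = t' \<Longrightarrow> (\<And>\<alpha> a. \<alpha> \<in> A \<Longrightarrow> a \<in> C \<Longrightarrow> f \<alpha> a = g \<alpha> a) \<Longrightarrow> DS t f = DS t' g"
  using tsum_cong[of "dual B" t' B f g] by (simp add: DS_def)

lemma DS_mult_left: "c * DS t f = DS t (\<lambda>\<alpha> a. c * f \<alpha> a :: 'k)"
  by (simp add: DS_def tsum_mult_left)

lemma DS_mult_right: "DS t f * c = DS t (\<lambda>\<alpha> a. f \<alpha> a * c :: 'k)"
  by (simp add: DS_def tsum_mult_right)

lemma SW_DS: "SW b (\<lambda>u v. DS t (\<lambda>\<alpha> a. f u v \<alpha> a)) = DS t (\<lambda>\<alpha> a. SW b (\<lambda>u v. f u v \<alpha> a))"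
  by (auto simp: SW_def DS_def sw_def tsum_zero intro: tsum_swap)

lemma sw_dual_DS:
  "sw (dual B) \<beta> (\<lambda>\<beta>1 \<beta>2. DS t (\<lambda>\<alpha> a. f \<beta>1 \<beta>2 \<alpha> a)) =
    DS t (\<lambda>\<alpha> a. sw (dual B) \<beta> (\<lambda>\<beta>1 \<beta>2. f \<beta>1 \<beta>2 \<alpha> a))"
  by (auto simp: DS_def sw_def tsum_zero intro: tsum_swap)

lemmas DS_out = DS_mult_left DS_mult_right SW_DS sw_dual_DS

lemma DS_mem:
  "vspace W \<Longrightarrow> (\<And>\<alpha> a. \<alpha> \<in> A \<Longrightarrow> a \<in> C \<Longrightarrow> f \<alpha> a \<in> carr W) \<Longrightarrow> DS t f \<in> carr W"
  by (simp add: DS_def tsum_mem vspace_zero)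

lemma linmap_DS:
  "linmap W Z g \<Longrightarrow> vspace W \<Longrightarrow> (\<And>\<alpha> a. \<alpha> \<in> A \<Longrightarrow> a \<in> C \<Longrightarrow> f \<alpha> a \<in> carr W) \<Longrightarrow>
    g (DS t f) = DS t (\<lambda>\<alpha> a. g (f \<alpha> a))"
  by (simp add: DS_def linmap_tsum linmap_zero)

lemma dtens_closed [simp]: "\<alpha> \<in> A \<Longrightarrow> a \<in> C \<Longrightarrow> dtens B \<alpha> a \<in> D"
  by (rule tens_mem) simp_all

definition dform :: "(('b \<Rightarrow> 'k) \<Rightarrow> 'b \<Rightarrow> 'k) \<Rightarrow> bool" where
  "dform K \<longleftrightarrow> bilin (dual B) B scalars K"

lemma dformI [simp]:
  "(\<And>\<alpha>. \<alpha> \<in> A \<Longrightarrow> form (K \<alpha>)) \<Longrightarrow> (\<And>a. a \<in> C \<Longrightarrow> linmap (dual B) scalars (\<lambda>\<alpha>. K \<alpha> a)) \<Longrightarrow> dform K"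
  unfolding dform_def by (rule bilinI)

lemma form_DS_fun:
  "(\<And>\<alpha> a. \<alpha> \<in> A \<Longrightarrow> a \<in> C \<Longrightarrow> linmap V scalars (\<lambda>z. f z \<alpha> a)) \<Longrightarrow>
    linmap V scalars (\<lambda>z. DS t (f z))"
  unfolding DS_def by (cases "t \<in> D") (simp_all add: linmap_tsum_fun form_zero)

lemma DS_linmap: "dform K \<Longrightarrow> linmap (dspace B) scalars (\<lambda>t. DS t K)"
  by (rule iffD2[OF linmap_cong tsum_linmap]) (auto simp: DS_def dform_def)

lemma form_DS_arg: "dform K \<Longrightarrow> linmap V (dspace B) g \<Longrightarrow> linmap V scalars (\<lambda>z. DS (g z) K)"
  by (rule linmap_comp[OF DS_linmap])

lemma form_sw_dual_fun:
  "\<beta> \<in> A \<Longrightarrow> (\<And>u v. u \<in> A \<Longrightarrow> v \<in> A \<Longrightarrow> linmap V scalars (\<lambda>z. f z u v)) \<Longrightarrow>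
    linmap V scalars (\<lambda>z. sw (dual B) \<beta> (f z))"
  unfolding sw_def by (intro linmap_tsum_fun dual_comul_closed) simp_all

lemmas lin_DS = form_DS_fun form_DS_arg form_sw_dual_fun
declare lin_DS [simp]

lemma DS_tens: "dform K \<Longrightarrow> \<alpha> \<in> A \<Longrightarrow> a \<in> C \<Longrightarrow> DS (dtens B \<alpha> a) K = K \<alpha> a"
  unfolding dform_def by (simp add: DS_def tsum_tens[OF vspace_scalars])

lemma DS_DS:
  "dform K \<Longrightarrow> (\<And>\<alpha> a. \<alpha> \<in> A \<Longrightarrow> a \<in> C \<Longrightarrow> f \<alpha> a \<in> D) \<Longrightarrow>
    DS (DS t f) K = DS t (\<lambda>\<alpha> a. DS (f \<alpha> a) K)"
  by (rule linmap_DS[OF DS_linmap]) simp_all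

lemma DS_SW:
  "dform K \<Longrightarrow> (\<And>u v. u \<in> C \<Longrightarrow> v \<in> C \<Longrightarrow> f u v \<in> D) \<Longrightarrow>
    DS (SW b f) K = SW b (\<lambda>u v. DS (f u v) K)"
  by (rule linmap_SW[OF DS_linmap]) simp_all

lemma DS_sw_dual:
  "dform K \<Longrightarrow> \<beta> \<in> A \<Longrightarrow> (\<And>u v. u \<in> A \<Longrightarrow> v \<in> A \<Longrightarrow> f u v \<in> D) \<Longrightarrow>
    DS (sw (dual B) \<beta> f) K = sw (dual B) \<beta> (\<lambda>u v. DS (f u v) K)"
  by (rule linmap_sw_dual[OF DS_linmap]) simp_all

lemma separating_double:
  "separating (dspace B) {\<lambda>t. DS t (\<lambda>\<alpha> a. ap \<alpha> x * ap \<phi> a) | x \<phi>. x \<in> C \<and> form \<phi>}"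
proof -
  let ?S = "{tform (dual B) B p q | p q. p \<in> {\<lambda>\<beta>::'b \<Rightarrow> 'k. \<beta> x | x. x \<in> C} \<and> q \<in> {\<phi>. form \<phi>}}"
  have sep: "separating (dspace B) ?S"
    by (rule separating_tens[OF vspace_dual vspace_B separating_dual separating_forms])
  have eq: "tform (dual B) B (\<lambda>\<beta>. \<beta> x) \<phi> t = DS t (\<lambda>\<alpha> a. ap \<alpha> x * ap \<phi> a)" if "t \<in> D" for x \<phi> t
    using that by (simp add: tform_def DS_def ap_def)
  show ?thesis
    unfolding separating_def
  proof (intro conjI ballI impI)
    fix p assume "p \<in> {\<lambda>t. DS t (\<lambda>\<alpha> a. ap \<alpha> x * ap \<phi> a) | x \<phi>. x \<in> C \<and> form \<phi>}"
    then obtain x \<phi> where p: "p = (\<lambda>t. DS t (\<lambda>\<alpha> a. ap \<alpha> x * ap \<phi> a))" "x \<in> C" "form \<phi>" by blast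
    show "linmap (dspace B) scalars p" unfolding p(1) using p(2,3) by (intro DS_linmap) simp
  next
    fix t assume t: "t \<in> D" "\<forall>p\<in>{\<lambda>t. DS t (\<lambda>\<alpha> a. ap \<alpha> x * ap \<phi> a) | x \<phi>. x \<in> C \<and> form \<phi>}. p t = 0"
    have "p t = 0" if "p \<in> ?S" for p
    proof -
      from that obtain e \<phi> where e: "p = tform (dual B) B e \<phi>" "e \<in> {\<lambda>\<beta>::'b \<Rightarrow> 'k. \<beta> x | x. x \<in> C}"
        and \<phi>: "form \<phi>" by blast
      from e(2) obtain x where x: "e = (\<lambda>\<beta>. \<beta> x)" "x \<in> C" by blast
      have p: "p = tform (dual B) B (\<lambda>\<beta>. \<beta> x) \<phi>" using e(1) x(1) by simp
      have "(\<lambda>t. DS t (\<lambda>\<alpha> a. ap \<alpha> x * ap \<phi> a)) t = 0"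
        by (rule bspec[OF t(2)]) (use x(2) \<phi> in blast)
      then show ?thesis unfolding p eq[OF t(1)] .
    qed
    then show "t = 0" by (rule separating_zero[OF sep t(1)])
  qed
qed

lemma double_eqI:
  assumes "s \<in> D" "t \<in> D"
    and "\<And>x \<phi>. x \<in> C \<Longrightarrow> form \<phi> \<Longrightarrow> DS s (\<lambda>\<alpha> a. ap \<alpha> x * ap \<phi> a) = DS t (\<lambda>\<alpha> a. ap \<alpha> x * ap \<phi> a)"
  shows "s = t"
  using assms by (intro separating_eqI[OF separating_double]) auto

lemma double_linmapI:
  assumes "vspace V" "\<And>z. z \<in> carr V \<Longrightarrow> f z \<in> D"
    and "\<And>x \<phi>. x \<in> C \<Longrightarrow> form \<phi> \<Longrightarrow> linmap V scalars (\<lambda>z. DS (f z) (\<lambda>\<alpha> a. ap \<alpha> x * ap \<phi> a))"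
  shows "linmap V (dspace B) f"
  using assms by (intro separating_linmapI[OF separating_double]) auto

lemma double_mul_eq:
  "s \<in> D \<Longrightarrow> t \<in> D \<Longrightarrow> double_mul B s t = DS s (\<lambda>\<mu> m. DS t (\<lambda>\<nu> n. SW m (\<lambda>x m3. SW x (\<lambda>m1 m2.
    dtens B (mul (dual B) \<mu> (rreg B (lreg B m1 \<nu>) (T m3))) (m2 \<cdot> n)))))"
  by (simp add: double_mul_def dsum_eq_DS sw3_def sw_eq_SW cong: DS_cong SW_cong)

lemma double_mul_closed [simp]: "s \<in> D \<Longrightarrow> t \<in> D \<Longrightarrow> double_mul B s t \<in> D"
  by (simp add: double_mul_eq DS_mem SW_mem)

lemma DS_double_mul:
  assumes "s \<in> D" "t \<in> D" "dform K"
  shows "DS (double_mul B s t) K = DS s (\<lambda>\<mu> m. DS t (\<lambda>\<nu> n. SW m (\<lambda>x m3. SW x (\<lambda>m1 m2.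
    K (mul (dual B) \<mu> (rreg B (lreg B m1 \<nu>) (T m3))) (m2 \<cdot> n)))))"
  using assms by (simp add: double_mul_eq DS_DS DS_SW DS_tens DS_mem SW_mem cong: DS_cong SW_cong)

abbreviation hmul where "hmul \<equiv> mul (heisenberg B)"

lemma hmul_eq:
  "s \<in> D \<Longrightarrow> t \<in> D \<Longrightarrow> hmul s t = DS s (\<lambda>\<alpha> a. DS t (\<lambda>\<beta> b. SW a (\<lambda>a1 a2.
    dtens B (mul (dual B) \<alpha> (lreg B a1 \<beta>)) (a2 \<cdot> b))))"
  by (simp add: heisenberg_def dsum_eq_DS sw_eq_SW cong: DS_cong SW_cong)

lemma hmul_closed [simp]: "s \<in> D \<Longrightarrow> t \<in> D \<Longrightarrow> hmul s t \<in> D"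
  by (simp add: hmul_eq DS_mem SW_mem)

lemma DS_hmul:
  assumes "s \<in> D" "t \<in> D" "dform K"
  shows "DS (hmul s t) K = DS s (\<lambda>\<alpha> a. DS t (\<lambda>\<beta> b. SW a (\<lambda>a1 a2.
    K (mul (dual B) \<alpha> (lreg B a1 \<beta>)) (a2 \<cdot> b))))"
  using assms by (simp add: hmul_eq DS_DS DS_SW DS_tens DS_mem SW_mem cong: DS_cong SW_cong)

lemma double_mul_bilin: "bilin (dspace B) (dspace B) (dspace B) (double_mul B)"
proof (rule bilinI)
  note [cong] = SW_cong DS_cong
  fix t assume [simp]: "t \<in> D"
  show "linmap (dspace B) (dspace B) (double_mul B t)"
  proof (rule double_linmapI)
    fix x \<phi> assume [simp]: "x \<in> C" "form \<phi>"
    show "linmap (dspace B) scalars (\<lambda>z. DS (double_mul B t z) (\<lambda>\<alpha> a. ap \<alpha> x * ap \<phi> a))"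
    proof -
      have "linmap (dspace B) scalars (\<lambda>z. DS t (\<lambda>\<mu> m. DS z (\<lambda>\<nu> n. SW m (\<lambda>y m3. SW y (\<lambda>m1 m2.
          SW x (\<lambda>x1 x2. ap \<mu> x1 * ap \<nu> (T m3 \<cdot> x2 \<cdot> m1)) * ap \<phi> (m2 \<cdot> n))))))" by simp
      then show ?thesis by (rule linmap_cong') (simp_all add: DS_double_mul ap_simps)
    qed
  qed simp_all
  show "linmap (dspace B) (dspace B) (\<lambda>s. double_mul B s t)"
  proof (rule double_linmapI)
    fix x \<phi> assume [simp]: "x \<in> C" "form \<phi>"
    show "linmap (dspace B) scalars (\<lambda>z. DS (double_mul B z t) (\<lambda>\<alpha> a. ap \<alpha> x * ap \<phi> a))"
    proof -
      have "linmap (dspace B) scalars (\<lambda>z. DS z (\<lambda>\<mu> m. DS t (\<lambda>\<nu> n. SW m (\<lambda>y m3. SW y (\<lambda>m1 m2.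
          SW x (\<lambda>x1 x2. ap \<mu> x1 * ap \<nu> (T m3 \<cdot> x2 \<cdot> m1)) * ap \<phi> (m2 \<cdot> n))))))" by simp
      then show ?thesis by (rule linmap_cong') (simp_all add: DS_double_mul ap_simps)
    qed
  qed simp_all
qed

lemma lin_double_mul:
  "c \<in> D \<Longrightarrow> linmap V (dspace B) g \<Longrightarrow> linmap V (dspace B) (\<lambda>z. double_mul B c (g z))"
  "c \<in> D \<Longrightarrow> linmap V (dspace B) g \<Longrightarrow> linmap V (dspace B) (\<lambda>z. double_mul B (g z) c)"
  using linmap_comp[OF bilin_right[OF double_mul_bilin]] linmap_comp[OF bilin_left[OF double_mul_bilin]]
  by blast+

lemma lin_dtens:
  "a \<in> C \<Longrightarrow> linmap V (dual B) g \<Longrightarrow> linmap V (dspace B) (\<lambda>z. dtens B (g z) a)"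
  "\<alpha> \<in> A \<Longrightarrow> linmap V B g' \<Longrightarrow> linmap V (dspace B) (\<lambda>z. dtens B \<alpha> (g' z))"
  using linmap_comp[OF bilin_left[OF tens_bilin[OF vspace_dual vspace_B]]]
    linmap_comp[OF bilin_right[OF tens_bilin[OF vspace_dual vspace_B]]]
  by blast+

declare lin_double_mul [simp] lin_dtens [simp]

lemma SW_counit_out: "SW b (\<lambda>u v. \<epsilon> c * f u v) = \<epsilon> c * SW b f"
  by (rule SW_mult_left[symmetric])

lemmas counits = mult.assoc counit_front SW_counit_out SW_counit_left SW_counit_right

lemma double_mul_assoc:
  assumes [simp]: "s \<in> D" "t \<in> D" "u \<in> D"
  shows "double_mul B (double_mul B s t) u = double_mul B s (double_mul B t u)"
proof (rule double_eqI)
  fix x \<phi> assume [simp]: "x \<in> C" "form \<phi>"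
  note [cong] = SW_cong DS_cong
  show "DS (double_mul B (double_mul B s t) u) (\<lambda>\<alpha> a. ap \<alpha> x * ap \<phi> a) =
    DS (double_mul B s (double_mul B t u)) (\<lambda>\<alpha> a. ap \<alpha> x * ap \<phi> a)"
    apply (simp add: DS_double_mul ap_simps)
    apply (simp add: DS_out)
    apply (intro DS_cong refl)
    subgoal for \<alpha> a \<beta> b \<gamma> c
      by ((simp add: counits)?; (simp add: expand)?;
        (simp only: SW_tagged SW_tag[where b=b and i=3] SW_tag[where b=a and i=2] SW_tag[where b=x and i=1])?;
        (simp add: SWt_sort)?; (simp only: untag)?; (simp add: SW_nest)?; (simp add: mult_ac)?)
    done
qed simp_all

abbreviation unit_double where "unit_double \<equiv> dtens B (unity (dual B)) \<one>"

lemma double_mul_unit: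
  assumes [simp]: "t \<in> D"
  shows "double_mul B unit_double t = t" "double_mul B t unit_double = t"
proof -
  note [cong] = SW_cong DS_cong
  show "double_mul B unit_double t = t"
  proof (rule double_eqI)
    fix x \<phi> assume [simp]: "x \<in> C" "form \<phi>"
    show "DS (double_mul B unit_double t) (\<lambda>\<alpha> a. ap \<alpha> x * ap \<phi> a) = DS t (\<lambda>\<alpha> a. ap \<alpha> x * ap \<phi> a)"
      by (simp add: DS_double_mul ap_simps DS_tens SW_one ap_collapse)
  qed simp_all
  show "double_mul B t unit_double = t"
  proof (rule double_eqI)
    fix x \<phi> assume [simp]: "x \<in> C" "form \<phi>"
    show "DS (double_mul B t unit_double) (\<lambda>\<alpha> a. ap \<alpha> x * ap \<phi> a) = DS t (\<lambda>\<alpha> a. ap \<alpha> x * ap \<phi> a)"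
      by (simp add: DS_double_mul ap_simps DS_tens ap_collapse)
  qed simp_all
qed

subsection \<open>The coproduct\<close>

lemma double_sel [simp]:
  "carr (double B) = D" "scal (double B) = scal (dspace B)" "mul (double B) = double_mul B"
  "unity (double B) = unit_double"
  by (simp_all add: double_def)

lemma heisenberg_sel [simp]:
  "carr (heisenberg B) = D" "scal (heisenberg B) = scal (dspace B)" "unity (heisenberg B) = unit_double"
  by (simp_all add: heisenberg_def)

lemma vspace_double [simp]: "vspace (double B)" "vspace (heisenberg B)"
  using vspace_tspace[of "dual B" B] by (simp_all add: vspace_def)

lemma linmap_double_sel [simp]:
  "linmap (double B) W = linmap (dspace B) W" "linmap V (double B) = linmap V (dspace B)"
  "linmap (heisenberg B) W = linmap (dspace B) W" "linmap V (heisenberg B) = linmap V (dspace B)"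
  by (intro ext linmap_vs_cong; simp)+

lemma tens_double_sel:
  "tens (double B) (double B) = tens (dspace B) (dspace B)"
  "tspace (double B) (double B) = tspace (dspace B) (dspace B)"
  "tsum (double B) (double B) = tsum (dspace B) (dspace B)"
  "tens (double B) (heisenberg B) = tens (dspace B) (dspace B)"
  "tspace (double B) (heisenberg B) = tspace (dspace B) (dspace B)"
  "tsum (double B) (heisenberg B) = tsum (dspace B) (dspace B)"
  by (intro tens_vs_cong; simp)+

definition qform :: "(('k, 'b \<Rightarrow> 'k, 'b) tensor \<Rightarrow> ('k, 'b \<Rightarrow> 'k, 'b) tensor \<Rightarrow> 'k) \<Rightarrow> bool" where
  "qform Q \<longleftrightarrow> bilin (dspace B) (dspace B) scalars Q"

lemma qformI [simp]:
  "(\<And>g. g \<in> D \<Longrightarrow> linmap (dspace B) scalars (Q g)) \<Longrightarrow>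
    (\<And>h. h \<in> D \<Longrightarrow> linmap (dspace B) scalars (\<lambda>g. Q g h)) \<Longrightarrow> qform Q"
  unfolding qform_def by (rule bilinI)

definition dcomul where
  "dcomul h = DS h (\<lambda>\<mu> m. sw (dual B) \<mu> (\<lambda>\<mu>1 \<mu>2. SW m (\<lambda>m1 m2.
    tens (dspace B) (dspace B) (dtens B \<mu>2 m1) (dtens B \<mu>1 m2))))"

lemma comul_double: "h \<in> D \<Longrightarrow> comul (double B) h = dcomul h"
  and coact_heisenberg: "h \<in> D \<Longrightarrow> coact (heisenberg B) h = dcomul h"
  unfolding dcomul_def
  by (simp_all add: double_def heisenberg_def dsum_eq_DS sw_eq_SW cong: DS_cong sw_dual_cong)

lemma dtens2_closed [simp]:
  "g \<in> D \<Longrightarrow> h \<in> D \<Longrightarrow> tens (dspace B) (dspace B) g h \<in> carr (tspace (dspace B) (dspace B))"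
  by (rule tens_mem) simp_all

lemma dcomul_closed [simp]: "h \<in> D \<Longrightarrow> dcomul h \<in> carr (tspace (dspace B) (dspace B))"
  unfolding dcomul_def by (intro DS_mem vspace_tspace sw_dual_mem SW_mem) auto

lemma tsum_dcomul:
  assumes "h \<in> D" "qform Q"
  shows "tsum (dspace B) (dspace B) (dcomul h) Q = DS h (\<lambda>\<mu> m. sw (dual B) \<mu> (\<lambda>\<mu>1 \<mu>2. SW m (\<lambda>m1 m2.
    Q (dtens B \<mu>2 m1) (dtens B \<mu>1 m2))))"
proof -
  have lin: "linmap (tspace (dspace B) (dspace B)) scalars (\<lambda>t. tsum (dspace B) (dspace B) t Q)"
    using assms(2) by (intro tsum_linmap) (simp_all add: qform_def)
  show ?thesis
    unfolding dcomul_def using assms(2)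
    by (simp add: linmap_DS[OF lin] linmap_sw_dual[OF lin] linmap_SW[OF lin] sw_dual_mem SW_mem qform_def
        tsum_tens[OF vspace_scalars] cong: DS_cong sw_dual_cong SW_cong)
qed

lemma sw_double_eq: "h \<in> D \<Longrightarrow> sw (double B) h f = tsum (dspace B) (dspace B) (dcomul h) f"
  by (simp add: sw_def tens_double_sel comul_double)

lemma cosw_heisenberg_eq:
  "h \<in> D \<Longrightarrow> cosw (double B) (heisenberg B) h f = tsum (dspace B) (dspace B) (dcomul h) f"
  by (simp add: cosw_def tens_double_sel coact_heisenberg)

lemma sw_dual_ap:
  "\<beta> \<in> A \<Longrightarrow> a \<in> C \<Longrightarrow> b \<in> C \<Longrightarrow> sw (dual B) \<beta> (\<lambda>\<beta>1 \<beta>2. ap \<beta>1 a * ap \<beta>2 b) = ap \<beta> (a \<cdot> b)"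
  "\<beta> \<in> A \<Longrightarrow> a \<in> C \<Longrightarrow> b \<in> C \<Longrightarrow> sw (dual B) \<beta> (\<lambda>\<beta>1 \<beta>2. ap \<beta>2 b * ap \<beta>1 a) = ap \<beta> (a \<cdot> b)"
  unfolding ap_def by (rule sw_dual_pair; assumption)+

lemma sw_dual_const':
  "sw (dual B) \<beta> (\<lambda>\<beta>1 \<beta>2. c * f \<beta>1 \<beta>2 * g \<beta>1 \<beta>2) = c * sw (dual B) \<beta> (\<lambda>\<beta>1 \<beta>2. f \<beta>1 \<beta>2 * g \<beta>1 \<beta>2 :: 'k)"
  by (simp add: mult.assoc sw_dual_const(1))

lemmas dual_out = sw_dual_SW sw_dual_const sw_dual_const' sw_dual_ap mult.assoc[symmetric] prenex DS_out

lemma SW_TT: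
  assumes [simp]: "b \<in> C" "c \<in> C"
  shows "SW b (\<lambda>u v. T u \<cdot> T (T v)) = scal B (\<epsilon> b) \<one>" "SW b (\<lambda>u v. T (T u) \<cdot> T v \<cdot> c) = scal B (\<epsilon> b) c"
proof -
  have "SW b (\<lambda>u v. T u \<cdot> T (T v)) = SW b (\<lambda>u v. T (T v \<cdot> u))" by (simp add: T_mult cong: SW_cong)
  also have "\<dots> = scal B (\<epsilon> b) \<one>" by (simp add: SW_linmap_in[OF T_lin] SW_T1 scal_out)
  finally show "SW b (\<lambda>u v. T u \<cdot> T (T v)) = scal B (\<epsilon> b) \<one>" .
  have "SW b (\<lambda>u v. T (T u) \<cdot> T v \<cdot> c) = SW b (\<lambda>u v. T (v \<cdot> T u) \<cdot> c)" by (simp add: T_mult cong: SW_cong)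
  also have "\<dots> = T (SW b (\<lambda>u v. v \<cdot> T u)) \<cdot> c"
    by (subst SW_linmap_in[OF linmap_comp[OF bilin_left[OF mult_bilin] T_lin]]) simp_all
  also have "\<dots> = scal B (\<epsilon> b) c" by (simp add: SW_T1 scal_out)
  finally show "SW b (\<lambda>u v. T (T u) \<cdot> T v \<cdot> c) = scal B (\<epsilon> b) c" .
qed

abbreviation ev where "ev x \<phi> t \<equiv> DS t (\<lambda>\<alpha> a. ap \<alpha> x * ap \<phi> a)"

abbreviation DD where "DD \<equiv> tspace (dspace B) (dspace B)"

lemma ev_lin [simp]: "x \<in> C \<Longrightarrow> form \<phi> \<Longrightarrow> linmap (dspace B) scalars (ev x \<phi>)"
  by (rule DS_linmap) simp

lemma separating_DD: "separating DD {tform (dspace B) (dspace B) (ev x \<phi>) (ev y \<psi>) | x \<phi> y \<psi>.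
    x \<in> C \<and> form \<phi> \<and> y \<in> C \<and> form \<psi>}"
proof -
  have "separating DD {tform (dspace B) (dspace B) p q | p q.
    p \<in> {ev x \<phi> | x \<phi>. x \<in> C \<and> form \<phi>} \<and> q \<in> {ev x \<phi> | x \<phi>. x \<in> C \<and> form \<phi>}}"
    by (rule separating_tens[OF vspace_tspace vspace_tspace separating_double separating_double])
  moreover have "{tform (dspace B) (dspace B) p q | p q.
      p \<in> {ev x \<phi> | x \<phi>. x \<in> C \<and> form \<phi>} \<and> q \<in> {ev x \<phi> | x \<phi>. x \<in> C \<and> form \<phi>}} =
    {tform (dspace B) (dspace B) (ev x \<phi>) (ev y \<psi>) | x \<phi> y \<psi>. x \<in> C \<and> form \<phi> \<and> y \<in> C \<and> form \<psi>}"
    by blast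
  ultimately show ?thesis by simp
qed

lemma double2_eqI:
  assumes "s \<in> carr DD" "t \<in> carr DD"
    and "\<And>x \<phi> y \<psi>. x \<in> C \<Longrightarrow> form \<phi> \<Longrightarrow> y \<in> C \<Longrightarrow> form \<psi> \<Longrightarrow>
      tsum (dspace B) (dspace B) s (\<lambda>g h. ev x \<phi> g * ev y \<psi> h) =
      tsum (dspace B) (dspace B) t (\<lambda>g h. ev x \<phi> g * ev y \<psi> h)"
  shows "s = t"
  by (rule separating_eqI[OF separating_DD vspace_tspace assms(1,2)]) (auto simp: tform_def assms(3))

lemma double3_eqI:
  assumes "s \<in> carr (tspace DD (dspace B))" "t \<in> carr (tspace DD (dspace B))"
    and "\<And>x \<phi> y \<psi> z \<chi>. x \<in> C \<Longrightarrow> form \<phi> \<Longrightarrow> y \<in> C \<Longrightarrow> form \<psi> \<Longrightarrow> z \<in> C \<Longrightarrow> form \<chi> \<Longrightarrow>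
      tform DD (dspace B) (tform (dspace B) (dspace B) (ev x \<phi>) (ev y \<psi>)) (ev z \<chi>) s =
      tform DD (dspace B) (tform (dspace B) (dspace B) (ev x \<phi>) (ev y \<psi>)) (ev z \<chi>) t"
  shows "s = t"
  by (rule separating_eqI[OF separating_tens[OF vspace_tspace vspace_tspace separating_DD separating_double]
        vspace_tspace assms(1,2)])
    (auto simp: assms(3))

definition dsw :: "('k, 'b \<Rightarrow> 'k, 'b) tensor \<Rightarrow> (('k, 'b \<Rightarrow> 'k, 'b) tensor \<Rightarrow> ('k, 'b \<Rightarrow> 'k, 'b) tensor \<Rightarrow> 'c::ab_group_add)
  \<Rightarrow> 'c"
  where "dsw h f = (if h \<in> D then tsum (dspace B) (dspace B) (dcomul h) f else 0)"

lemma sw_double: "h \<in> D \<Longrightarrow> sw (double B) h f = dsw h f"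
  by (simp add: sw_double_eq dsw_def)

lemma cosw_heisenberg: "h \<in> D \<Longrightarrow> cosw (double B) (heisenberg B) h f = dsw h f"
  by (simp add: cosw_heisenberg_eq dsw_def)

lemma dsw_cong:
  "h = h' \<Longrightarrow> (\<And>x y. x \<in> D \<Longrightarrow> y \<in> D \<Longrightarrow> f x y = g x y) \<Longrightarrow> dsw h f = dsw h' g"
  using tsum_cong[of "dspace B" "dcomul h'" "dspace B" f g] by (simp add: dsw_def)

lemma dsw_mem:
  "vspace W \<Longrightarrow> (\<And>u v. u \<in> D \<Longrightarrow> v \<in> D \<Longrightarrow> f u v \<in> carr W) \<Longrightarrow> dsw b f \<in> carr W"
  by (simp add: dsw_def tsum_mem vspace_zero)

lemma linmap_dsw:
  "linmap W Z g \<Longrightarrow> vspace W \<Longrightarrow> (\<And>u v. u \<in> D \<Longrightarrow> v \<in> D \<Longrightarrow> f u v \<in> carr W) \<Longrightarrow>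
    g (dsw b f) = dsw b (\<lambda>u v. g (f u v))"
  by (simp add: dsw_def linmap_tsum linmap_zero)

lemma dsw_eq:
  "h \<in> D \<Longrightarrow> qform Q \<Longrightarrow> dsw h Q = DS h (\<lambda>\<mu> m. sw (dual B) \<mu> (\<lambda>\<mu>1 \<mu>2. SW m (\<lambda>m1 m2.
    Q (dtens B \<mu>2 m1) (dtens B \<mu>1 m2))))"
  by (simp add: dsw_def tsum_dcomul)

lemma linmap_dcomul: "linmap (dspace B) DD dcomul"
proof (rule separating_linmapI[OF separating_DD])
  note [cong] = SW_cong DS_cong sw_dual_cong
  fix p assume "p \<in> {tform (dspace B) (dspace B) (ev x \<phi>) (ev y \<psi>) | x \<phi> y \<psi>.
    x \<in> C \<and> form \<phi> \<and> y \<in> C \<and> form \<psi>}"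
  then obtain x \<phi> y \<psi> where p: "p = tform (dspace B) (dspace B) (ev x \<phi>) (ev y \<psi>)"
    and [simp]: "x \<in> C" "form \<phi>" "y \<in> C" "form \<psi>" by blast
  have "linmap (dspace B) scalars (\<lambda>h. DS h (\<lambda>\<mu> m. SW m (\<lambda>m1 m2. ap \<mu> (y \<cdot> x) * ap \<phi> m1 * ap \<psi> m2)))"
    by (simp add: linmap_id)
  then show "linmap (dspace B) scalars (\<lambda>h. p (dcomul h))"
    unfolding p tform_def
    by (rule linmap_cong') (simp_all add: tsum_dcomul DS_tens dual_out)
qed simp_all

lemma dsw_coassoc:
  assumes [simp]: "h \<in> D"
  shows "dsw h (\<lambda>x c. dsw x (\<lambda>a b. tens DD (dspace B) (tens (dspace B) (dspace B) a b) c)) =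
    dsw h (\<lambda>a x. dsw x (\<lambda>b c. tens DD (dspace B) (tens (dspace B) (dspace B) a b) c))"
proof (rule double3_eqI)
  note [cong] = SW_cong DS_cong sw_dual_cong dsw_cong
  have t3: "tens DD (dspace B) (tens (dspace B) (dspace B) a b) c \<in> carr (tspace DD (dspace B))"
    if "a \<in> D" "b \<in> D" "c \<in> D" for a b c using that by (intro tens_mem) simp_all
  show "dsw h (\<lambda>x c. dsw x (\<lambda>a b. tens DD (dspace B) (tens (dspace B) (dspace B) a b) c)) \<in> carr (tspace DD (dspace
    B))"
    "dsw h (\<lambda>a x. dsw x (\<lambda>b c. tens DD (dspace B) (tens (dspace B) (dspace B) a b) c)) \<in> carr (tspace DD (dspace B))"
    by (intro dsw_mem vspace_tspace t3; assumption)+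
  fix x \<phi> y \<psi> z \<chi> assume [simp]: "x \<in> C" "form \<phi>" "y \<in> C" "form \<psi>" "z \<in> C" "form \<chi>"
  let ?G = "tform DD (dspace B) (tform (dspace B) (dspace B) (ev x \<phi>) (ev y \<psi>)) (ev z \<chi>)"
  have lin: "linmap (tspace DD (dspace B)) scalars ?G"
    by (intro linmap_tform) simp_all
  have G: "?G (tens DD (dspace B) (tens (dspace B) (dspace B) a b) c) = ev x \<phi> a * ev y \<psi> b * ev z \<chi> c"
    if "a \<in> D" "b \<in> D" "c \<in> D" for a b c
    using that by (simp add: tform_tens linmap_tform)
  show "?G (dsw h (\<lambda>x c. dsw x (\<lambda>a b. tens DD (dspace B) (tens (dspace B) (dspace B) a b) c))) =
    ?G (dsw h (\<lambda>a x. dsw x (\<lambda>b c. tens DD (dspace B) (tens (dspace B) (dspace B) a b) c)))"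
    apply (simp add: linmap_dsw[OF lin] dsw_mem t3 G)
    apply (simp add: dsw_eq DS_tens dual_out)
    apply (intro DS_cong refl)
    subgoal for \<mu> m
      by (simp add: SW_nest; simp add: mult_ac)
    done
qed

lemma dcomul_mult:
  assumes [simp]: "s \<in> D" "t \<in> D"
  shows "dcomul (double_mul B s t) = dsw s (\<lambda>s1 s2. dsw t (\<lambda>t1 t2.
    tens (dspace B) (dspace B) (double_mul B s1 t1) (double_mul B s2 t2)))"
proof (rule double2_eqI)
  note [cong] = SW_cong DS_cong sw_dual_cong dsw_cong
  show "dsw s (\<lambda>s1 s2. dsw t (\<lambda>t1 t2.
    tens (dspace B) (dspace B) (double_mul B s1 t1) (double_mul B s2 t2))) \<in> carr DD"
    by (intro dsw_mem vspace_tspace) simp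
  fix x \<phi> y \<psi> assume [simp]: "x \<in> C" "form \<phi>" "y \<in> C" "form \<psi>"
  let ?G = "\<lambda>t. tsum (dspace B) (dspace B) t (\<lambda>g h. ev x \<phi> g * ev y \<psi> h)"
  have lin: "linmap DD scalars ?G"
    by (intro tsum_linmap bilin_tform) simp_all
  have G: "?G (tens (dspace B) (dspace B) a b) = ev x \<phi> a * ev y \<psi> b"
    if "a \<in> D" "b \<in> D" for a b
    using that by (simp add: tsum_tens[OF vspace_scalars bilin_tform])
  show "?G (dcomul (double_mul B s t)) = ?G (dsw s (\<lambda>s1 s2. dsw t (\<lambda>t1 t2.
    tens (dspace B) (dspace B) (double_mul B s1 t1) (double_mul B s2 t2))))"
    apply (simp add: linmap_dsw[OF lin] dsw_mem G)
    apply (simp add: dsw_eq tsum_dcomul DS_tens DS_double_mul ap_simps dual_out)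
    apply (intro DS_cong refl)
    subgoal for \<alpha> a \<beta> b
    proof -
      assume [simp]: "\<alpha> \<in> A" "a \<in> C" "\<beta> \<in> A" "b \<in> C"
      have 1: "SW a (\<lambda>u a6. SW u (\<lambda>u a5. SW u (\<lambda>u r. SW u (\<lambda>a1 a2. SW x (\<lambda>x1 x2. SW y (\<lambda>y1 y2.
          SW b (\<lambda>b1 b2. SW r (\<lambda>a3 a4. ap \<alpha> (y1 \<cdot> x1) * ap \<beta> (T a6 \<cdot> y2 \<cdot> a4 \<cdot> T a3 \<cdot> x2 \<cdot> a1) *
            ap \<phi> (a2 \<cdot> b1) * ap \<psi> (a5 \<cdot> b2))))))))) =
        SW a (\<lambda>u a4. SW u (\<lambda>u a3. SW u (\<lambda>a1 a2. SW x (\<lambda>x1 x2. SW y (\<lambda>y1 y2.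
          SW b (\<lambda>b1 b2. ap \<alpha> (y1 \<cdot> x1) * ap \<beta> (T a4 \<cdot> y2 \<cdot> x2 \<cdot> a1) *
            ap \<phi> (a2 \<cdot> b1) * ap \<psi> (a3 \<cdot> b2)))))))"
        by (simp add: ap_collapse)
      show ?thesis
        apply (rule trans[OF _ trans[OF sym[OF 1]]])
        subgoal
          by ((simp add: counits)?; (simp add: expand)?;
            (simp only: SW_tagged SW_tag[where b=b and i=4] SW_tag[where b=a and i=3] SW_tag[where b=y and i=2] SW_tag[where b=x and i=1])?;
            (simp add: SWt_sort)?; (simp only: untag)?; (simp add: SW_nest)?; (simp add: mult_ac)?)
        subgoal
          by ((simp add: counits)?; (simp add: expand)?;
            (simp only: SW_tagged SW_tag[where b=b and i=4] SW_tag[where b=a and i=3] SW_tag[where b=y and i=2] SW_tag[where b=x and i=1])?;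
            (simp add: SWt_sort)?; (simp only: untag)?; (simp add: SW_nest)?; (simp add: mult_ac)?)
        done
    qed
    done
qed simp_all

lemma counit_double: "h \<in> D \<Longrightarrow> counit (double B) h = DS h (\<lambda>\<mu> m. ap \<mu> \<one> * \<epsilon> m)"
  by (simp add: double_def dsum_eq_DS dual_counit ap_def)

lemma scal_double_closed [simp]: "t \<in> D \<Longrightarrow> scal (dspace B) c t \<in> D"
  by (rule vspace_scal) simp_all

lemma DS_scal [simp]: "dform K \<Longrightarrow> t \<in> D \<Longrightarrow> DS (scal (dspace B) c t) K = c * DS t K"
  using linmap_scal[OF DS_linmap] by simp

lemma lin_counit_double [simp]: "linmap (dspace B) scalars (counit (double B))"
proof -
  have "linmap (dspace B) scalars (\<lambda>h. DS h (\<lambda>\<mu> m. ap \<mu> \<one> * \<epsilon> m))"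
    by (simp add: linmap_id counit_lin)
  then show ?thesis by (rule linmap_cong') (simp_all add: counit_double)
qed

lemma dsw_counit:
  assumes [simp]: "h \<in> D"
  shows "dsw h (\<lambda>g1 g2. scal (dspace B) (counit (double B) g1) g2) = h"
    "dsw h (\<lambda>g1 g2. scal (dspace B) (counit (double B) g2) g1) = h"
proof -
  note [cong] = SW_cong DS_cong sw_dual_cong dsw_cong
  have lin: "linmap V scalars (\<lambda>z. counit (double B) (g z))" if "linmap V (dspace B) g" for V :: "('k, ('k, 'b \<Rightarrow> 'k,
    'b) tensor) vs" and g
    by (rule linmap_comp[OF lin_counit_double that])
  show "dsw h (\<lambda>g1 g2. scal (dspace B) (counit (double B) g1) g2) = h"
  proof (rule double_eqI)
    fix x \<phi> assume [simp]: "x \<in> C" "form \<phi>"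
    show "ev x \<phi> (dsw h (\<lambda>g1 g2. scal (dspace B) (counit (double B) g1) g2)) = ev x \<phi> h"
      by (simp add: linmap_dsw[OF ev_lin] dsw_eq lin counit_double DS_tens dual_out)
        (simp add: ap_collapse)
  qed (simp_all add: dsw_mem)
  show "dsw h (\<lambda>g1 g2. scal (dspace B) (counit (double B) g2) g1) = h"
  proof (rule double_eqI)
    fix x \<phi> assume [simp]: "x \<in> C" "form \<phi>"
    show "ev x \<phi> (dsw h (\<lambda>g1 g2. scal (dspace B) (counit (double B) g2) g1)) = ev x \<phi> h"
      by (simp add: linmap_dsw[OF ev_lin] dsw_eq lin counit_double DS_tens dual_out)
        (simp add: ap_collapse)
  qed (simp_all add: dsw_mem)
qed

lemma dcomul_unit: "dcomul unit_double = tens (dspace B) (dspace B) unit_double unit_double"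
proof (rule double2_eqI)
  note [cong] = SW_cong DS_cong sw_dual_cong dsw_cong
  fix x \<phi> y \<psi> assume [simp]: "x \<in> C" "form \<phi>" "y \<in> C" "form \<psi>"
  show "tsum (dspace B) (dspace B) (dcomul unit_double) (\<lambda>g h. ev x \<phi> g * ev y \<psi> h) =
    tsum (dspace B) (dspace B) (tens (dspace B) (dspace B) unit_double unit_double) (\<lambda>g h. ev x \<phi> g * ev y \<psi> h)"
    by (simp add: tsum_tens[OF vspace_scalars bilin_tform] tsum_dcomul; simp add: DS_tens dual_out ap_simps SW_one;
      (simp add: mult_ac)?)
qed simp_all

lemma counit_double_mult:
  assumes [simp]: "s \<in> D" "t \<in> D"
  shows "counit (double B) (double_mul B s t) = counit (double B) s * counit (double B) t"
proof -
  note [cong] = SW_cong DS_cong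
  show ?thesis
    by (simp add: counit_double DS_double_mul ap_simps SW_one DS_mult_right, simp add: DS_out)
      (intro DS_cong refl; (simp add: ap_collapse)?; (simp add: mult_ac)?)
qed

lemma counit_double_unit: "counit (double B) unit_double = 1"
  by (simp add: counit_double DS_tens ap_simps)

subsection \<open>The antipode\<close>

lemma antip_double:
  "h \<in> D \<Longrightarrow> antip (double B) h = DS h (\<lambda>\<mu> m. double_mul B (dtens B (unity (dual B)) (S m))
    (dtens B (antip_inv (dual B) \<mu>) \<one>))"
  by (simp add: double_def dsum_eq_DS)

lemma antip_double_closed [simp]: "h \<in> D \<Longrightarrow> antip (double B) h \<in> D"
  by (simp add: antip_double DS_mem)

lemma DS_antip:
  assumes "h \<in> D" "dform K"
  shows "DS (antip (double B) h) K = DS h (\<lambda>\<mu> m. DS (double_mul B (dtens B (unity (dual B)) (S m))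
    (dtens B (antip_inv (dual B) \<mu>) \<one>)) K)"
  using assms by (simp add: antip_double DS_DS cong: DS_cong)

lemma lin_antip: "linmap (dspace B) (dspace B) (antip (double B))"
proof (rule double_linmapI)
  note [cong] = SW_cong DS_cong
  fix x \<phi> assume [simp]: "x \<in> C" "form \<phi>"
  have "linmap (dspace B) scalars (\<lambda>h. DS h (\<lambda>\<mu> m. SW (S m) (\<lambda>y m3. SW y (\<lambda>m1 m2. SW x (\<lambda>x1 x2.
     \<epsilon> x1 * ap \<mu> (T (T m3 \<cdot> x2 \<cdot> m1))) * ap \<phi> m2))))"
    by (simp add: linmap_id)
  then show "linmap (dspace B) scalars (\<lambda>h. ev x \<phi> (antip (double B) h))"
    by (rule linmap_cong') (simp_all add: DS_antip DS_double_mul DS_tens ap_simps)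
qed simp_all

lemma antip_double_left:
  assumes [simp]: "h \<in> D"
  shows "dsw h (\<lambda>h1 h2. double_mul B (antip (double B) h1) h2) = scal (dspace B) (counit (double B) h) unit_double"
proof (rule double_eqI)
  note [cong] = SW_cong DS_cong sw_dual_cong dsw_cong
  fix x \<phi> assume [simp]: "x \<in> C" "form \<phi>"
  show "ev x \<phi> (dsw h (\<lambda>h1 h2. double_mul B (antip (double B) h1) h2)) =
    ev x \<phi> (scal (dspace B) (counit (double B) h) unit_double)"
    apply (simp add: linmap_dsw[OF ev_lin] dsw_eq counit_double DS_antip DS_double_mul DS_tens ap_simps dual_out
      SW_one)
    apply (intro DS_cong refl)
    subgoal for \<alpha> a
    proof -
      assume [simp]: "\<alpha> \<in> A" "a \<in> C"
      have 1: "SW a (\<lambda>a1 a2. SW (S a1) (\<lambda>q s. SW q (\<lambda>q1 n3. SW s (\<lambda>n4 n5. SW x (\<lambda>x2 x3. SW q1 (\<lambda>n1 n2.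
          ap \<alpha> (T n4 \<cdot> x3 \<cdot> n2 \<cdot> T n1 \<cdot> T x2 \<cdot> T (T n5)) * ap \<phi> (n3 \<cdot> a2))))))) = ap \<alpha> \<one> * \<epsilon> a * \<epsilon> x * ap \<phi> \<one>"
        by (simp add: ap_collapse SW_TT)
      show ?thesis
        apply (rule trans[OF _ 1])
        by ((simp add: counits)?; (simp add: expand)?;
          (simp only: SW_tagged SW_tag[where b=a and i=2] SW_tag[where b=x and i=1])?; (simp add: SWt_sort)?;
          (simp only: untag)?; (simp add: SW_nest)?; (simp add: mult_ac)?)
    qed
    done
qed (simp_all add: dsw_mem)

lemma antip_double_right:
  assumes [simp]: "h \<in> D"
  shows "dsw h (\<lambda>h1 h2. double_mul B h1 (antip (double B) h2)) = scal (dspace B) (counit (double B) h) unit_double"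
proof (rule double_eqI)
  note [cong] = SW_cong DS_cong sw_dual_cong dsw_cong
  fix x \<phi> assume [simp]: "x \<in> C" "form \<phi>"
  show "ev x \<phi> (dsw h (\<lambda>h1 h2. double_mul B h1 (antip (double B) h2))) =
    ev x \<phi> (scal (dspace B) (counit (double B) h) unit_double)"
    apply (simp add: linmap_dsw[OF ev_lin] dsw_eq counit_double DS_antip DS_double_mul DS_tens ap_simps dual_out
      SW_one)
    apply (intro DS_cong refl)
    subgoal for \<alpha> a
    proof -
      assume [simp]: "\<alpha> \<in> A" "a \<in> C"
      have 1: "SW a (\<lambda>p a6. SW p (\<lambda>a1 w. SW w (\<lambda>w1 a5. SW w1 (\<lambda>a2 v. SW x (\<lambda>x1 x2. SW v (\<lambda>a3 a4.
          ap \<alpha> (a6 \<cdot> T a1 \<cdot> T x2 \<cdot> T (T a3) \<cdot> T a4 \<cdot> x1) * ap \<phi> (a2 \<cdot> S a5))))))) = ap \<alpha> \<one> * \<epsilon> a * \<epsilon> x * ap \<phi> \<one>"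
        by (simp add: ap_collapse SW_TT)
      show ?thesis
        apply (rule trans[OF _ 1])
        by ((simp add: counits)?; (simp add: expand)?;
          (simp only: SW_tagged SW_tag[where b=a and i=2] SW_tag[where b=x and i=1])?; (simp add: SWt_sort)?;
          (simp only: untag)?; (simp add: SW_nest)?; (simp add: mult_ac)?)
    qed
    done
qed (simp_all add: dsw_mem)

definition antip_double_inv where
  "antip_double_inv h = DS h (\<lambda>\<mu> m. double_mul B (dtens B (unity (dual B)) (T m))
    (dtens B (antip (dual B) \<mu>) \<one>))"

lemma dual_antip_closed' [simp]: "\<mu> \<in> A \<Longrightarrow> antip (dual B) \<mu> \<in> A"
  by (simp add: dual_antip dual_antip_closed)

lemma antip_double_inv_closed [simp]: "antip_double_inv h \<in> D"
  by (simp add: antip_double_inv_def DS_mem)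

lemma DS_antip_inv:
  "dform K \<Longrightarrow> DS (antip_double_inv h) K = DS h (\<lambda>\<mu> m. DS (double_mul B (dtens B (unity (dual B)) (T m))
    (dtens B (antip (dual B) \<mu>) \<one>)) K)"
  by (simp add: antip_double_inv_def DS_DS)

lemma SW_TT':
  assumes [simp]: "b \<in> C" "c \<in> C"
  shows "SW b (\<lambda>u v. T u \<cdot> T (T v) \<cdot> c) = scal B (\<epsilon> b) c"
proof -
  have "SW b (\<lambda>u v. T u \<cdot> T (T v) \<cdot> c) = SW b (\<lambda>u v. T u \<cdot> T (T v)) \<cdot> c"
    by (subst SW_linmap_in[OF bilin_left[OF mult_bilin assms(2)], symmetric]) (simp_all cong: SW_cong)
  then show ?thesis by (simp add: SW_TT(1)[of b \<one>] scal_out)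
qed

lemma antip_antip_inv:
  assumes [simp]: "h \<in> D"
  shows "antip (double B) (antip_double_inv h) = h" "antip_double_inv (antip (double B) h) = h"
proof -
  note [cong] = SW_cong DS_cong
  show "antip (double B) (antip_double_inv h) = h"
  proof (rule double_eqI)
    fix x \<phi> assume [simp]: "x \<in> C" "form \<phi>"
    show "ev x \<phi> (antip (double B) (antip_double_inv h)) = ev x \<phi> h"
      apply (simp add: DS_antip DS_antip_inv DS_double_mul DS_tens ap_simps SW_one)
      apply (intro DS_cong refl)
      subgoal for \<mu> m
      proof -
        assume [simp]: "\<mu> \<in> A" "m \<in> C"
        have 1: "SW (T m) (\<lambda>w q. SW w (\<lambda>r n3. SW r (\<lambda>n1 n2. SW q (\<lambda>n4 n5.
            ap \<mu> (S n1 \<cdot> n2 \<cdot> x \<cdot> S n4 \<cdot> n5) * ap \<phi> (S n3))))) = ap \<mu> x * ap \<phi> m"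
          by (simp add: ap_collapse; simp add: mult_ac)
        show ?thesis
          apply (rule trans[OF _ 1])
          by ((simp add: counits)?; (simp add: expand)?;
            (simp only: SW_tagged SW_tag[where b=m and i=2] SW_tag[where b=x and i=1])?; (simp add: SWt_sort)?;
            (simp only: untag)?; (simp add: SW_nest)?; (simp add: mult_ac)?)
      qed
      done
  qed simp_all
  show "antip_double_inv (antip (double B) h) = h"
  proof (rule double_eqI)
    fix x \<phi> assume [simp]: "x \<in> C" "form \<phi>"
    show "ev x \<phi> (antip_double_inv (antip (double B) h)) = ev x \<phi> h"
      apply (simp add: DS_antip DS_antip_inv DS_double_mul DS_tens ap_simps SW_one)
      apply (intro DS_cong refl)
      subgoal for \<mu> m
      proof -
        assume [simp]: "\<mu> \<in> A" "m \<in> C"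
        have 1: "SW (S m) (\<lambda>w q. SW w (\<lambda>r n3. SW r (\<lambda>n1 n2. SW q (\<lambda>n4 n5.
            ap \<mu> (T n1 \<cdot> T (T n2) \<cdot> x \<cdot> T n4 \<cdot> T (T n5)) * ap \<phi> (T n3))))) = ap \<mu> x * ap \<phi> m"
          by (simp add: ap_collapse SW_TT SW_TT'; simp add: mult_ac)
        show ?thesis
          apply (rule trans[OF _ 1])
          by ((simp add: counits)?; (simp add: expand)?;
            (simp only: SW_tagged SW_tag[where b=m and i=2] SW_tag[where b=x and i=1])?; (simp add: SWt_sort)?;
            (simp only: untag)?; (simp add: SW_nest)?; (simp add: mult_ac)?)
      qed
      done
  qed simp_all
qed

lemma bilin_double_sel:
  "bilin (double B) (double B) (double B) = bilin (dspace B) (dspace B) (dspace B)"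
  "bilin (heisenberg B) (heisenberg B) (heisenberg B) = bilin (dspace B) (dspace B) (dspace B)"
  "bilin (double B) (heisenberg B) (heisenberg B) = bilin (dspace B) (dspace B) (dspace B)"
  by (intro ext bilin_vs_cong; simp)+

lemma tens3_double:
  "tens3 (double B) (double B) (double B) a b c = tens DD (dspace B) (tens (dspace B) (dspace B) a b) c"
  "tens3 (double B) (double B) (heisenberg B) a b c = tens DD (dspace B) (tens (dspace B) (dspace B) a b) c"
proof -
  have "tens (tspace (double B) (double B)) (double B) = tens DD (dspace B)"
    "tens (tspace (double B) (double B)) (heisenberg B) = tens DD (dspace B)"
    by (intro tens_vs_cong; simp add: tens_double_sel)+
  then show "tens3 (double B) (double B) (double B) a b c = tens DD (dspace B) (tens (dspace B) (dspace B) a b) c"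
    "tens3 (double B) (double B) (heisenberg B) a b c = tens DD (dspace B) (tens (dspace B) (dspace B) a b) c"
    by (simp_all add: tens3_def tens_double_sel)
qed

theorem hopf_double: "hopf_algebra_bij (double B)"
proof -
  note [cong] = dsw_cong
  have alg: "algebra (double B)"
    using double_mul_bilin by (auto simp: algebra_def bilin_double_sel double_mul_assoc double_mul_unit)
  have comul: "linmap (dspace B) DD (comul (double B))"
    by (rule linmap_cong'[OF linmap_dcomul]) (simp_all add: comul_double)
  have coalg: "coalgebra (double B)"
    unfolding coalgebra_def
    by (auto simp: comul tens_double_sel sw_double tens3_double dsw_coassoc dsw_counit)
  have bialg: "bialgebra (double B)"
    unfolding bialgebra_def
    by (auto simp: alg coalg comul_double dcomul_unit counit_double_unit counit_double_mult tens_double_sel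
        dcomul_mult sw_double)
  have hopf: "hopf_algebra (double B)"
    unfolding hopf_algebra_def
    by (auto simp: bialg lin_antip sw_double antip_double_left antip_double_right)
  have "bij_betw (antip (double B)) D D"
    by (rule bij_betw_byWitness[of _ antip_double_inv]) (auto simp: antip_antip_inv)
  then show ?thesis using hopf by (simp add: hopf_algebra_bij_def)
qed

end

text \<open>Beyond the default depth the simplifier gives up on the side conditions of deeply nested Sweedler
  sums without a message.\<close>

declare [[simp_depth_limit = 1000]]

context hopf_bij begin

section \<open>The Heisenberg double\<close>

abbreviation hact where "hact \<equiv> act (heisenberg B)"

lemma rreg_alg_eq: "c \<in> C \<Longrightarrow> rreg_alg B c \<beta> = SW c (\<lambda>c1 c2. scal B (ap \<beta> c1) c2)"
  by (simp add: rreg_alg_def sw_eq_SW ap_def)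

lemma hact_eq:
  "h \<in> D \<Longrightarrow> t \<in> D \<Longrightarrow> hact h t = DS h (\<lambda>\<mu> m. DS t (\<lambda>\<alpha> a.
    sw (dual B) \<mu> (\<lambda>u \<mu>3. sw (dual B) u (\<lambda>\<mu>1 \<mu>2. SW m (\<lambda>y m3. SW y (\<lambda>m1 m2.
      dtens B (mul (dual B) (mul (dual B) \<mu>3 (lreg B m1 \<alpha>)) (antip_inv (dual B) \<mu>2))
        (rreg_alg B (m2 \<cdot> a \<cdot> S m3) (antip_inv (dual B) \<mu>1))))))))"
  by (simp add: heisenberg_def dsum_eq_DS sw3_def sw_eq_SW cong: DS_cong SW_cong sw_dual_cong)

lemma hact_closed [simp]: "h \<in> D \<Longrightarrow> t \<in> D \<Longrightarrow> hact h t \<in> D"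
  by (simp add: hact_eq DS_mem SW_mem sw_dual_mem)

lemma DS_hact:
  assumes "h \<in> D" "t \<in> D" and K: "dform K"
  shows "DS (hact h t) K = DS h (\<lambda>\<mu> m. DS t (\<lambda>\<alpha> a.
    sw (dual B) \<mu> (\<lambda>u \<mu>3. sw (dual B) u (\<lambda>\<mu>1 \<mu>2. SW m (\<lambda>y m3. SW y (\<lambda>m1 m2.
      SW (m2 \<cdot> a \<cdot> S m3) (\<lambda>c1 c2. ap \<mu>1 (T c1) *
        K (mul (dual B) (mul (dual B) \<mu>3 (lreg B m1 \<alpha>)) (antip_inv (dual B) \<mu>2)) c2)))))))"
proof -
  have *: "K \<alpha> (SW c (\<lambda>c1 c2. scal B (f c1) c2)) = SW c (\<lambda>c1 c2. f c1 * K \<alpha> c2)"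
    if "\<alpha> \<in> A" for c f \<alpha>
  proof -
    have "form (K \<alpha>)" using K that by (simp add: dform_def bilin_def)
    then show ?thesis by (simp add: linmap_SW form_scal cong: SW_cong)
  qed
  show ?thesis
    using assms
    by (simp add: hact_eq DS_DS DS_SW DS_tens DS_mem SW_mem DS_sw_dual sw_dual_mem rreg_alg_eq * ap_simps
        cong: DS_cong SW_cong sw_dual_cong)
qed

lemma ev_hact:
  assumes "h \<in> D" "t \<in> D" "x \<in> C" "form \<phi>"
  shows "ev x \<phi> (hact h t) = DS h (\<lambda>\<mu> m. DS t (\<lambda>\<alpha> a. SW m (\<lambda>y m3. SW y (\<lambda>m1 m2.
    SW x (\<lambda>z x3. SW z (\<lambda>x1 x2. SW (m2 \<cdot> a \<cdot> S m3) (\<lambda>c1 c2.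
      ap \<mu> (T c1 \<cdot> T x3 \<cdot> x1) * ap \<alpha> (x2 \<cdot> m1) * ap \<phi> c2)))))))"
proof -
  note [cong] = SW_cong DS_cong sw_dual_cong
  show ?thesis
    using assms apply (simp add: DS_hact ap_simps dual_out)
    apply (intro DS_cong refl)
    subgoal for \<mu> m \<alpha> a
      by ((simp add: counits)?; (simp add: expand)?;
        (simp only: SW_tagged SW_tag[where b=a and i=3] SW_tag[where b=m and i=2] SW_tag[where b=x and i=1])?;
        (simp only: SWt_sort rel_simps)?; (simp only: untag)?; (simp add: SW_nest)?; (simp add: mult_ac)?)
    done
qed

lemma hmul_bilin: "bilin (dspace B) (dspace B) (dspace B) hmul"
proof (rule bilinI)
  note [cong] = SW_cong DS_cong
  fix t assume [simp]: "t \<in> D"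
  show "linmap (dspace B) (dspace B) (hmul t)"
  proof (rule double_linmapI)
    fix x \<phi> assume [simp]: "x \<in> C" "form \<phi>"
    have "linmap (dspace B) scalars (\<lambda>z. DS t (\<lambda>\<alpha> a. DS z (\<lambda>\<beta> b. SW a (\<lambda>a1 a2.
        SW x (\<lambda>x1 x2. ap \<alpha> x1 * ap \<beta> (x2 \<cdot> a1)) * ap \<phi> (a2 \<cdot> b)))))" by simp
    then show "linmap (dspace B) scalars (\<lambda>z. ev x \<phi> (hmul t z))"
      by (rule linmap_cong') (simp_all add: DS_hmul ap_simps)
  qed simp_all
  show "linmap (dspace B) (dspace B) (\<lambda>s. hmul s t)"
  proof (rule double_linmapI)
    fix x \<phi> assume [simp]: "x \<in> C" "form \<phi>"
    have "linmap (dspace B) scalars (\<lambda>z. DS z (\<lambda>\<alpha> a. DS t (\<lambda>\<beta> b. SW a (\<lambda>a1 a2.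
        SW x (\<lambda>x1 x2. ap \<alpha> x1 * ap \<beta> (x2 \<cdot> a1)) * ap \<phi> (a2 \<cdot> b)))))" by simp
    then show "linmap (dspace B) scalars (\<lambda>z. ev x \<phi> (hmul z t))"
      by (rule linmap_cong') (simp_all add: DS_hmul ap_simps)
  qed simp_all
qed

lemma hact_bilin: "bilin (dspace B) (dspace B) (dspace B) hact"
proof (rule bilinI)
  fix t assume [simp]: "t \<in> D"
  show "linmap (dspace B) (dspace B) (hact t)"
  proof (rule double_linmapI)
    fix x \<phi> assume [simp]: "x \<in> C" "form \<phi>"
    show "linmap (dspace B) scalars (\<lambda>z. ev x \<phi> (hact t z))"
      by (rule linmap_cong'[OF _ ev_hact]) simp_all
  qed simp_all
  show "linmap (dspace B) (dspace B) (\<lambda>s. hact s t)"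
  proof (rule double_linmapI)
    fix x \<phi> assume [simp]: "x \<in> C" "form \<phi>"
    show "linmap (dspace B) scalars (\<lambda>z. ev x \<phi> (hact z t))"
      by (rule linmap_cong'[OF _ ev_hact]) simp_all
  qed simp_all
qed

lemma lin_hmul [simp]:
  "c \<in> D \<Longrightarrow> linmap V (dspace B) g \<Longrightarrow> linmap V (dspace B) (\<lambda>z. hmul c (g z))"
  "c \<in> D \<Longrightarrow> linmap V (dspace B) g \<Longrightarrow> linmap V (dspace B) (\<lambda>z. hmul (g z) c)"
  using linmap_comp[OF bilin_right[OF hmul_bilin]] linmap_comp[OF bilin_left[OF hmul_bilin]]
  by blast+

lemma lin_hact [simp]:
  "c \<in> D \<Longrightarrow> linmap V (dspace B) g \<Longrightarrow> linmap V (dspace B) (\<lambda>z. hact c (g z))"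
  "c \<in> D \<Longrightarrow> linmap V (dspace B) g \<Longrightarrow> linmap V (dspace B) (\<lambda>z. hact (g z) c)"
  using linmap_comp[OF bilin_right[OF hact_bilin]] linmap_comp[OF bilin_left[OF hact_bilin]]
  by blast+

lemma hmul_assoc:
  assumes [simp]: "s \<in> D" "t \<in> D" "u \<in> D"
  shows "hmul (hmul s t) u = hmul s (hmul t u)"
proof (rule double_eqI)
  fix x \<phi> assume [simp]: "x \<in> C" "form \<phi>"
  note [cong] = SW_cong DS_cong
  show "ev x \<phi> (hmul (hmul s t) u) = ev x \<phi> (hmul s (hmul t u))"
    apply (simp add: DS_hmul ap_simps)
    apply (simp add: DS_out)
    apply (intro DS_cong refl)
    subgoal for \<alpha> a \<beta> b \<gamma> c
      by ((simp add: counits)?; (simp add: expand)?;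
        (simp only: SW_tagged SW_tag[where b=b and i=3] SW_tag[where b=a and i=2] SW_tag[where b=x and i=1])?;
        (simp only: SWt_sort rel_simps)?; (simp only: untag)?; (simp add: SW_nest)?; (simp add: mult_ac)?)
    done
qed simp_all

lemma hmul_unit:
  assumes [simp]: "t \<in> D"
  shows "hmul unit_double t = t" "hmul t unit_double = t"
proof -
  note [cong] = SW_cong DS_cong
  show "hmul unit_double t = t"
  proof (rule double_eqI)
    fix x \<phi> assume [simp]: "x \<in> C" "form \<phi>"
    show "ev x \<phi> (hmul unit_double t) = ev x \<phi> t"
      by (simp add: DS_hmul ap_simps DS_tens SW_one ap_collapse)
  qed simp_all
  show "hmul t unit_double = t"
  proof (rule double_eqI)
    fix x \<phi> assume [simp]: "x \<in> C" "form \<phi>"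
    show "ev x \<phi> (hmul t unit_double) = ev x \<phi> t"
      by (simp add: DS_hmul ap_simps DS_tens ap_collapse)
  qed simp_all
qed

lemma hact_unit:
  assumes [simp]: "t \<in> D"
  shows "hact unit_double t = t"
proof (rule double_eqI)
  note [cong] = SW_cong DS_cong
  fix x \<phi> assume [simp]: "x \<in> C" "form \<phi>"
  show "ev x \<phi> (hact unit_double t) = ev x \<phi> t"
    apply (simp add: ev_hact DS_tens SW_one ap_simps)
    apply (simp add: ap_collapse)
    done
qed simp_all

lemma SW_arg_in:
  assumes "\<And>u. u \<in> C \<Longrightarrow> form (f u)" "\<And>v. v \<in> C \<Longrightarrow> form (\<lambda>u. f u v)"
    "\<And>u v. u \<in> C \<Longrightarrow> v \<in> C \<Longrightarrow> g u v \<in> C"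
  shows "SW b (\<lambda>u v. SW (g u v) f) = SW (SW b g) f"
  using assms by (intro SW_linmap_in[of scalars "\<lambda>z. SW z f"]) simp_all

lemma SW_scal:
  assumes "\<And>u. u \<in> C \<Longrightarrow> form (f u)" "\<And>v. v \<in> C \<Longrightarrow> form (\<lambda>u. f u v)" "a \<in> C"
  shows "SW (scal B k a) f = k * SW a f"
  using assms linmap_scal[of B scalars "\<lambda>z. SW z f" a k] by simp

lemma SW_arg_S3:
  assumes "w \<in> C" "\<And>u. u \<in> C \<Longrightarrow> form (f u)" "\<And>v. v \<in> C \<Longrightarrow> form (\<lambda>u. f u v)"
  shows "SW w (\<lambda>u v. SW (u \<cdot> S v) f) = \<epsilon> w * f \<one> \<one>"
  using assms by (simp add: SW_arg_in SW_scal SW_one SW_S1)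

lemma hact_one:
  assumes [simp]: "h \<in> D"
  shows "hact h unit_double = scal (dspace B) (counit (double B) h) unit_double"
proof (rule double_eqI)
  note [cong] = SW_cong DS_cong
  fix x \<phi> assume [simp]: "x \<in> C" "form \<phi>"
  show "ev x \<phi> (hact h unit_double) = ev x \<phi> (scal (dspace B) (counit (double B) h) unit_double)"
    apply (simp add: ev_hact DS_tens SW_one ap_simps counit_double DS_out)
    apply (intro DS_cong refl)
    subgoal for \<alpha> a
    proof -
      assume [simp]: "\<alpha> \<in> A" "a \<in> C"
      have 1: "SW a (\<lambda>a1 a2. SW (a1 \<cdot> S a2) (\<lambda>c1 c2. SW x (\<lambda>x1 x2. ap \<alpha> (T c1 \<cdot> T x2 \<cdot> x1) * ap \<phi> (c2)))) =
          ap \<alpha> \<one> * \<epsilon> a * (\<epsilon> x * ap \<phi> \<one>)"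
        by (simp add: ap_collapse SW_arg_S3; (simp add: mult_ac)?)
      show ?thesis
        apply (rule trans[OF _ 1])
        by ((simp add: counits)?; (simp add: expand)?;
          (simp only: SW_tagged SW_tag[where b=a and i=2] SW_tag[where b=x and i=1])?;
          (simp only: SWt_sort rel_simps)?; (simp only: untag)?; (simp add: SW_nest)?; (simp add: mult_ac)?)
    qed
    done
qed simp_all

definition th :: "'b \<Rightarrow> ('b \<Rightarrow> 'k) \<Rightarrow> ('k, 'b \<Rightarrow> 'k, 'b) tensor \<Rightarrow> 'k" where
  "th x \<phi> t = DS t (\<lambda>\<alpha> a. SW x (\<lambda>x1 x2. ap \<alpha> x1 * ap \<phi> (x2 \<cdot> a)))"

lemma th_eqI:
  assumes "s \<in> D" "t \<in> D" and th: "\<And>x \<phi>. x \<in> C \<Longrightarrow> form \<phi> \<Longrightarrow> th x \<phi> s = th x \<phi> t"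
  shows "s = t"
proof (rule double_eqI[OF assms(1,2)])
  note [cong] = SW_cong DS_cong
  fix x \<phi> assume [simp]: "x \<in> C" "form \<phi>"
  have *: "ev x \<phi> u = SW x (\<lambda>x1 x2. th x1 (\<lambda>c. ap \<phi> (T x2 \<cdot> c)) u)" for u
  proof -
    have "SW x (\<lambda>x1 x2. th x1 (\<lambda>c. ap \<phi> (T x2 \<cdot> c)) u) =
      DS u (\<lambda>\<alpha> a. SW x (\<lambda>z x3. SW z (\<lambda>x1 x2. ap \<alpha> x1 * ap \<phi> (T x3 \<cdot> x2 \<cdot> a))))"
      by (simp add: th_def ap_def[of "\<lambda>c. _ c"] DS_out)
    also have "\<dots> = DS u (\<lambda>\<alpha> a. SW x (\<lambda>x1 z. SW z (\<lambda>x2 x3. ap \<alpha> x1 * ap \<phi> (T x3 \<cdot> x2 \<cdot> a))))"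
      by (simp add: SW_coassoc)
    also have "\<dots> = ev x \<phi> u"
      by (simp add: ap_collapse)
    finally show ?thesis by simp
  qed
  have "th x1 (\<lambda>c. ap \<phi> (T x2 \<cdot> c)) s = th x1 (\<lambda>c. ap \<phi> (T x2 \<cdot> c)) t" if "x1 \<in> C" "x2 \<in> C" for x1 x2
    using that by (intro th) simp_all
  then show "ev x \<phi> s = ev x \<phi> t" unfolding * by simp
qed

lemma hmul_braided:
  assumes [simp]: "s \<in> D" "t \<in> D"
  shows "hmul s t = dsw s (\<lambda>s1 s2. hmul (hact s1 t) s2)"
proof (rule th_eqI)
  note [cong] = SW_cong DS_cong sw_dual_cong dsw_cong
  fix x \<phi> assume [simp]: "x \<in> C" "form \<phi>"
  have lin: "linmap (dspace B) scalars (th x \<phi>)"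
    unfolding th_def[abs_def] by (rule DS_linmap) simp
  show "th x \<phi> (hmul s t) = th x \<phi> (dsw s (\<lambda>s1 s2. hmul (hact s1 t) s2))"
    apply (simp add: linmap_dsw[OF lin])
    apply (simp add: th_def dsw_eq DS_hact DS_hmul DS_tens ap_simps dual_out)
    apply (intro DS_cong refl)
    subgoal for \<alpha> a \<gamma> c
    proof -
      assume [simp]: "\<alpha> \<in> A" "a \<in> C" "\<gamma> \<in> A" "c \<in> C"
      have 1: "SW x (\<lambda>x1 r. SW r (\<lambda>x2 x3. SW a (\<lambda>a1 r. SW r (\<lambda>a2 w. SW w (\<lambda>a3 a4. SW (x3 \<cdot> a2 \<cdot> c \<cdot> S a3) (\<lambda>u d3. SW u
        (\<lambda>d1 d2. ap \<alpha> (d2 \<cdot> T d1 \<cdot> x1) * ap \<gamma> (x2 \<cdot> a1) * ap \<phi> (d3 \<cdot> a4)))))))) =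
          SW x (\<lambda>x1 r. SW r (\<lambda>x2 x3. SW a (\<lambda>a1 a2. ap \<alpha> (x1) * ap \<gamma> (x2 \<cdot> a1) * ap \<phi> (x3 \<cdot> a2 \<cdot> c))))"
        by (simp add: ap_collapse)
      show ?thesis
        apply (rule trans[OF _ trans[OF sym[OF 1]]])
        subgoal
          by ((simp add: counits)?; (simp add: expand)?;
            (simp only: SW_tagged SW_tag[where b=c and i=3] SW_tag[where b=a and i=2] SW_tag[where b=x and i=1])?;
            (simp only: SWt_sort rel_simps)?; (simp only: untag)?; (simp add: SW_nest)?; (simp add: mult_ac)?)
        subgoal
          by ((simp add: counits)?; (simp add: expand)?;
            (simp only: SW_tagged SW_tag[where b=c and i=3] SW_tag[where b=a and i=2] SW_tag[where b=x and i=1])?;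
            (simp only: SWt_sort rel_simps)?; (simp only: untag)?; (simp add: SW_nest)?; (simp add: mult_ac)?)
        done
    qed
    done
qed (simp_all add: dsw_mem)

lemma hact_mul:
  assumes [simp]: "g \<in> D" "h \<in> D" "t \<in> D"
  shows "hact (double_mul B g h) t = hact g (hact h t)"
proof (rule th_eqI)
  note [cong] = SW_cong DS_cong sw_dual_cong dsw_cong
  fix x \<phi> assume [simp]: "x \<in> C" "form \<phi>"
  have lin: "linmap (dspace B) scalars (th x \<phi>)"
    unfolding th_def[abs_def] by (rule DS_linmap) simp
  show "th x \<phi> (hact (double_mul B g h) t) = th x \<phi> (hact g (hact h t))"
    apply (simp add: th_def DS_hact DS_double_mul ap_simps dual_out)
    apply (intro DS_cong refl)
    subgoal for \<mu> m \<nu> n \<alpha> a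
    proof -
      assume [simp]: "\<mu> \<in> A" "m \<in> C" "\<nu> \<in> A" "n \<in> C" "\<alpha> \<in> A" "a \<in> C"
      have 1: "SW m (\<lambda>p w. SW p (\<lambda>m1 r. SW r (\<lambda>m2 r. SW r (\<lambda>m3 r. SW r (\<lambda>m4 m5. SW x (\<lambda>x1 r. SW r (\<lambda>x2 r. SW r (\<lambda>x3
        x4. SW n (\<lambda>n1 r. SW r (\<lambda>n2 n3. SW (x4 \<cdot> m3 \<cdot> n2 \<cdot> a \<cdot> S n3) (\<lambda>d1 r. SW r (\<lambda>d2 d3. SW w (\<lambda>m6 m7. ap \<mu> (m5 \<cdot> T
        d2 \<cdot> x1) * ap \<nu> (T m7 \<cdot> m6 \<cdot> T d1 \<cdot> x2 \<cdot> m1) * ap \<alpha> (x3 \<cdot> m2 \<cdot> n1) * ap \<phi> (d3 \<cdot> S m4)))))))))))))) =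
          SW m (\<lambda>m1 r. SW r (\<lambda>m2 r. SW r (\<lambda>m3 r. SW r (\<lambda>m4 m5. SW x (\<lambda>x1 r. SW r (\<lambda>x2 r. SW r (\<lambda>x3 x4. SW n (\<lambda>n1 r. SW
            r (\<lambda>n2 n3. SW (x4 \<cdot> m3 \<cdot> n2 \<cdot> a \<cdot> S n3) (\<lambda>d1 r. SW r (\<lambda>d2 d3. ap \<mu> (m5 \<cdot> T d2 \<cdot> x1) * ap \<nu> (T d1 \<cdot> x2 \<cdot>
            m1) * ap \<alpha> (x3 \<cdot> m2 \<cdot> n1) * ap \<phi> (d3 \<cdot> S m4))))))))))))"
        by (simp add: ap_collapse)
      show ?thesis
        apply (rule trans[OF trans[OF _ 1]])
        subgoal
          by ((simp add: counits)?; (simp add: expand)?;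
            (simp only: SW_tagged SW_tag[where b=a and i=4] SW_tag[where b=n and i=3] SW_tag[where b=m and i=2] SW_tag[where b=x and i=1])?;
            (simp only: SWt_sort rel_simps)?; (simp only: untag)?; (simp add: SW_nest)?; (simp add: mult_ac)?)
        subgoal
          by ((simp add: counits)?; (simp add: expand)?;
            (simp only: SW_tagged SW_tag[where b=a and i=4] SW_tag[where b=n and i=3] SW_tag[where b=m and i=2] SW_tag[where b=x and i=1])?;
            (simp only: SWt_sort rel_simps)?; (simp only: untag)?; (simp add: SW_nest)?; (simp add: mult_ac)?)
        done
    qed
    done
qed (simp_all add: dsw_mem)

lemma hact_hmul_dual:
  assumes [simp]: "\<mu> \<in> A" "s \<in> D" "t \<in> D"
  shows "hact (dtens B \<mu> \<one>) (hmul s t) = dsw (dtens B \<mu> \<one>) (\<lambda>h1 h2. hmul (hact h1 s) (hact h2 t))"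
proof (rule th_eqI)
  note [cong] = SW_cong DS_cong sw_dual_cong dsw_cong
  fix x \<phi> assume [simp]: "x \<in> C" "form \<phi>"
  have lin: "linmap (dspace B) scalars (th x \<phi>)"
    unfolding th_def[abs_def] by (rule DS_linmap) simp
  show "th x \<phi> (hact (dtens B \<mu> \<one>) (hmul s t)) = th x \<phi> (dsw (dtens B \<mu> \<one>) (\<lambda>h1 h2. hmul (hact h1 s) (hact h2 t)))"
    apply (simp add: linmap_dsw[OF lin])
    apply (simp add: th_def dsw_eq DS_hact DS_hmul DS_tens ap_simps dual_out SW_one)
    apply (intro DS_cong refl)
    subgoal for \<beta> b \<gamma> c
    proof -
      assume [simp]: "\<beta> \<in> A" "b \<in> C" "\<gamma> \<in> A" "c \<in> C"
      have 1: "SW x (\<lambda>x1 r. SW r (\<lambda>x2 r. SW r (\<lambda>wx r. SW r (\<lambda>x5 r. SW r (\<lambda>x6 x7. SW b (\<lambda>w r. SW r (\<lambda>g3 r. SW r (\<lambda>g4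
        g5. SW c (\<lambda>d1 d2. SW wx (\<lambda>x3 x4. SW w (\<lambda>g1 g2. ap \<mu> (T d1 \<cdot> T g4 \<cdot> T x6 \<cdot> x4 \<cdot> g2 \<cdot> T g1 \<cdot> T x3 \<cdot> x1) * ap \<beta>
        (x2) * ap \<gamma> (x5 \<cdot> g3) * ap \<phi> (x7 \<cdot> g5 \<cdot> d2)))))))))))) =
          SW x (\<lambda>x1 r. SW r (\<lambda>x2 r. SW r (\<lambda>x5 r. SW r (\<lambda>x6 x7. SW b (\<lambda>g3 r. SW r (\<lambda>g4 g5. SW c (\<lambda>d1 d2. ap \<mu> (T d1 \<cdot> T
            g4 \<cdot> T x6 \<cdot> x1) * ap \<beta> (x2) * ap \<gamma> (x5 \<cdot> g3) * ap \<phi> (x7 \<cdot> g5 \<cdot> d2))))))))"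
        by (simp add: ap_collapse)
      show ?thesis
        apply (rule trans[OF _ trans[OF sym[OF 1]]])
        subgoal
          by ((simp add: counits)?; (simp add: expand)?;
            (simp only: SW_tagged SW_tag[where b=c and i=3] SW_tag[where b=b and i=2] SW_tag[where b=x and i=1])?;
            (simp only: SWt_sort rel_simps)?; (simp only: untag)?; (simp add: SW_nest)?; (simp add: mult_ac)?)
        subgoal
          by ((simp add: counits)?; (simp add: expand)?;
            (simp only: SW_tagged SW_tag[where b=c and i=3] SW_tag[where b=b and i=2] SW_tag[where b=x and i=1])?;
            (simp only: SWt_sort rel_simps)?; (simp only: untag)?; (simp add: SW_nest)?; (simp add: mult_ac)?)
        done
    qed
    done
qed (simp_all add: dsw_mem)

lemma hact_hmul_self:
  assumes [simp]: "m \<in> C" "s \<in> D" "t \<in> D"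
  shows "hact (dtens B (unity (dual B)) m) (hmul s t) = dsw (dtens B (unity (dual B)) m) (\<lambda>h1 h2. hmul (hact h1 s)
    (hact h2 t))"
proof (rule th_eqI)
  note [cong] = SW_cong DS_cong sw_dual_cong dsw_cong
  fix x \<phi> assume [simp]: "x \<in> C" "form \<phi>"
  have lin: "linmap (dspace B) scalars (th x \<phi>)"
    unfolding th_def[abs_def] by (rule DS_linmap) simp
  show "th x \<phi> (hact (dtens B (unity (dual B)) m) (hmul s t)) = th x \<phi> (dsw (dtens B (unity (dual B)) m) (\<lambda>h1 h2. hmul
    (hact h1 s) (hact h2 t)))"
    apply (simp add: linmap_dsw[OF lin])
    apply (simp add: th_def dsw_eq DS_hact DS_hmul DS_tens ap_simps dual_out SW_one)
    apply (intro DS_cong refl)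
    subgoal for \<beta> b \<gamma> c
    proof -
      assume [simp]: "\<beta> \<in> A" "b \<in> C" "\<gamma> \<in> A" "c \<in> C"
      have 1: "SW x (\<lambda>x1 r. SW r (\<lambda>x2 x3. SW m (\<lambda>m1 r. SW r (\<lambda>m2 r. SW r (\<lambda>m3 r. SW r (\<lambda>V m6. SW b (\<lambda>b1 b2. SW V (\<lambda>r1
        s. SW s (\<lambda>w m5. SW w (\<lambda>r2 m4. ap \<beta> (x1 \<cdot> m1) * ap \<gamma> (x2 \<cdot> m2 \<cdot> b1 \<cdot> S r2 \<cdot> m4) * ap \<phi> (x3 \<cdot> m3 \<cdot> b2 \<cdot> S r1 \<cdot>
        m5 \<cdot> c \<cdot> S m6))))))))))) =
          SW x (\<lambda>x1 r. SW r (\<lambda>x2 x3. SW m (\<lambda>m1 r. SW r (\<lambda>m2 r. SW r (\<lambda>m3 m6. SW b (\<lambda>b1 b2. ap \<beta> (x1 \<cdot> m1) * ap \<gamma> (x2 \<cdot>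
            m2 \<cdot> b1) * ap \<phi> (x3 \<cdot> m3 \<cdot> b2 \<cdot> c \<cdot> S m6)))))))"
        by (simp add: ap_collapse)
      show ?thesis
        apply (rule trans[OF _ trans[OF sym[OF 1]]])
        subgoal
          by ((simp add: counits)?; (simp add: expand)?;
            (simp only: SW_tagged SW_tag[where b=c and i=4] SW_tag[where b=b and i=3] SW_tag[where b=m and i=2] SW_tag[where b=x and i=1])?;
            (simp only: SWt_sort rel_simps)?; (simp only: untag)?; (simp add: SW_nest)?; (simp add: mult_ac)?)
        subgoal
          by ((simp add: counits)?; (simp add: expand)?;
            (simp only: SW_tagged SW_tag[where b=c and i=4] SW_tag[where b=b and i=3] SW_tag[where b=m and i=2] SW_tag[where b=x and i=1])?;
            (simp only: SWt_sort rel_simps)?; (simp only: untag)?; (simp add: SW_nest)?; (simp add: mult_ac)?)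
        done
    qed
    done
qed (simp_all add: dsw_mem)

lemma dtens_split:
  assumes [simp]: "\<mu> \<in> A" "m \<in> C"
  shows "dtens B \<mu> m = double_mul B (dtens B \<mu> \<one>) (dtens B (unity (dual B)) m)"
proof (rule double_eqI)
  note [cong] = SW_cong DS_cong
  fix x \<phi> assume [simp]: "x \<in> C" "form \<phi>"
  show "DS (dtens B \<mu> m) (\<lambda>\<alpha> a. ap \<alpha> x * ap \<phi> a) =
    DS (double_mul B (dtens B \<mu> \<one>) (dtens B (unity (dual B)) m)) (\<lambda>\<alpha> a. ap \<alpha> x * ap \<phi> a)"
    by (simp add: DS_double_mul DS_tens ap_simps SW_one ap_collapse)
qed simp_all

lemma double_linmap_eqI:
  assumes "linmap (dspace B) W f" "linmap (dspace B) W g" "vspace W" "h \<in> D"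
    and "\<And>\<mu> m. \<mu> \<in> A \<Longrightarrow> m \<in> C \<Longrightarrow> f (dtens B \<mu> m) = g (dtens B \<mu> m)"
  shows "f h = g h"
proof -
  have "h = (\<Sum>z\<leftarrow>tlist (dual B) B h. dtens B (fst z) (snd z))"
    by (rule tlist(3)[OF vspace_dual assms(4)])
  moreover have "f (\<Sum>z\<leftarrow>tlist (dual B) B h. dtens B (fst z) (snd z)) =
      g (\<Sum>z\<leftarrow>tlist (dual B) B h. dtens B (fst z) (snd z))"
    by (subst linmap_sum_list[OF assms(1) vspace_tspace], (rule dtens_closed; rule tlist[OF vspace_dual assms(4)];
      assumption),
        subst linmap_sum_list[OF assms(2) vspace_tspace], (rule dtens_closed; rule tlist[OF vspace_dual assms(4)];
          assumption),
        intro arg_cong[of _ _ sum_list] map_cong refl assms(5) tlist[OF vspace_dual assms(4)])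
  ultimately show ?thesis by simp
qed

lemma linmap_dsw_arg:
  assumes "bilin (dspace B) (dspace B) W F" "vspace W"
  shows "linmap (dspace B) W (\<lambda>h. dsw h F)"
  by (rule linmap_cong'[OF linmap_tsum_arg[OF _ _ assms(2,1) linmap_dcomul]]) (simp_all add: dsw_def)

lemma dsw_mult:
  assumes F: "bilin (dspace B) (dspace B) W F" "vspace W" and [simp]: "g \<in> D" "h \<in> D"
  shows "dsw (double_mul B g h) F = dsw g (\<lambda>g1 g2. dsw h (\<lambda>h1 h2. F (double_mul B g1 h1) (double_mul B g2 h2)))"
proof -
  note [cong] = dsw_cong
  have lin: "linmap DD W (\<lambda>t. tsum (dspace B) (dspace B) t F)"
    by (intro tsum_linmap F) simp_all
  show ?thesis
    by (simp add: dsw_def[of "double_mul B g h"] dcomul_mult linmap_dsw[OF lin] dsw_mem tsum_tens[OF F(2,1)])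
qed

lemma dsw_swap: "dsw g (\<lambda>g1 g2. dsw h (\<lambda>h1 h2. f g1 g2 h1 h2)) = dsw h (\<lambda>h1 h2. dsw g (\<lambda>g1 g2. f g1 g2 h1 h2))"
  by (auto simp: dsw_def tsum_zero intro: tsum_swap)

lemma hact_hmul:
  assumes [simp]: "h \<in> D" "s \<in> D" "t \<in> D"
  shows "hact h (hmul s t) = dsw h (\<lambda>h1 h2. hmul (hact h1 s) (hact h2 t))"
proof -
  note [cong] = dsw_cong
  let ?F = "\<lambda>h1 h2. hmul (hact h1 s) (hact h2 t)"
  have F: "bilin (dspace B) (dspace B) (dspace B) ?F"
    by (rule bilinI) (simp_all add: linmap_id)
  show ?thesis
  proof (rule double_linmap_eqI[of "dspace B" "\<lambda>h. hact h (hmul s t)" "\<lambda>h. dsw h ?F"])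
    show "linmap (dspace B) (dspace B) (\<lambda>h. hact h (hmul s t))" by (simp add: linmap_id)
    show "linmap (dspace B) (dspace B) (\<lambda>h. dsw h ?F)" by (rule linmap_dsw_arg[OF F]) simp
    fix \<mu> m assume [simp]: "\<mu> \<in> A" "m \<in> C"
    let ?g = "dtens B \<mu> \<one>" and ?h = "dtens B (unity (dual B)) m"
    have lin: "linmap (dspace B) (dspace B) (hact ?g)" by (rule bilin_right[OF hact_bilin]) simp
    have "hact (dtens B \<mu> m) (hmul s t) = hact ?g (dsw ?h ?F)"
      by (simp add: dtens_split[of \<mu> m] hact_mul hact_hmul_self)
    also have "\<dots> = dsw ?h (\<lambda>h1 h2. dsw ?g (\<lambda>g1 g2. hmul (hact g1 (hact h1 s)) (hact g2 (hact h2 t))))"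
      by (simp add: linmap_dsw[OF lin] hact_hmul_dual)
    also have "\<dots> = dsw ?g (\<lambda>g1 g2. dsw ?h (\<lambda>h1 h2. ?F (double_mul B g1 h1) (double_mul B g2 h2)))"
      by (subst dsw_swap) (simp add: hact_mul)
    also have "\<dots> = dsw (dtens B \<mu> m) ?F"
      by (simp add: dtens_split[of \<mu> m] dsw_mult[OF F vspace_tspace])
    finally show "hact (dtens B \<mu> m) (hmul s t) = dsw (dtens B \<mu> m) ?F" .
  qed simp_all
qed

lemma separating_th: "separating (dspace B) {th x \<phi> | x \<phi>. x \<in> C \<and> form \<phi>}"
  unfolding separating_def
proof (intro conjI ballI impI)
  fix p assume "p \<in> {th x \<phi> | x \<phi>. x \<in> C \<and> form \<phi>}"
  then obtain x \<phi> where p: "p = th x \<phi>" "x \<in> C" "form \<phi>" by blast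
  show "linmap (dspace B) scalars p"
    unfolding p(1) th_def[abs_def] using p(2,3) by (intro DS_linmap) simp
next
  fix t assume t: "t \<in> D" "\<forall>p\<in>{th x \<phi> | x \<phi>. x \<in> C \<and> form \<phi>}. p t = 0"
  show "t = 0"
  proof (rule th_eqI[OF t(1) vspace_zero[OF vspace_tspace]])
    fix x \<phi> assume x: "x \<in> C" "form \<phi>"
    have "th x \<phi> 0 = 0"
      unfolding th_def by (rule linmap_zero[OF DS_linmap vspace_tspace]) (simp add: x)
    moreover have "th x \<phi> t = 0" by (rule bspec[OF t(2)]) (use x in blast)
    ultimately show "th x \<phi> t = th x \<phi> 0" by simp
  qed
qed

lemma double2_eqI':
  assumes "s \<in> carr DD" "t \<in> carr DD"
    and "\<And>x \<phi> y \<psi>. x \<in> C \<Longrightarrow> form \<phi> \<Longrightarrow> y \<in> C \<Longrightarrow> form \<psi> \<Longrightarrow>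
      tsum (dspace B) (dspace B) s (\<lambda>g h. ev x \<phi> g * th y \<psi> h) =
      tsum (dspace B) (dspace B) t (\<lambda>g h. ev x \<phi> g * th y \<psi> h)"
  shows "s = t"
proof (rule separating_eqI[OF separating_tens[OF vspace_tspace vspace_tspace separating_double separating_th]
      vspace_tspace assms(1,2)])
  fix p assume "p \<in> {tform (dspace B) (dspace B) p q | p q.
    p \<in> {ev x \<phi> | x \<phi>. x \<in> C \<and> form \<phi>} \<and> q \<in> {th x \<phi> | x \<phi>. x \<in> C \<and> form \<phi>}}"
  then obtain x \<phi> y \<psi> where p: "p = tform (dspace B) (dspace B) (ev x \<phi>) (th y \<psi>)"
    and x: "x \<in> C" "form \<phi>" "y \<in> C" "form \<psi>" by blast
  show "p s = p t" unfolding p tform_def by (rule assms(3)[OF x])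
qed

lemma dcomul_hmul:
  assumes [simp]: "s \<in> D" "t \<in> D"
  shows "dcomul (hmul s t) = dsw s (\<lambda>s1 s2. dsw t (\<lambda>t1 t2. tens (dspace B) (dspace B) (double_mul B s1 t1) (hmul s2
    t2)))"
proof (rule double2_eqI)
  note [cong] = SW_cong DS_cong sw_dual_cong dsw_cong
  fix x \<phi> y \<psi> assume [simp]: "x \<in> C" "form \<phi>" "y \<in> C" "form \<psi>"
  let ?G = "\<lambda>t. tsum (dspace B) (dspace B) t (\<lambda>g h. ev x \<phi> g * ev y \<psi> h)"
  have lq: "linmap (dspace B) scalars (ev y \<psi>)"
    by (rule separating_linmap[OF separating_double])
      (unfold mem_Collect_eq, intro exI conjI, rule refl, simp_all)
  have lin: "linmap DD scalars ?G"
    by (intro tsum_linmap bilin_tform lq) simp_all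
  have G: "?G (tens (dspace B) (dspace B) a b) = ev x \<phi> a * ev y \<psi> b"
    if "a \<in> D" "b \<in> D" for a b
    using that by (simp add: tsum_tens[OF vspace_scalars bilin_tform] lq)
  show "?G (dcomul (hmul s t)) = ?G (dsw s (\<lambda>s1 s2. dsw t (\<lambda>t1 t2. tens (dspace B) (dspace B) (double_mul B s1 t1)
    (hmul s2 t2))))"
    apply (simp add: linmap_dsw[OF lin] dsw_mem G)
    apply (simp add: dsw_eq tsum_dcomul DS_tens DS_double_mul DS_hmul ap_simps dual_out)
    apply (intro DS_cong refl)
    subgoal for \<alpha> a \<beta> b
    proof -
      assume [simp]: "\<alpha> \<in> A" "a \<in> C" "\<beta> \<in> A" "b \<in> C"
      have 1: "SW a (\<lambda>u a5. SW u (\<lambda>u r. SW u (\<lambda>a1 a2. SW x (\<lambda>x1 x2. SW y (\<lambda>y1 y2. SW b (\<lambda>b1 b2. SW r (\<lambda>a3 a4. ap \<alpha> (y1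
        \<cdot> x1) * ap \<beta> (y2 \<cdot> a4 \<cdot> T a3 \<cdot> x2 \<cdot> a1) * ap \<phi> (a2 \<cdot> b1) * ap \<psi> (a5 \<cdot> b2)))))))) =
          SW a (\<lambda>u a3. SW u (\<lambda>a1 a2. SW x (\<lambda>x1 x2. SW y (\<lambda>y1 y2. SW b (\<lambda>b1 b2. ap \<alpha> (y1 \<cdot> x1) * ap \<beta> (y2 \<cdot> x2 \<cdot> a1) *
            ap \<phi> (a2 \<cdot> b1) * ap \<psi> (a3 \<cdot> b2))))))"
        by (simp add: ap_collapse)
      show ?thesis
        apply (rule trans[OF _ trans[OF sym[OF 1]]])
        subgoal
          by ((simp add: counits)?; (simp add: expand)?;
            (simp only: SW_tagged SW_tag[where b=b and i=4] SW_tag[where b=a and i=3] SW_tag[where b=y and i=2] SW_tag[where b=x and i=1])?;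
            (simp only: SWt_sort rel_simps)?; (simp only: untag)?; (simp add: SW_nest)?; (simp add: mult_ac)?)
        subgoal
          by ((simp add: counits)?; (simp add: expand)?;
            (simp only: SW_tagged SW_tag[where b=b and i=4] SW_tag[where b=a and i=3] SW_tag[where b=y and i=2] SW_tag[where b=x and i=1])?;
            (simp only: SWt_sort rel_simps)?; (simp only: untag)?; (simp add: SW_nest)?; (simp add: mult_ac)?)
        done
    qed
    done
qed (simp, intro dsw_mem vspace_tspace, simp)

lemma hact_yd:
  assumes [simp]: "h \<in> D" "t \<in> D"
  shows "dsw h (\<lambda>h1 h2. dsw (hact h1 t) (\<lambda>g t0. tens (dspace B) (dspace B) (double_mul B g h2) t0)) = dsw h (\<lambda>h1 h2.
    dsw t (\<lambda>g t0. tens (dspace B) (dspace B) (double_mul B h1 g) (hact h2 t0)))"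
proof (rule double2_eqI')
  note [cong] = SW_cong DS_cong sw_dual_cong dsw_cong
  fix x \<phi> y \<psi> assume [simp]: "x \<in> C" "form \<phi>" "y \<in> C" "form \<psi>"
  let ?G = "\<lambda>t. tsum (dspace B) (dspace B) t (\<lambda>g h. ev x \<phi> g * th y \<psi> h)"
  have lq: "linmap (dspace B) scalars (th y \<psi>)"
    by (rule separating_linmap[OF separating_th])
      (unfold mem_Collect_eq, intro exI conjI, rule refl, simp_all)
  have lin: "linmap DD scalars ?G"
    by (intro tsum_linmap bilin_tform lq) simp_all
  have G: "?G (tens (dspace B) (dspace B) a b) = ev x \<phi> a * th y \<psi> b"
    if "a \<in> D" "b \<in> D" for a b
    using that by (simp add: tsum_tens[OF vspace_scalars bilin_tform] lq)
  show "?G (dsw h (\<lambda>h1 h2. dsw (hact h1 t) (\<lambda>g t0. tens (dspace B) (dspace B) (double_mul B g h2) t0))) = ?G (dsw h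
    (\<lambda>h1 h2. dsw t (\<lambda>g t0. tens (dspace B) (dspace B) (double_mul B h1 g) (hact h2 t0))))"
    apply (simp add: linmap_dsw[OF lin] dsw_mem G)
    apply (simp add: dsw_eq th_def DS_tens DS_double_mul DS_hact ap_simps dual_out)
    apply (intro DS_cong refl)
    subgoal for \<mu> m \<alpha> a
    proof -
      assume [simp]: "\<mu> \<in> A" "m \<in> C" "\<alpha> \<in> A" "a \<in> C"
      have 1: "SW m (\<lambda>m1 r. SW r (\<lambda>m2 r. SW r (\<lambda>m3 m4. SW x (\<lambda>x1 r. SW r (\<lambda>x2 wx. SW y (\<lambda>y1 r. SW r (\<lambda>y2 r. SW r (\<lambda>y3
        y4. SW (m2 \<cdot> a \<cdot> S m3) (\<lambda>wd r. SW r (\<lambda>d3 r. SW r (\<lambda>d4 d5. SW wx (\<lambda>x3 x4. SW wd (\<lambda>d1 d2. ap \<mu> (T d4 \<cdot> x4 \<cdot> d2 \<cdot>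
        T d1 \<cdot> T x3 \<cdot> T y3 \<cdot> y1 \<cdot> x1) * ap \<alpha> (y2 \<cdot> x2 \<cdot> m1) * ap \<phi> (d3 \<cdot> m4) * ap \<psi> (y4 \<cdot> d5)))))))))))))) =
          SW m (\<lambda>m1 r. SW r (\<lambda>m2 r. SW r (\<lambda>m3 m4. SW x (\<lambda>x1 x2. SW y (\<lambda>y1 r. SW r (\<lambda>y2 r. SW r (\<lambda>y3 y4. SW (m2 \<cdot> a \<cdot> S
            m3) (\<lambda>d3 r. SW r (\<lambda>d4 d5. ap \<mu> (T d4 \<cdot> T y3 \<cdot> y1 \<cdot> x1) * ap \<alpha> (y2 \<cdot> x2 \<cdot> m1) * ap \<phi> (d3 \<cdot> m4) * ap \<psi> (y4 \<cdot>
            d5))))))))))"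
        by (simp add: ap_collapse)
      have 2: "SW m (\<lambda>m1 r. SW r (\<lambda>m2 r. SW r (\<lambda>m3 r. SW r (\<lambda>m4 w. SW a (\<lambda>a1 a2. SW x (\<lambda>x1 x2. SW y (\<lambda>y1 r. SW r (\<lambda>y2
        r. SW r (\<lambda>y3 y4. SW (m3 \<cdot> a2 \<cdot> S m4) (\<lambda>e1 e2. SW w (\<lambda>m5 m6. ap \<alpha> (y2 \<cdot> x2 \<cdot> m1) * ap \<mu> (T e1 \<cdot> T y3 \<cdot> y1 \<cdot> x1)
        * ap \<phi> (m2 \<cdot> a1 \<cdot> S m5 \<cdot> m6) * ap \<psi> (y4 \<cdot> e2)))))))))))) =
          SW m (\<lambda>m1 r. SW r (\<lambda>m2 r. SW r (\<lambda>m3 m4. SW a (\<lambda>a1 a2. SW x (\<lambda>x1 x2. SW y (\<lambda>y1 r. SW r (\<lambda>y2 r. SW r (\<lambda>y3 y4.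
            SW (m3 \<cdot> a2 \<cdot> S m4) (\<lambda>e1 e2. ap \<alpha> (y2 \<cdot> x2 \<cdot> m1) * ap \<mu> (T e1 \<cdot> T y3 \<cdot> y1 \<cdot> x1) * ap \<phi> (m2 \<cdot> a1) * ap \<psi>
            (y4 \<cdot> e2))))))))))"
        by (simp add: ap_collapse)
      have 3: "SW m (\<lambda>m1 r. SW r (\<lambda>m2 r. SW r (\<lambda>w r. SW r (\<lambda>m3 m4. SW a (\<lambda>a1 a2. SW x (\<lambda>x1 x2. SW y (\<lambda>y1 r. SW r (\<lambda>y2
        r. SW r (\<lambda>y3 y4. SW (m3 \<cdot> a2 \<cdot> S m4) (\<lambda>e1 e2. SW w (\<lambda>u v. ap \<alpha> (y2 \<cdot> v \<cdot> T u \<cdot> x2 \<cdot> m1) * ap \<mu> (T e1 \<cdot> T y3 \<cdot>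
        y1 \<cdot> x1) * ap \<phi> (m2 \<cdot> a1) * ap \<psi> (y4 \<cdot> e2)))))))))))) =
          SW m (\<lambda>m1 r. SW r (\<lambda>m2 r. SW r (\<lambda>m3 m4. SW a (\<lambda>a1 a2. SW x (\<lambda>x1 x2. SW y (\<lambda>y1 r. SW r (\<lambda>y2 r. SW r (\<lambda>y3 y4.
            SW (m3 \<cdot> a2 \<cdot> S m4) (\<lambda>e1 e2. ap \<alpha> (y2 \<cdot> x2 \<cdot> m1) * ap \<mu> (T e1 \<cdot> T y3 \<cdot> y1 \<cdot> x1) * ap \<phi> (m2 \<cdot> a1) * ap \<psi>
            (y4 \<cdot> e2))))))))))"
        by (simp add: ap_collapse)
      show ?thesis
        apply (rule trans[OF trans[OF _ 1] trans[OF _ trans[OF trans[OF 2 sym[OF 3]]]]])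
        subgoal
          by ((simp add: counits)?; (simp add: expand)?;
            (simp only: SW_tagged SW_tag[where b=a and i=4] SW_tag[where b=m and i=3] SW_tag[where b=y and i=2] SW_tag[where b=x and i=1])?;
            (simp only: SWt_sort rel_simps)?; (simp only: untag)?; (simp add: SW_nest)?; (simp add: mult_ac)?)
        subgoal
          by ((simp add: counits)?; (simp add: expand)?;
            (simp only: SW_tagged SW_tag[where b=a and i=4] SW_tag[where b=m and i=3] SW_tag[where b=y and i=2] SW_tag[where b=x and i=1])?;
            (simp only: SWt_sort rel_simps)?; (simp only: untag)?; (simp add: SW_nest)?; (simp add: mult_ac)?)
        subgoal
          by ((simp add: counits)?; (simp add: expand)?;
            (simp only: SW_tagged SW_tag[where b=a and i=4] SW_tag[where b=m and i=3] SW_tag[where b=y and i=2] SW_tag[where b=x and i=1])?;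
            (simp only: SWt_sort rel_simps)?; (simp only: untag)?; (simp add: SW_nest)?; (simp add: mult_ac)?)
        done
    qed
    done
qed (intro dsw_mem vspace_tspace; simp)+

subsection \<open>The Heisenberg double as a Yetter--Drinfeld module algebra\<close>

lemma yd_heisenberg: "yd_module_algebra (double B) (heisenberg B)"
proof -
  note [cong] = dsw_cong
  have alg: "algebra (heisenberg B)"
    by (simp add: algebra_def bilin_double_sel hmul_bilin hmul_assoc hmul_unit)
  have "module_algebra (double B) (heisenberg B)"
    by (simp add: module_algebra_def alg bilin_double_sel hact_bilin hact_unit hact_mul hact_one hact_hmul sw_double)
  moreover have "linmap (dspace B) DD (coact (heisenberg B))"
    by (rule linmap_cong'[OF linmap_dcomul]) (simp_all add: coact_heisenberg)
  then have "comodule_algebra (double B) (heisenberg B)"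
    by (simp add: comodule_algebra_def alg tens_double_sel coact_heisenberg dcomul_unit dcomul_hmul
      cosw_heisenberg sw_double tens3_double dsw_coassoc dsw_counit)
  ultimately show ?thesis
    by (simp add: yd_module_algebra_def hopf_double sw_double cosw_heisenberg tens_double_sel hact_yd)
qed

lemma braided_commutative_heisenberg: "braided_commutative (double B) (heisenberg B)"
  by (simp add: braided_commutative_def cosw_heisenberg flip: hmul_braided)

subsection \<open>The Yetter--Drinfeld algebras on \<open>B\<^sup>*\<close> and \<open>B\<close>\<close>

lemma dual_yd_sel [simp]:
  "carr (dual_yd B) = A" "scal (dual_yd B) = scal (dual B)" "mul (dual_yd B) = mul (dual B)"
  "unity (dual_yd B) = unity (dual B)"
  by (simp_all add: dual_yd_def)

lemma self_yd_sel [simp]: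
  "carr (self_yd B) = C" "scal (self_yd B) = scal B" "mul (self_yd B) = mul B" "unity (self_yd B) = \<one>"
  by (simp_all add: self_yd_def)

lemma yd_tens_sel:
  "tens (double B) (dual_yd B) = tens (dspace B) (dual B)" "tens (double B) (self_yd B) = tens (dspace B) B"
  "tspace (double B) (dual_yd B) = tspace (dspace B) (dual B)" "tspace (double B) (self_yd B) = tspace (dspace B) B"
  "tsum (double B) (dual_yd B) = tsum (dspace B) (dual B)" "tsum (double B) (self_yd B) = tsum (dspace B) B"
  "tens (dual_yd B) (self_yd B) = tens (dual B) B" "tspace (dual_yd B) (self_yd B) = dspace B"
  "tsum (dual_yd B) (self_yd B) = tsum (dual B) B"
  "tens (self_yd B) (dual_yd B) = tens B (dual B)" "tspace (self_yd B) (dual_yd B) = tspace B (dual B)"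
  "tsum (self_yd B) (dual_yd B) = tsum B (dual B)"
  by (intro tens_vs_cong; simp)+

lemma linmap_yd_sel:
  "linmap (dual_yd B) W f = linmap (dual B) W f" "linmap (self_yd B) W f' = linmap B W f'"
  "linmap V (dual_yd B) g = linmap V (dual B) g" "linmap V (self_yd B) g' = linmap V B g'"
  by (intro linmap_vs_cong; simp)+

lemma vspace_yd [simp]: "vspace (dual_yd B)" "vspace (self_yd B)"
  using vspace_dual vspace_B by (simp_all add: vspace_def)

lemma coact_dual_yd: "\<beta> \<in> A \<Longrightarrow> coact (dual_yd B) \<beta> =
    sw (dual B) \<beta> (\<lambda>\<beta>1 \<beta>2. tens (dspace B) (dual B) (dtens B \<beta>2 \<one>) \<beta>1)"
  and coact_self_yd: "b \<in> C \<Longrightarrow> coact (self_yd B) b =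
    SW b (\<lambda>b1 b2. tens (dspace B) B (dtens B (unity (dual B)) b1) b2)"
  by (simp_all add: dual_yd_def self_yd_def sw_eq_SW)

lemma coact_yd_closed:
  "\<beta> \<in> A \<Longrightarrow> coact (dual_yd B) \<beta> \<in> carr (tspace (dspace B) (dual B))"
  "b \<in> C \<Longrightarrow> coact (self_yd B) b \<in> carr (tspace (dspace B) B)"
  by (simp_all add: coact_dual_yd coact_self_yd sw_dual_mem SW_mem tens_mem)

lemma cosw_dual_yd:
  assumes "\<beta> \<in> A" "vspace W" "bilin (dspace B) (dual B) W F"
  shows "cosw (double B) (dual_yd B) \<beta> F = sw (dual B) \<beta> (\<lambda>\<beta>1 \<beta>2. F (dtens B \<beta>2 \<one>) \<beta>1)"
  using assms by (simp add: cosw_def coact_dual_yd yd_tens_sel tens_mem tsum_tens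
      linmap_sw_dual[OF tsum_linmap[OF vspace_tspace vspace_dual assms(2,3)] vspace_tspace] cong: sw_dual_cong)

lemma cosw_self_yd:
  assumes "b \<in> C" "vspace W" "bilin (dspace B) B W F"
  shows "cosw (double B) (self_yd B) b F = SW b (\<lambda>b1 b2. F (dtens B (unity (dual B)) b1) b2)"
  using assms by (simp add: cosw_def coact_self_yd yd_tens_sel tens_mem tsum_tens
      linmap_SW[OF tsum_linmap[OF vspace_tspace vspace_B assms(2,3)] vspace_tspace] cong: SW_cong)

abbreviation aact where "aact \<equiv> act (dual_yd B)"
abbreviation bact where "bact \<equiv> act (self_yd B)"

lemma aact_eq: "h \<in> D \<Longrightarrow> \<beta> \<in> A \<Longrightarrow> aact h \<beta> = DS h (\<lambda>\<mu> m. sw (dual B) \<mu> (\<lambda>\<mu>1 \<mu>2.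
    mul (dual B) (mul (dual B) \<mu>2 (lreg B m \<beta>)) (antip_inv (dual B) \<mu>1)))"
  by (simp add: dual_yd_def dsum_eq_DS)

lemma bact_eq: "h \<in> D \<Longrightarrow> b \<in> C \<Longrightarrow> bact h b = DS h (\<lambda>\<mu> m. SW m (\<lambda>m1 m2.
    rreg_alg B (m1 \<cdot> b \<cdot> S m2) (antip_inv (dual B) \<mu>)))"
  by (simp add: self_yd_def dsum_eq_DS sw_eq_SW cong: DS_cong SW_cong)

lemma aact_closed [simp]: "h \<in> D \<Longrightarrow> \<beta> \<in> A \<Longrightarrow> aact h \<beta> \<in> A"
  by (simp add: aact_eq DS_mem sw_dual_mem)

lemma bact_closed [simp]: "h \<in> D \<Longrightarrow> b \<in> C \<Longrightarrow> bact h b \<in> C"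
  by (simp add: bact_eq DS_mem SW_mem)

lemma ap_aact:
  assumes "h \<in> D" "\<beta> \<in> A" "x \<in> C"
  shows "ap (aact h \<beta>) x = DS h (\<lambda>\<mu> m. SW x (\<lambda>z x3. SW z (\<lambda>x1 x2. ap \<mu> (T x3 \<cdot> x1) * ap \<beta> (x2 \<cdot> m))))"
proof -
  note [cong] = SW_cong DS_cong sw_dual_cong
  show ?thesis
    using assms by (simp add: aact_eq linmap_DS[OF ap_eval vspace_dual] linmap_sw_dual[OF ap_eval vspace_dual]
      sw_dual_mem
      ap_simps dual_out)
qed

lemma ap_bact:
  assumes "h \<in> D" "b \<in> C" "form \<phi>"
  shows "ap \<phi> (bact h b) = DS h (\<lambda>\<mu> m. SW m (\<lambda>m1 m2. SW (m1 \<cdot> b \<cdot> S m2) (\<lambda>c1 c2. ap \<mu> (T c1) * ap \<phi> c2)))"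
proof -
  note [cong] = SW_cong DS_cong
  have lin: "form (ap \<phi>)" using assms by simp
  show ?thesis
    using assms by (simp add: bact_eq linmap_DS[OF lin vspace_B] linmap_SW[OF lin vspace_B] SW_mem rreg_alg_eq ap_scal
      ap_simps)
qed

lemma dtens_inj:
  "\<beta> \<in> A \<Longrightarrow> \<beta>' \<in> A \<Longrightarrow> dtens B \<beta> \<one> = dtens B \<beta>' \<one> \<Longrightarrow> \<beta> = \<beta>'"
  "b \<in> C \<Longrightarrow> b' \<in> C \<Longrightarrow> dtens B (unity (dual B)) b = dtens B (unity (dual B)) b' \<Longrightarrow> b = b'"
proof -
  assume [simp]: "\<beta> \<in> A" "\<beta>' \<in> A" and eq: "dtens B \<beta> \<one> = dtens B \<beta>' \<one>"
  show "\<beta> = \<beta>'"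
  proof (rule dual_eqI)
    fix x assume [simp]: "x \<in> C"
    have "ev x \<epsilon> (dtens B \<beta> \<one>) = ev x \<epsilon> (dtens B \<beta>' \<one>)" by (simp add: eq)
    then show "\<beta> x = \<beta>' x" by (simp add: DS_tens counit_lin) (simp add: ap_def)
  qed simp_all
next
  assume [simp]: "b \<in> C" "b' \<in> C" and eq: "dtens B (unity (dual B)) b = dtens B (unity (dual B)) b'"
  show "b = b'"
  proof (rule separating_eqI[OF separating_forms vspace_B])
    fix \<phi> assume "\<phi> \<in> {\<phi>. form \<phi>}"
    then have [simp]: "form \<phi>" by simp
    have "ev \<one> \<phi> (dtens B (unity (dual B)) b) = ev \<one> \<phi> (dtens B (unity (dual B)) b')" by (simp add: eq)
    then show "\<phi> b = \<phi> b'" by (simp add: DS_tens ap_simps) (simp add: ap_def)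
  qed simp_all
qed

lemma dcomul_tens:
  shows dcomul_dual: "\<beta> \<in> A \<Longrightarrow> dcomul (dtens B \<beta> \<one>) =
      sw (dual B) \<beta> (\<lambda>\<beta>1 \<beta>2. tens (dspace B) (dspace B) (dtens B \<beta>2 \<one>) (dtens B \<beta>1 \<one>))"
    and dcomul_self: "b \<in> C \<Longrightarrow> dcomul (dtens B (unity (dual B)) b) = SW b (\<lambda>b1 b2.
      tens (dspace B) (dspace B) (dtens B (unity (dual B)) b1) (dtens B (unity (dual B)) b2))"
    and "\<beta> \<in> A \<Longrightarrow> b \<in> C \<Longrightarrow> dcomul (dtens B \<beta> b) = sw (dual B) \<beta> (\<lambda>\<beta>1 \<beta>2. SW b (\<lambda>b1 b2.
      tens (dspace B) (dspace B) (dtens B \<beta>2 b1) (dtens B \<beta>1 b2)))"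
proof -
  note [cong] = SW_cong DS_cong sw_dual_cong dsw_cong
  note lin = tsum_linmap[OF vspace_tspace vspace_tspace vspace_scalars bilin_tform[OF ev_lin ev_lin]]
  note rules = lin linmap_sw_dual[OF lin] linmap_SW[OF lin] tsum_tens[OF vspace_scalars bilin_tform[OF ev_lin ev_lin]]
    sw_dual_mem SW_mem tsum_dcomul
  show "dcomul (dtens B \<beta> \<one>) = sw (dual B) \<beta> (\<lambda>\<beta>1 \<beta>2. tens (dspace B) (dspace B) (dtens B \<beta>2 \<one>) (dtens B \<beta>1 \<one>))"
    if "\<beta> \<in> A"
    by (rule double2_eqI; simp add: rules that; simp add: DS_tens dual_out ap_simps SW_one that; (simp add: mult_ac)?)
  show "dcomul (dtens B (unity (dual B)) b) = SW b (\<lambda>b1 b2.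
      tens (dspace B) (dspace B) (dtens B (unity (dual B)) b1) (dtens B (unity (dual B)) b2))"
    if "b \<in> C"
    by (rule double2_eqI; simp add: rules that; simp add: DS_tens dual_out ap_simps that; (simp add: mult_ac)?)
  show "dcomul (dtens B \<beta> b) = sw (dual B) \<beta> (\<lambda>\<beta>1 \<beta>2. SW b (\<lambda>b1 b2.
    tens (dspace B) (dspace B) (dtens B \<beta>2 b1) (dtens B \<beta>1 b2)))" if "\<beta> \<in> A" "b \<in> C"
    by (rule double2_eqI; simp add: rules that; simp add: DS_tens dual_out that; (simp add: mult_ac)?)
qed

lemma cosw_embedding:
  assumes F: "bilin (double B) (heisenberg B) scalars F"
  shows coact_dual_embedding: "\<beta> \<in> A \<Longrightarrow> cosw (double B) (heisenberg B) (dtens B \<beta> \<one>) F =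
      cosw (double B) (dual_yd B) \<beta> (\<lambda>g \<beta>0. F g (dtens B \<beta>0 \<one>))"
    and coact_self_embedding: "b \<in> C \<Longrightarrow> cosw (double B) (heisenberg B) (dtens B (unity (dual B)) b) F =
      cosw (double B) (self_yd B) b (\<lambda>g b0. F g (dtens B (unity (dual B)) b0))"
proof -
  note [cong] = SW_cong sw_dual_cong
  have q: "bilin (dspace B) (dspace B) scalars F"
    using F by (simp add: bilin_def)
  have b: "bilin (dspace B) (dual B) scalars (\<lambda>g \<beta>0. F g (dtens B \<beta>0 \<one>))"
    "bilin (dspace B) B scalars (\<lambda>g b0. F g (dtens B (unity (dual B)) b0))"
    by (intro bilinI linmap_comp[OF bilin_right[OF q]] bilin_left[OF q]; simp add: linmap_id)+
  have lin: "linmap DD scalars (\<lambda>t. tsum (dspace B) (dspace B) t F)"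
    using q by (intro tsum_linmap) simp_all
  note rules = dsw_def dcomul_dual dcomul_self linmap_sw_dual[OF lin vspace_tspace] linmap_SW[OF lin vspace_tspace]
    tsum_tens[OF vspace_scalars q] cosw_heisenberg
  show "cosw (double B) (heisenberg B) (dtens B \<beta> \<one>) F =
      cosw (double B) (dual_yd B) \<beta> (\<lambda>g \<beta>0. F g (dtens B \<beta>0 \<one>))" if "\<beta> \<in> A"
    using that by (simp add: rules cosw_dual_yd[OF that vspace_scalars b(1)])
  show "cosw (double B) (heisenberg B) (dtens B (unity (dual B)) b) F =
      cosw (double B) (self_yd B) b (\<lambda>g b0. F g (dtens B (unity (dual B)) b0))" if "b \<in> C"
    using that by (simp add: rules cosw_self_yd[OF that vspace_scalars b(2)])
qed

lemma embedding_dual: "yd_embedding (double B) (dual_yd B) (heisenberg B) (\<lambda>\<beta>. dtens B \<beta> \<one>)"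
proof
  note [cong] = SW_cong DS_cong sw_dual_cong
  show "yd_module_algebra (double B) (heisenberg B)" by (rule yd_heisenberg)
  show "vspace (dual_yd B)" by simp
  show "linmap (dual_yd B) (heisenberg B) (\<lambda>\<beta>. dtens B \<beta> \<one>)"
    by (simp add: linmap_yd_sel linmap_id)
  show "inj_on (\<lambda>\<beta>. dtens B \<beta> \<one>) (carr (dual_yd B))"
    by (rule inj_onI) (simp add: dtens_inj)
  show "unity (dual_yd B) \<in> carr (dual_yd B)" "dtens B (unity (dual_yd B)) \<one> = unity (heisenberg B)"
    by simp_all
  fix \<alpha> \<beta> assume "\<alpha> \<in> carr (dual_yd B)"  "\<beta> \<in> carr (dual_yd B)"
  then have [simp]: "\<alpha> \<in> A" "\<beta> \<in> A" by simp_all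
  show "mul (dual_yd B) \<alpha> \<beta> \<in> carr (dual_yd B)" by simp
  have "dtens B (mul (dual B) \<alpha> \<beta>) \<one> = hmul (dtens B \<alpha> \<one>) (dtens B \<beta> \<one>)"
  proof (rule double_eqI)
    fix x \<phi> assume [simp]: "x \<in> C" "form \<phi>"
    show "ev x \<phi> (dtens B (mul (dual B) \<alpha> \<beta>) \<one>) = ev x \<phi> (hmul (dtens B \<alpha> \<one>) (dtens B \<beta> \<one>))"
      by (simp add: DS_hmul DS_tens ap_simps SW_one)
  qed simp_all
  then show "dtens B (mul (dual_yd B) \<alpha> \<beta>) \<one> = mul (heisenberg B) (dtens B \<alpha> \<one>) (dtens B \<beta> \<one>)" by simp
next
  note [cong] = SW_cong DS_cong sw_dual_cong
  fix h \<beta> assume "h \<in> carr (double B)" "\<beta> \<in> carr (dual_yd B)"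
  then have [simp]: "h \<in> D" "\<beta> \<in> A" by simp_all
  show "aact h \<beta> \<in> carr (dual_yd B)" by simp
  show "dtens B (aact h \<beta>) \<one> = hact h (dtens B \<beta> \<one>)"
  proof (rule double_eqI)
    fix x \<phi> assume [simp]: "x \<in> C" "form \<phi>"
    show "ev x \<phi> (dtens B (aact h \<beta>) \<one>) = ev x \<phi> (hact h (dtens B \<beta> \<one>))"
      apply (simp add: ev_hact)
      apply (simp add: DS_tens ap_aact DS_out)
      apply (intro DS_cong refl)
      subgoal for \<mu> m
      proof -
        assume [simp]: "\<mu> \<in> A" "m \<in> C"
        have 1: "SW m (\<lambda>m1 w. SW w (\<lambda>m2 m3. SW (m2 \<cdot> S m3) (\<lambda>c1 c2. SW x (\<lambda>z x3. SW z (\<lambda>x1 x2. ap \<mu> (T c1 \<cdot> T x3 \<cdot> x1)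
          * ap \<beta> (x2 \<cdot> m1) * ap \<phi> (c2)))))) =
          SW x (\<lambda>z x3. SW z (\<lambda>x1 x2. ap \<mu> (T x3 \<cdot> x1) * ap \<beta> (x2 \<cdot> m))) * ap \<phi> \<one>"
          by (simp add: ap_collapse SW_arg_S3; (simp add: prenex mult_ac)?)
        show ?thesis
          apply (rule trans[OF _ trans[OF sym[OF 1]]])
          subgoal by ((simp add: counits)?; (simp add: expand)?;
            (simp only: SW_tagged SW_tag[where b=m and i=2] SW_tag[where b=x and i=1])?;
            (simp only: SWt_sort rel_simps)?; (simp only: untag)?; (simp add: SW_nest)?; (simp add: mult_ac)?)
          subgoal by ((simp add: counits)?; (simp add: expand)?;
            (simp only: SW_tagged SW_tag[where b=m and i=2] SW_tag[where b=x and i=1])?;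
            (simp only: SWt_sort rel_simps)?; (simp only: untag)?; (simp add: SW_nest)?; (simp add: mult_ac)?)
          done
      qed
      done
  qed simp_all
next
  fix \<beta> assume "\<beta> \<in> carr (dual_yd B)"
  then have [simp]: "\<beta> \<in> A" by simp
  show "coact (dual_yd B) \<beta> \<in> carr (tspace (double B) (dual_yd B))"
    by (simp add: yd_tens_sel coact_yd_closed)
  show "cosw (double B) (heisenberg B) (dtens B \<beta> \<one>) F =
    cosw (double B) (dual_yd B) \<beta> (\<lambda>g \<beta>0. F g (dtens B \<beta>0 \<one>))"
    if "bilin (double B) (heisenberg B) scalars F" for F
    by (rule coact_dual_embedding) (simp_all add: that)
qed

lemma embedding_self: "yd_embedding (double B) (self_yd B) (heisenberg B) (dtens B (unity (dual B)))"
proof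
  note [cong] = SW_cong DS_cong sw_dual_cong
  show "yd_module_algebra (double B) (heisenberg B)" by (rule yd_heisenberg)
  show "vspace (self_yd B)" by simp
  show "linmap (self_yd B) (heisenberg B) (dtens B (unity (dual B)))"
    using lin_dtens(2)[OF dual_unit_closed linmap_id[of B]] by (simp add: linmap_yd_sel)
  show "inj_on (dtens B (unity (dual B))) (carr (self_yd B))"
    by (rule inj_onI) (simp add: dtens_inj)
  show "unity (self_yd B) \<in> carr (self_yd B)" "dtens B (unity (dual B)) (unity (self_yd B)) = unity (heisenberg B)"
    by simp_all
  fix a b assume "a \<in> carr (self_yd B)"  "b \<in> carr (self_yd B)"
  then have [simp]: "a \<in> C" "b \<in> C" by simp_all
  show "mul (self_yd B) a b \<in> carr (self_yd B)" by simp
  have "dtens B (unity (dual B)) (a \<cdot> b) = hmul (dtens B (unity (dual B)) a) (dtens B (unity (dual B)) b)"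
  proof (rule double_eqI)
    fix x \<phi> assume [simp]: "x \<in> C" "form \<phi>"
    show "ev x \<phi> (dtens B (unity (dual B)) (a \<cdot> b)) = ev x \<phi> (hmul (dtens B (unity (dual B)) a) (dtens B (unity (dual
      B)) b))"
      by (simp add: DS_hmul DS_tens ap_simps; simp add: ap_collapse; (simp add: prenex mult_ac)?)
  qed simp_all
  then show "dtens B (unity (dual B)) (mul (self_yd B) a b) = mul (heisenberg B) (dtens B (unity (dual B)) a) (dtens B
    (unity (dual B)) b)" by simp
next
  note [cong] = SW_cong DS_cong sw_dual_cong
  fix h b assume "h \<in> carr (double B)" "b \<in> carr (self_yd B)"
  then have [simp]: "h \<in> D" "b \<in> C" by simp_all
  show "bact h b \<in> carr (self_yd B)" by simp
  show "dtens B (unity (dual B)) (bact h b) = hact h (dtens B (unity (dual B)) b)"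
  proof (rule double_eqI)
    fix x \<phi> assume [simp]: "x \<in> C" "form \<phi>"
    show "ev x \<phi> (dtens B (unity (dual B)) (bact h b)) = ev x \<phi> (hact h (dtens B (unity (dual B)) b))"
      apply (simp add: ev_hact)
      apply (simp add: DS_tens ap_bact ap_simps DS_out)
      apply (intro DS_cong refl)
      subgoal for \<mu> m
      proof -
        assume [simp]: "\<mu> \<in> A" "m \<in> C"
        have 1: "SW m (\<lambda>m2 m3. SW (m2 \<cdot> b \<cdot> S m3) (\<lambda>c1 c2. SW x (\<lambda>x1 x2. ap \<mu> (T c1 \<cdot> T x2 \<cdot> x1) * ap \<phi> c2))) =
          \<epsilon> x * SW m (\<lambda>m2 m3. SW (m2 \<cdot> b \<cdot> S m3) (\<lambda>c1 c2. ap \<mu> (T c1) * ap \<phi> c2))"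
          by (simp add: ap_collapse; (simp add: prenex mult_ac)?)
        show ?thesis
          apply (rule trans[OF _ trans[OF sym[OF 1]]])
          subgoal by ((simp add: counits)?; (simp add: expand)?;
            (simp only: SW_tagged SW_tag[where b=b and i=3] SW_tag[where b=m and i=2] SW_tag[where b=x and i=1])?;
            (simp only: SWt_sort rel_simps)?; (simp only: untag)?; (simp add: SW_nest)?; (simp add: mult_ac)?)
          subgoal by ((simp add: counits)?; (simp add: expand)?;
            (simp only: SW_tagged SW_tag[where b=b and i=3] SW_tag[where b=m and i=2] SW_tag[where b=x and i=1])?;
            (simp only: SWt_sort rel_simps)?; (simp only: untag)?; (simp add: SW_nest)?; (simp add: mult_ac)?)
          done
      qed
      done
  qed simp_all
next
  fix b assume "b \<in> carr (self_yd B)"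
  then have [simp]: "b \<in> C" by simp
  show "coact (self_yd B) b \<in> carr (tspace (double B) (self_yd B))"
    by (simp add: yd_tens_sel coact_yd_closed)
  show "cosw (double B) (heisenberg B) (dtens B (unity (dual B)) b) F =
    cosw (double B) (self_yd B) b (\<lambda>g b0. F g (dtens B (unity (dual B)) b0))"
    if "bilin (double B) (heisenberg B) scalars F" for F
    by (rule coact_self_embedding) (simp_all add: that)
qed

lemmas yd_dual_yd = yd_embedding.yd_module_algebraX[OF embedding_dual]
lemmas yd_self_yd = yd_embedding.yd_module_algebraX[OF embedding_self]

lemma lin_aact [simp]:
  "\<beta> \<in> A \<Longrightarrow> linmap V (dspace B) g \<Longrightarrow> linmap V (dual B) (\<lambda>z. aact (g z) \<beta>)"
  "\<alpha> \<in> A \<Longrightarrow> linmap V (dual B) f \<Longrightarrow> linmap V (dual B) (\<lambda>z. mul (dual B) \<alpha> (f z))"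
proof -
  have "bilin (double B) (dual_yd B) (dual_yd B) aact" "bilin (dual_yd B) (dual_yd B) (dual_yd B) (mul (dual_yd B))"
    using yd_dual_yd by (simp_all add: yd_module_algebra_def module_algebra_def algebra_def)
  then have *: "\<beta> \<in> A \<Longrightarrow> linmap (dspace B) (dual B) (\<lambda>h. aact h \<beta>)" "\<alpha> \<in> A \<Longrightarrow> linmap (dual B) (dual B) (mul (dual B) \<alpha>)"
    by (simp_all add: bilin_def linmap_yd_sel)
  show "\<beta> \<in> A \<Longrightarrow> linmap V (dspace B) g \<Longrightarrow> linmap V (dual B) (\<lambda>z. aact (g z) \<beta>)"
    "\<alpha> \<in> A \<Longrightarrow> linmap V (dual B) f \<Longrightarrow> linmap V (dual B) (\<lambda>z. mul (dual B) \<alpha> (f z))"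
    using linmap_comp[OF *(1)] linmap_comp[OF *(2)] by blast+
qed

lemma lin_bact [simp]:
  "b \<in> C \<Longrightarrow> linmap V (dspace B) g \<Longrightarrow> linmap V B (\<lambda>z. bact (g z) b)"
proof -
  have "bilin (double B) (self_yd B) (self_yd B) bact"
    using yd_self_yd by (simp add: yd_module_algebra_def module_algebra_def)
  then have *: "b \<in> C \<Longrightarrow> linmap (dspace B) B (\<lambda>h. bact h b)"
    by (simp add: bilin_def linmap_yd_sel)
  show "b \<in> C \<Longrightarrow> linmap V (dspace B) g \<Longrightarrow> linmap V B (\<lambda>z. bact (g z) b)"
    using linmap_comp[OF *] by blast
qed

lemma aact_self:
  assumes [simp]: "m \<in> C" "\<beta> \<in> A"
  shows "aact (dtens B (unity (dual B)) m) \<beta> = lreg B m \<beta>"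
proof (rule dual_eqI)
  note [cong] = SW_cong DS_cong
  fix x assume [simp]: "x \<in> C"
  have "ap (aact (dtens B (unity (dual B)) m) \<beta>) x = ap (lreg B m \<beta>) x"
    by (simp add: ap_aact DS_tens ap_simps; simp add: ap_collapse)
  then show "aact (dtens B (unity (dual B)) m) \<beta> x = lreg B m \<beta> x"
    by (simp add: ap_def)
qed simp_all

lemma bact_dual:
  assumes [simp]: "\<mu> \<in> A" "b \<in> C"
  shows "bact (dtens B \<mu> \<one>) b = rreg_alg B b (antip_inv (dual B) \<mu>)"
proof (rule separating_eqI[OF separating_forms vspace_B])
  note [cong] = SW_cong DS_cong
  fix \<phi> assume "\<phi> \<in> {\<phi>. form \<phi>}"
  then have [simp]: "form \<phi>" by simp
  have "ap \<phi> (bact (dtens B \<mu> \<one>) b) = SW b (\<lambda>b1 b2. ap \<mu> (T b1) * ap \<phi> b2)"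
    by (simp add: ap_bact DS_tens SW_one)
  then show "\<phi> (bact (dtens B \<mu> \<one>) b) = \<phi> (rreg_alg B b (antip_inv (dual B) \<mu>))"
    by (simp add: form_rreg_alg dual_antip_inv_apply ap_def)
qed simp_all

subsection \<open>The braiding\<close>

abbreviation braid_dual_self where "braid_dual_self \<equiv> braiding (double B) (dual_yd B) (self_yd B)"
abbreviation braid_self_dual where "braid_self_dual \<equiv> braiding (double B) (self_yd B) (dual_yd B)"

lemma lin_tens_self_dual:
  "\<beta> \<in> A \<Longrightarrow> linmap V B g \<Longrightarrow> linmap V (tspace B (dual B)) (\<lambda>z. tens B (dual B) (g z) \<beta>)"
  "b \<in> C \<Longrightarrow> linmap V (dual B) g' \<Longrightarrow> linmap V (tspace B (dual B)) (\<lambda>z. tens B (dual B) b (g' z))"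
  using linmap_comp[OF bilin_left[OF tens_bilin[OF vspace_B vspace_dual]]]
    linmap_comp[OF bilin_right[OF tens_bilin[OF vspace_B vspace_dual]]] by blast+

lemma braid_dual_self_eq:
  assumes "t \<in> D"
  shows "braid_dual_self t = DS t (\<lambda>\<beta> b. sw (dual B) \<beta> (\<lambda>\<beta>1 \<beta>2.
    tens B (dual B) (rreg_alg B b (antip_inv (dual B) \<beta>2)) \<beta>1))"
proof -
  note [cong] = DS_cong sw_dual_cong
  have "bilin (dspace B) (dual B) (tspace B (dual B)) (\<lambda>g \<beta>0. tens B (dual B) (bact g b) \<beta>0)" if "b \<in> C" for b
    using that by (intro bilinI lin_tens_self_dual) (simp_all add: linmap_id)
  then show ?thesis
    using assms by (simp add: braiding_def yd_tens_sel dsum_eq_DS cosw_dual_yd[where W="tspace B (dual B)"] bact_dual)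
qed

lemma braid_self_dual_eq:
  assumes "t \<in> carr (tspace B (dual B))"
  shows "braid_self_dual t = tsum B (dual B) t (\<lambda>b \<beta>. SW b (\<lambda>b1 b2. dtens B (lreg B b1 \<beta>) b2))"
proof -
  note [cong] = SW_cong
  have "bilin (dspace B) B (dspace B) (\<lambda>g b0. dtens B (aact g \<beta>) b0)" if "\<beta> \<in> A" for \<beta>
    using that by (intro bilinI) (simp_all add: linmap_id)
  then have "cosw (double B) (self_yd B) b (\<lambda>g b0. dtens B (aact g \<beta>) b0) = SW b (\<lambda>b1 b2. dtens B (lreg B b1 \<beta>) b2)"
    if "b \<in> C" "\<beta> \<in> A" for b \<beta>
    using that by (simp add: cosw_self_yd[where W="dspace B"] aact_self)
  then show ?thesis
    using assms by (simp add: braiding_def yd_tens_sel) (rule tsum_cong; simp)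
qed

lemma braid_closed [simp]:
  "t \<in> D \<Longrightarrow> braid_dual_self t \<in> carr (tspace B (dual B))"
  "t' \<in> carr (tspace B (dual B)) \<Longrightarrow> braid_self_dual t' \<in> D"
proof -
  show "t \<in> D \<Longrightarrow> braid_dual_self t \<in> carr (tspace B (dual B))"
    by (simp add: braid_dual_self_eq DS_mem sw_dual_mem tens_mem)
  show "t' \<in> carr (tspace B (dual B)) \<Longrightarrow> braid_self_dual t' \<in> D"
    unfolding braid_self_dual_eq by (rule tsum_mem) (simp_all add: SW_mem)
qed

lemma tsum_braid_dual_self:
  assumes t: "t \<in> D" and L: "bilin B (dual B) scalars L"
  shows "tsum B (dual B) (braid_dual_self t) L = DS t (\<lambda>\<beta> b. sw (dual B) \<beta> (\<lambda>\<beta>1 \<beta>2.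
    SW b (\<lambda>b1 b2. ap \<beta>2 (T b1) * L b2 \<beta>1)))"
proof -
  note [cong] = DS_cong sw_dual_cong SW_cong
  have L': "L (rreg_alg B b (antip_inv (dual B) \<beta>2)) \<beta>1 = SW b (\<lambda>b1 b2. ap \<beta>2 (T b1) * L b2 \<beta>1)"
    if "b \<in> C" "\<beta>1 \<in> A" "\<beta>2 \<in> A" for b \<beta>1 \<beta>2
    using that form_rreg_alg[OF bilin_left[OF L that(2)] that(1)] by (simp add: dual_antip_inv_apply ap_def)
  have lin: "linmap (tspace B (dual B)) scalars (\<lambda>t. tsum B (dual B) t L)"
    by (rule tsum_linmap) (simp_all add: L)
  show ?thesis
    using t by (simp add: braid_dual_self_eq linmap_DS[OF lin vspace_tspace] linmap_sw_dual[OF lin vspace_tspace]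
      sw_dual_mem tens_mem tsum_tens[OF vspace_scalars L] L')
qed

lemma DS_braid_self_dual:
  assumes t: "t \<in> carr (tspace B (dual B))" and K: "dform K"
  shows "DS (braid_self_dual t) K = tsum B (dual B) t (\<lambda>b \<beta>. SW b (\<lambda>b1 b2. K (lreg B b1 \<beta>) b2))"
proof -
  note [cong] = SW_cong
  have "DS (braid_self_dual t) K = tsum B (dual B) t (\<lambda>b \<beta>. DS (SW b (\<lambda>b1 b2. dtens B (lreg B b1 \<beta>) b2)) K)"
    unfolding braid_self_dual_eq[OF t]
    by (rule linmap_tsum[OF vspace_B t vspace_tspace DS_linmap[OF K]]) (simp add: SW_mem)
  also have "\<dots> = tsum B (dual B) t (\<lambda>b \<beta>. SW b (\<lambda>b1 b2. K (lreg B b1 \<beta>) b2))"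
    by (rule tsum_cong[OF vspace_B t]) (simp add: DS_SW DS_tens K)
  finally show ?thesis .
qed

lemma braid_self_dual_self:
  assumes t [simp]: "t \<in> D"
  shows "braid_self_dual (braid_dual_self t) = t"
proof (rule double_eqI)
  note [cong] = SW_cong DS_cong sw_dual_cong
  fix x \<phi> assume [simp]: "x \<in> C" "form \<phi>"
  have L: "bilin B (dual B) scalars (\<lambda>b \<beta>. SW b (\<lambda>b1 b2. ap \<beta> (x \<cdot> b1) * ap \<phi> b2))"
    by (intro bilinI) (simp_all add: linmap_id)
  have "ev x \<phi> (braid_self_dual (braid_dual_self t)) =
    tsum B (dual B) (braid_dual_self t) (\<lambda>b \<beta>. SW b (\<lambda>b1 b2. ap (lreg B b1 \<beta>) x * ap \<phi> b2))"
    by (simp add: DS_braid_self_dual)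
  also have "\<dots> = tsum B (dual B) (braid_dual_self t) (\<lambda>b \<beta>. SW b (\<lambda>b1 b2. ap \<beta> (x \<cdot> b1) * ap \<phi> b2))"
    by (rule tsum_cong) (simp_all add: ap_simps)
  also have "\<dots> = DS t (\<lambda>\<beta> b. SW b (\<lambda>b1 w. SW w (\<lambda>b2 b3. ap \<beta> (x \<cdot> b2 \<cdot> T b1) * ap \<phi> b3)))"
    by (simp add: tsum_braid_dual_self[OF t L] dual_out)
  also have "\<dots> = DS t (\<lambda>\<beta> b. SW b (\<lambda>w b3. SW w (\<lambda>b1 b2. ap \<beta> (x \<cdot> b2 \<cdot> T b1) * ap \<phi> b3)))"
    by (simp add: SW_coassoc)
  also have "\<dots> = ev x \<phi> t"
    by (simp add: ap_collapse)
  finally show "ev x \<phi> (braid_self_dual (braid_dual_self t)) = ev x \<phi> t" .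
qed simp_all

lemma braid_dual_self_dual:
  assumes t [simp]: "t \<in> carr (tspace B (dual B))"
  shows "braid_dual_self (braid_self_dual t) = t"
proof (rule separating_eqI[OF separating_tens[OF vspace_B vspace_dual separating_forms separating_dual]
  vspace_tspace])
  note [cong] = SW_cong DS_cong sw_dual_cong
  fix p assume "p \<in> {tform B (dual B) p q |p q. p \<in> {\<phi>. form \<phi>} \<and> q \<in> {\<lambda>\<beta>. \<beta> x |x. x \<in> C}}"
  then obtain \<phi> x where [simp]: "x \<in> C" "form \<phi>" and p: "p = tform B (dual B) \<phi> (\<lambda>\<beta>. \<beta> x)"
    by blast
  have p': "p u = tsum B (dual B) u (\<lambda>b \<beta>. ap \<phi> b * ap \<beta> x)" for u
    by (simp add: p tform_def ap_def)
  have L: "bilin B (dual B) scalars (\<lambda>b \<beta>. ap \<phi> b * ap \<beta> x)"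
    by (intro bilinI) (simp_all add: linmap_id)
  have "p (braid_dual_self (braid_self_dual t)) =
    DS (braid_self_dual t) (\<lambda>\<beta> b. SW b (\<lambda>b1 b2. ap \<beta> (x \<cdot> T b1) * ap \<phi> b2))"
    by (simp add: p' tsum_braid_dual_self[OF _ L] dual_out; (simp add: dual_out mult_ac)?)
  also have "\<dots> = tsum B (dual B) t (\<lambda>b \<beta>. SW b (\<lambda>b1 w. SW w (\<lambda>b2 b3. ap (lreg B b1 \<beta>) (x \<cdot> T b2) * ap \<phi> b3)))"
    by (simp add: DS_braid_self_dual)
  also have "\<dots> = p t"
  proof (unfold p', rule tsum_cong)
    fix b \<beta> assume [simp]: "b \<in> C" "\<beta> \<in> A"
    have "SW b (\<lambda>b1 w. SW w (\<lambda>b2 b3. ap (lreg B b1 \<beta>) (x \<cdot> T b2) * ap \<phi> b3)) =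
      SW b (\<lambda>w b3. SW w (\<lambda>b1 b2. ap \<beta> (x \<cdot> T b2 \<cdot> b1) * ap \<phi> b3))"
      by (simp add: ap_simps SW_coassoc)
    also have "\<dots> = ap \<phi> b * ap \<beta> x"
      by (simp add: ap_collapse; (simp add: mult_ac)?)
    finally show "SW b (\<lambda>b1 w. SW w (\<lambda>b2 b3. ap (lreg B b1 \<beta>) (x \<cdot> T b2) * ap \<phi> b3)) = ap \<phi> b * ap \<beta> x" .
  qed simp_all
  finally show "p (braid_dual_self (braid_self_dual t)) = p t" .
qed simp_all

lemma braided_symmetric_dual_self: "braided_symmetric (double B) (dual_yd B) (self_yd B)"
proof -
  have bij: "bij_betw braid_self_dual (carr (tspace B (dual B))) D"
    by (rule bij_betw_byWitness[of _ braid_dual_self]) (auto simp: braid_self_dual_self braid_dual_self_dual)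
  have "braid_dual_self t = inv_into (carr (tspace B (dual B))) braid_self_dual t" if "t \<in> D" for t
    by (rule inv_into_f_eq[symmetric]) (use that bij in \<open>simp_all add: bij_betw_def braid_self_dual_self\<close>)
  with bij show ?thesis
    by (simp add: braided_symmetric_def yd_tens_sel)
qed

subsection \<open>The Heisenberg double as a braided product\<close>

abbreviation bprod where "bprod \<equiv> braided_product (double B) (dual_yd B) (self_yd B)"

lemma mul_bprod:
  assumes [simp]: "s \<in> D" "t \<in> D"
  shows "mul bprod s t = hmul s t"
proof -
  note [cong] = DS_cong SW_cong
  have "bilin (dspace B) B (dspace B) (\<lambda>g y0. dtens B (mul (dual B) x (aact g v)) (y0 \<cdot> u))"
    if "x \<in> A" "v \<in> A" "u \<in> C" for x v u
    using that by (intro bilinI) (simp_all add: linmap_id)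
  then show ?thesis
    by (simp add: braided_product_def yd_tens_sel dsum_eq_DS cosw_self_yd[where W="dspace B"] aact_self hmul_eq)
qed

lemma DS_DS_swap: "DS s (\<lambda>\<alpha> a. DS t (\<lambda>\<beta> b. f \<alpha> a \<beta> b)) = DS t (\<lambda>\<beta> b. DS s (\<lambda>\<alpha> a. f \<alpha> a \<beta> b))"
  by (auto simp: DS_def tsum_zero intro: tsum_swap)

lemma act_bprod:
  assumes [simp]: "h \<in> D" "t \<in> D"
  shows "act bprod h t = hact h t"
proof -
  have eq: "act bprod h t = DS t (\<lambda>\<alpha> a. dsw h (\<lambda>h1 h2. dtens B (aact h1 \<alpha>) (bact h2 a)))"
    by (simp add: braided_product_def yd_tens_sel dsum_eq_DS sw_double)
  show ?thesis
  proof (rule double_eqI)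
    note [cong] = SW_cong DS_cong sw_dual_cong dsw_cong
    fix x \<phi> assume [simp]: "x \<in> C" "form \<phi>"
    have lin: "linmap V scalars (\<lambda>z. ap (f z) x)" if "linmap V (dual B) f" for f and V :: "('k, 'z::ab_group_add, 'w)
      vs_scheme"
      by (rule linmap_comp[OF ap_eval that])
    have "ev x \<phi> (act bprod h t) = DS t (\<lambda>\<alpha> a. dsw h (\<lambda>h1 h2. ap (aact h1 \<alpha>) x * ap \<phi> (bact h2 a)))"
      by (simp add: eq DS_DS dsw_mem linmap_dsw[OF ev_lin vspace_tspace]; simp add: DS_tens)
    also have "\<dots> = DS t (\<lambda>\<alpha> a. DS h (\<lambda>\<mu> m. sw (dual B) \<mu> (\<lambda>\<mu>1 \<mu>2. SW m (\<lambda>m1 m2.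
        ap (aact (dtens B \<mu>2 m1) \<alpha>) x * ap \<phi> (bact (dtens B \<mu>1 m2) a)))))"
      by (simp add: dsw_eq lin linmap_id)
    also have "\<dots> = DS h (\<lambda>\<mu> m. DS t (\<lambda>\<alpha> a. sw (dual B) \<mu> (\<lambda>\<mu>1 \<mu>2. SW m (\<lambda>m1 m2.
        ap (aact (dtens B \<mu>2 m1) \<alpha>) x * ap \<phi> (bact (dtens B \<mu>1 m2) a)))))"
      by (rule DS_DS_swap)
    also have "\<dots> = ev x \<phi> (hact h t)"
      apply (simp add: ev_hact ap_aact ap_bact DS_tens dual_out)
      apply (intro DS_cong refl)
      subgoal for \<mu> m \<alpha> a
        by ((simp add: counits)?; (simp add: expand)?;
          (simp only: SW_tagged SW_tag[where b=a and i=3] SW_tag[where b=m and i=2] SW_tag[where b=x and i=1])?;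
          (simp only: SWt_sort rel_simps)?; (simp only: untag)?; (simp add: SW_nest)?; (simp add: mult_ac)?)
      done
    finally show "ev x \<phi> (act bprod h t) = ev x \<phi> (hact h t)" .
  qed (simp_all add: eq DS_mem dsw_mem)
qed

lemma coact_bprod:
  assumes [simp]: "t \<in> D"
  shows "coact bprod t = coact (heisenberg B) t"
proof -
  note [cong] = DS_cong SW_cong sw_dual_cong
  let ?t = "tens (dspace B) (dspace B)"
  have lt: "linmap V DD (\<lambda>z. ?t (g z) h)" "linmap V DD (\<lambda>z. ?t h (g z))"
    if "h \<in> D" "linmap V (dspace B) g" for g h and V :: "('k, 'z::ab_group_add, 'w) vs_scheme"
    using linmap_comp[OF bilin_left[OF tens_bilin[OF vspace_tspace vspace_tspace]] that(2)]
      linmap_comp[OF bilin_right[OF tens_bilin[OF vspace_tspace vspace_tspace]] that(2)] that(1) by blast+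
  have SW_lin: "linmap V DD (\<lambda>z. SW b (f z))" if "b \<in> C" "\<And>u v. u \<in> C \<Longrightarrow> v \<in> C \<Longrightarrow> linmap V DD (\<lambda>z. f z u v)"
    for b f and V :: "('k, 'z::ab_group_add, 'w) vs_scheme"
    using that by (simp add: SW_tsum linmap_tsum_fun)
  have 1: "cosw (double B) (self_yd B) y (\<lambda>h y0. ?t (double_mul B g h) (dtens B x0 y0)) =
      SW y (\<lambda>b1 b2. ?t (double_mul B g (dtens B (unity (dual B)) b1)) (dtens B x0 b2))"
    if "y \<in> C" "g \<in> D" "x0 \<in> A" for y g x0
    using that by (intro cosw_self_yd[where W=DD] bilinI lt) (simp_all add: linmap_id)
  have 2: "cosw (double B) (dual_yd B) x (\<lambda>g x0. cosw (double B) (self_yd B) y (\<lambda>h y0. ?t (double_mul B g h) (dtens B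
    x0 y0))) =
      sw (dual B) x (\<lambda>\<beta>1 \<beta>2. SW y (\<lambda>b1 b2. ?t (dtens B \<beta>2 b1) (dtens B \<beta>1 b2)))"
    if "x \<in> A" "y \<in> C" for x y
  proof -
    have "cosw (double B) (dual_yd B) x (\<lambda>g x0. cosw (double B) (self_yd B) y (\<lambda>h y0. ?t (double_mul B g h) (dtens B
      x0 y0))) =
      cosw (double B) (dual_yd B) x (\<lambda>g x0. SW y (\<lambda>b1 b2. ?t (double_mul B g (dtens B (unity (dual B)) b1)) (dtens B
        x0 b2)))"
      unfolding cosw_def[of _ "dual_yd B"] yd_tens_sel
      by (rule tsum_cong[OF vspace_tspace coact_yd_closed(1)[OF that(1)]]) (rule 1, simp_all add: that)
    also have "\<dots> = sw (dual B) x (\<lambda>\<beta>1 \<beta>2. SW y (\<lambda>b1 b2.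
        ?t (double_mul B (dtens B \<beta>2 \<one>) (dtens B (unity (dual B)) b1)) (dtens B \<beta>1 b2)))"
      using that by (intro cosw_dual_yd[where W=DD] bilinI SW_lin lt) (simp_all add: linmap_id)
    also have "\<dots> = sw (dual B) x (\<lambda>\<beta>1 \<beta>2. SW y (\<lambda>b1 b2. ?t (dtens B \<beta>2 b1) (dtens B \<beta>1 b2)))"
      using that by (simp flip: dtens_split)
    finally show ?thesis .
  qed
  have "tens (double B) (dspace B) = ?t"
    by (intro tens_vs_cong) simp_all
  then show ?thesis
    by (simp add: coact_heisenberg dcomul_def braided_product_def yd_tens_sel dsum_eq_DS 2)
qed

lemma same_heisenberg_bprod: "same_yd_algebra (double B) (heisenberg B) bprod"
  unfolding same_yd_algebra_def
proof (intro conjI ballI)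
  show "carr (heisenberg B) = carr bprod" "scal (heisenberg B) = scal bprod" "unity (heisenberg B) = unity bprod"
    by (simp_all add: braided_product_def yd_tens_sel)
qed (simp_all add: mul_bprod act_bprod coact_bprod)

end

theorem mainTheorem3:
  fixes B :: "('k::field, 'b::ab_group_add) hopf"
  assumes "hopf_algebra_bij B"
  shows
    "(yd_module_algebra (double B) (dual_yd B) \<and>
      yd_module_algebra (double B) (self_yd B) \<and>
      braided_commutative (double B) (dual_yd B) \<and>
      braided_commutative (double B) (self_yd B)) \<and>
     braided_symmetric (double B) (dual_yd B) (self_yd B) \<and>
     (same_yd_algebra (double B) (heisenberg B)
        (braided_product (double B) (dual_yd B) (self_yd B)) \<and>
      yd_module_algebra (double B) (heisenberg B) \<and>
      braided_commutative (double B) (heisenberg B))"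
proof -
  interpret hopf_bij B by (rule hopf_bij.intro[OF assms])
  show ?thesis
    by (intro conjI yd_dual_yd yd_self_yd braided_symmetric_dual_self same_heisenberg_bprod yd_heisenberg
      braided_commutative_heisenberg yd_embedding.braided_commutativeX[OF embedding_dual]
      yd_embedding.braided_commutativeX[OF embedding_self])
qed

end
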